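(* For every fine-labelled rooted tree $\mathfrak{g}=(\Gamma,lb)$, the scheme $V_{\mathfrak{g}}=\mathrm{Spec}(B_{\mathfrak{g}})$ is a generalized Danielewski surface over $Z=\mathrm{Spec}(\mathbb{C}[h])$ for the morphism $q_{\mathfrak{g}}:V_{\mathfrak{g}}\to Z$ induced by the inclusion $\mathbb{C}[h]\hookrightarrow B_{\mathfrak{g}}$.
   Context: GDS. A generalized Danielewski surface (GDS) over $Z\simeq\mathbb{A}^1_{\mathbb{C}}$ is a normal affine complex surface $V$ together with a faithfully flat morphism $q:V\to Z$ with reduced fibers and generic fiber isomorphic to $\mathbb{A}^1_{K(Z)}$ ($K(Z)$ the function field of $Z$), such that all but possibly one closed fiber are integral. Trees. A rooted tree $\Gamma$ is a nonempty finite poset $(N(\Gamma),\le)$ with a unique minimal element $e_0$ (the root) such that $(\downarrow e)=\{e'\le e\}$ is a chain for every node $e$. Maximal elements are the leaves, $\mathrm{Leaves}(\Gamma)$; $\mathbf{P}(\Gamma)=N(\Gamma)\setminus\mathrm{Leaves}(\Gamma)$. $\mathrm{Anc}(e)=(\downarrow e)\setminus\{e\}$; for $e\ne e_0$, $\mathrm{Par}(e)$ is the maximal element of $\mathrm{Anc}(e)$. $\mathrm{Child}(e)$ is the set of minimal elements of $\{e'>e\}$. A fine-labelled rooted tree $\mathfrak{g}=(\Gamma,lb)$ is a rooted tree with a function $lb:N(\Gamma)\setminus\{e_0\}\to\mathbb{C}$ such that $lb(f)\ne lb(f')$ for distinct nodes $f,f'$ with the same parent. The scheme $V_{\mathfrak{g}}$.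 Let $A=\mathbb{C}[h]$ (polynomial ring in one variable), $Z=\mathrm{Spec}(A)$. $A[\Gamma]$ is the polynomial ring over $A$ in the variables $X_0$ and $X_e$, $e\in\mathbf{P}(\Gamma)$. Convention: $X_{\mathrm{Par}(e_0)}:=X_0$. For $e\in\mathbf{P}(\Gamma)$ and $J\subset\mathrm{Child}(e)$ put $S_e^J=\prod_{g\in\mathrm{Child}(e)\setminus J}(X_{\mathrm{Par}(e)}-lb(g))$ and $S_e=S_e^{\emptyset}$. Put $R_{e_0}=1$, and recursively $R_e=S_{\mathrm{Par}(e)}^{\{e\}}R_{\mathrm{Par}(e)}$ for $e\ne e_0$; for $e\in\mathbf{P}(\Gamma)$ put $Q_e=S_eR_e$. $I_{\mathfrak{g}}\subset A[\Gamma]$ is the ideal generated by $\Delta_{0,e}=hX_e-Q_e$ ($e\in\mathbf{P}(\Gamma)$) and $\Delta_{e',e}=R_{e''}^{-1}(Q_{e'}X_e-Q_eX_{e'})=(X_{\mathrm{Par}(e')}-lb(e''))X_e-X_{e'}\,(Q_e/R_{e''})$ for $e\in\mathbf{P}(\Gamma)$, $e'\in\mathrm{Anc}(e)$, where $e''$ is the unique element of $\mathrm{Child}(e')\cap(\downarrow e)$. Put $B_{\mathfrak{g}}=A[\Gamma]/I_{\mathfrak{g}}$, $V_{\mathfrak{g}}=\mathrm{Spec}(B_{\mathfrak{g}})$. *)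

theory Defs
  imports
    "HOL-Computational_Algebra.Polynomial"
    "HOL-Library.Poly_Mapping"
    "HOL-Library.Extended_Nat"
    "HOL-Algebra.UnivPoly"
    "HOL-Algebra.QuotRing"
    "HOL-Algebra.Generated_Rings"
    "HOL-Algebra.Free_Abelian_Groups"
    "HOL-Algebra.Algebraic_Closure_Type"
begin

section \<open>Commutative algebra\<close>

subsection \<open>Localization and integral closure\<close>

definition fraction :: "('a, 'x) ring_scheme \<Rightarrow> 'a set \<Rightarrow> 'a \<Rightarrow> 'a \<Rightarrow> ('a \<times> 'a) set" where
  "fraction R S a s =
     {(b, t). b \<in> carrier R \<and> t \<in> S \<and>
        (\<exists>u\<in>S. u \<otimes>\<^bsub>R\<^esub> (a \<otimes>\<^bsub>R\<^esub> t) = u \<otimes>\<^bsub>R\<^esub> (b \<otimes>\<^bsub>R\<^esub> s))}"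

text \<open>As for cosets, the operations are unions over all representatives. They are the usual
  ones when \<open>S\<close> is a multiplicative subset of the commutative ring \<open>R\<close>.\<close>

definition localization :: "('a, 'x) ring_scheme \<Rightarrow> 'a set \<Rightarrow> ('a \<times> 'a) set ring" where
  "localization R S =
     \<lparr>carrier = {fraction R S a s | a s. a \<in> carrier R \<and> s \<in> S},
      monoid.mult = (\<lambda>U V. \<Union>{fraction R S (a \<otimes>\<^bsub>R\<^esub> b) (s \<otimes>\<^bsub>R\<^esub> t) | a s b t. (a, s) \<in> U \<and> (b, t) \<in> V}),
      one = fraction R S \<one>\<^bsub>R\<^esub> \<one>\<^bsub>R\<^esub>,
      ring.zero = fraction R S \<zero>\<^bsub>R\<^esub> \<one>\<^bsub>R\<^esub>,
      add = (\<lambda>U V. \<Union>{fraction R S (a \<otimes>\<^bsub>R\<^esub> t \<oplus>\<^bsub>R\<^esub> b \<otimes>\<^bsub>R\<^esub> s) (s \<otimes>\<^bsub>R\<^esub> t) | a s b t.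
               (a, s) \<in> U \<and> (b, t) \<in> V})\<rparr>"

definition nonzero_elements :: "('a, 'x) ring_scheme \<Rightarrow> 'a set" where
  "nonzero_elements R = carrier R - {\<zero>\<^bsub>R\<^esub>}"

definition fraction_field :: "('a, 'x) ring_scheme \<Rightarrow> ('a \<times> 'a) set ring" where
  "fraction_field R = localization R (nonzero_elements R)"

definition integral_over ::
  "('a, 'x) ring_scheme \<Rightarrow> ('a \<Rightarrow> 'b) \<Rightarrow> ('b, 'y) ring_scheme \<Rightarrow> 'b \<Rightarrow> bool" where
  "integral_over R \<iota> L x \<longleftrightarrow>
     (\<exists>(n::nat) c. (\<forall>i<n. c i \<in> carrier R) \<and>
        x [^]\<^bsub>L\<^esub> n \<oplus>\<^bsub>L\<^esub> (\<Oplus>\<^bsub>L\<^esub>i\<in>{..<n}. \<iota> (c i) \<otimes>\<^bsub>L\<^esub> x [^]\<^bsub>L\<^esub> i) = \<zero>\<^bsub>L\<^esub>)"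

definition normal_domain :: "('a, 'x) ring_scheme \<Rightarrow> bool" where
  "normal_domain R \<longleftrightarrow> domain R \<and>
     (let \<iota> = (\<lambda>a. fraction R (nonzero_elements R) a \<one>\<^bsub>R\<^esub>) in
        \<forall>x\<in>carrier (fraction_field R).
          integral_over R \<iota> (fraction_field R) x \<longrightarrow> x \<in> \<iota> ` carrier R)"

subsection \<open>Dimension, reducedness, finite generation\<close>

definition krull_dim :: "('a, 'x) ring_scheme \<Rightarrow> enat" where
  "krull_dim R = Sup {enat n | n. \<exists>P. (\<forall>i\<le>n. primeideal (P i) R) \<and> (\<forall>i<n. P i \<subset> P (Suc i))}"

definition reduced_ring :: "('a, 'x) ring_scheme \<Rightarrow> bool" where
  "reduced_ring R \<longleftrightarrow>
     (\<forall>x\<in>carrier R. \<forall>n::nat. x [^]\<^bsub>R\<^esub> n = \<zero>\<^bsub>R\<^esub> \<longrightarrow> x = \<zero>\<^bsub>R\<^esub>)"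

definition finitely_generated_over :: "'a set \<Rightarrow> ('a, 'x) ring_scheme \<Rightarrow> bool" where
  "finitely_generated_over K R \<longleftrightarrow>
     (\<exists>F. finite F \<and> F \<subseteq> carrier R \<and> generate_ring R (K \<union> F) = carrier R)"

subsection \<open>Tensor products and flatness\<close>

definition restrict_scalars ::
  "('a \<Rightarrow> 'b) \<Rightarrow> ('b, 'y) ring_scheme \<Rightarrow> ('a, 'b) module" where
  "restrict_scalars \<phi> B =
     \<lparr>carrier = carrier B, monoid.mult = monoid.mult B, one = one B,
      ring.zero = ring.zero B, add = add B,
      module.smult = (\<lambda>a b. \<phi> a \<otimes>\<^bsub>B\<^esub> b)\<rparr>"

text \<open>The tensor product is the free abelian group on \<open>M \<times> N\<close> (written multiplicatively in the
  library) modulo the bilinearity relations.\<close>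

definition tensor_relations ::
  "('a, 'x) ring_scheme \<Rightarrow> ('a, 'm) module \<Rightarrow> ('a, 'n) module \<Rightarrow> ('m \<times> 'n \<Rightarrow>\<^sub>0 int) set" where
  "tensor_relations A M N =
     generate (free_Abelian_group (carrier M \<times> carrier N))
      ({frag_of (m \<oplus>\<^bsub>M\<^esub> m', n) - frag_of (m, n) - frag_of (m', n) | m m' n.
          m \<in> carrier M \<and> m' \<in> carrier M \<and> n \<in> carrier N}
       \<union> {frag_of (m, n \<oplus>\<^bsub>N\<^esub> n') - frag_of (m, n) - frag_of (m, n') | m n n'.
          m \<in> carrier M \<and> n \<in> carrier N \<and> n' \<in> carrier N}
       \<union> {frag_of (a \<odot>\<^bsub>M\<^esub> m, n) - frag_of (m, a \<odot>\<^bsub>N\<^esub> n) | a m n.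
          a \<in> carrier A \<and> m \<in> carrier M \<and> n \<in> carrier N})"

definition tensor_product ::
  "('a, 'x) ring_scheme \<Rightarrow> ('a, 'm) module \<Rightarrow> ('a, 'n) module \<Rightarrow> ('m \<times> 'n \<Rightarrow>\<^sub>0 int) set monoid"
  where
  "tensor_product A M N =
     free_Abelian_group (carrier M \<times> carrier N) Mod tensor_relations A M N"

text \<open>The map \<open>f \<otimes> id : M \<otimes> N \<rightarrow> M' \<otimes> N\<close>.\<close>

definition tensor_map_left ::
  "('a, 'x) ring_scheme \<Rightarrow> ('m \<Rightarrow> 'm') \<Rightarrow> ('a, 'm') module \<Rightarrow> ('a, 'n) module
     \<Rightarrow> ('m \<times> 'n \<Rightarrow>\<^sub>0 int) set \<Rightarrow> ('m' \<times> 'n \<Rightarrow>\<^sub>0 int) set" where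
  "tensor_map_left A f M' N U =
     (\<Union>x\<in>U. tensor_relations A M' N
        #>\<^bsub>free_Abelian_group (carrier M' \<times> carrier N)\<^esub>
           frag_extend (\<lambda>(m, n). frag_of (f m, n)) x)"

definition linear_map ::
  "('a, 'x) ring_scheme \<Rightarrow> ('a, 'm) module \<Rightarrow> ('a, 'm') module \<Rightarrow> ('m \<Rightarrow> 'm') \<Rightarrow> bool" where
  "linear_map A M M' f \<longleftrightarrow> f \<in> carrier M \<rightarrow> carrier M' \<and>
     (\<forall>x\<in>carrier M. \<forall>y\<in>carrier M. f (x \<oplus>\<^bsub>M\<^esub> y) = f x \<oplus>\<^bsub>M'\<^esub> f y) \<and>
     (\<forall>a\<in>carrier A. \<forall>x\<in>carrier M. f (a \<odot>\<^bsub>M\<^esub> x) = a \<odot>\<^bsub>M'\<^esub> f x)"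

text \<open>HOL cannot quantify over all modules inside a formula, so the type of the elements of the
  test modules is a parameter. Flatness is the assertion of this predicate for an arbitrary
  type \<open>'m\<close>; two modules over different types embed into the sum type, so one type is enough
  for source and target.\<close>

definition flat ::
  "'m itself \<Rightarrow> ('a, 'x) ring_scheme \<Rightarrow> ('a, 'n) module \<Rightarrow> bool" where
  "flat _ A N \<longleftrightarrow>
     (\<forall>(M :: ('a, 'm) module) (M' :: ('a, 'm) module) f.
        module A M \<and> module A M' \<and> linear_map A M M' f \<and> inj_on f (carrier M) \<longrightarrow>
        inj_on (tensor_map_left A f M' N) (carrier (tensor_product A M N)))"

text \<open>A morphism of schemes is faithfully flat if it is flat and surjective.\<close>

definition spec_surjective ::
  "('a, 'x) ring_scheme \<Rightarrow> ('b, 'y) ring_scheme \<Rightarrow> ('a \<Rightarrow> 'b) \<Rightarrow> bool" where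
  "spec_surjective A B \<phi> \<longleftrightarrow>
     (\<forall>p. primeideal p A \<longrightarrow> (\<exists>P. primeideal P B \<and> {a \<in> carrier A. \<phi> a \<in> P} = p))"

definition faithfully_flat ::
  "'m itself \<Rightarrow> ('a, 'x) ring_scheme \<Rightarrow> ('b, 'y) ring_scheme \<Rightarrow> ('a \<Rightarrow> 'b) \<Rightarrow> bool" where
  "faithfully_flat T A B \<phi> \<longleftrightarrow> flat T A (restrict_scalars \<phi> B) \<and> spec_surjective A B \<phi>"

subsection \<open>Fibers\<close>

text \<open>For \<open>\<phi> : A \<rightarrow> B\<close> with \<open>A\<close> a domain with fraction field \<open>K\<close>, the fiber over the generic
  point is the spectrum of \<open>B \<otimes> K\<close>, the localization of \<open>B\<close> at the image of the nonzero
  elements of \<open>A\<close>; the fiber over a maximal ideal \<open>m\<close> is the spectrum of \<open>B \<otimes> A/m = B/mB\<close>.\<close>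

definition generic_fiber ::
  "('a, 'x) ring_scheme \<Rightarrow> ('b, 'y) ring_scheme \<Rightarrow> ('a \<Rightarrow> 'b) \<Rightarrow> ('b \<times> 'b) set ring" where
  "generic_fiber A B \<phi> = localization B (\<phi> ` nonzero_elements A)"

definition closed_fiber ::
  "('b, 'y) ring_scheme \<Rightarrow> ('a \<Rightarrow> 'b) \<Rightarrow> 'a set \<Rightarrow> 'b set ring" where
  "closed_fiber B \<phi> m = B Quot (Idl\<^bsub>B\<^esub> (\<phi> ` m))"

text \<open>The generic fiber is isomorphic to the affine line over \<open>K\<close>, as a scheme over \<open>K\<close>: the ring
  isomorphism onto \<open>K[t]\<close> is compatible with the structure map \<open>a/s \<mapsto> \<phi> a/\<phi> s\<close> from \<open>K\<close>.\<close>

definition generic_fiber_is_affine_line ::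
  "('a, 'x) ring_scheme \<Rightarrow> ('b, 'y) ring_scheme \<Rightarrow> ('a \<Rightarrow> 'b) \<Rightarrow> bool" where
  "generic_fiber_is_affine_line A B \<phi> \<longleftrightarrow>
     (\<exists>\<theta>. \<theta> \<in> ring_iso (generic_fiber A B \<phi>) (UP (fraction_field A)) \<and>
        (\<forall>a\<in>carrier A. \<forall>s\<in>nonzero_elements A.
           \<theta> (fraction B (\<phi> ` nonzero_elements A) (\<phi> a) (\<phi> s)) =
           up_ring.monom (UP (fraction_field A)) (fraction A (nonzero_elements A) a s) 0))"

section \<open>Generalized Danielewski surfaces over the affine line\<close>

abbreviation Ch :: "complex poly ring" where
  "Ch \<equiv> ring_of_type_algebra"

text \<open>An affine scheme over \<open>Spec (\<complex>[h])\<close> is given by a ring \<open>B\<close> and a homomorphism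
  \<open>\<phi> : \<complex>[h] \<rightarrow> B\<close>, and \<open>\<phi>\<close> also gives the complex structure on \<open>B\<close>. The points of
  \<open>Spec (\<complex>[h])\<close> are the generic one and the maximal ideals.\<close>

definition affine_complex_surface ::
  "('b, 'y) ring_scheme \<Rightarrow> (complex poly \<Rightarrow> 'b) \<Rightarrow> bool" where
  "affine_complex_surface B \<phi> \<longleftrightarrow>
     domain B \<and> finitely_generated_over (range (\<lambda>c. \<phi> [:c:])) B \<and> krull_dim B = 2"

definition generalized_danielewski_surface ::
  "'m itself \<Rightarrow> ('b, 'y) ring_scheme \<Rightarrow> (complex poly \<Rightarrow> 'b) \<Rightarrow> bool" where
  "generalized_danielewski_surface T B \<phi> \<longleftrightarrow>
     \<phi> \<in> ring_hom Ch B \<and>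
     affine_complex_surface B \<phi> \<and> normal_domain B \<and>
     faithfully_flat T Ch B \<phi> \<and>
     reduced_ring (generic_fiber Ch B \<phi>) \<and>
     (\<forall>m. maximalideal m Ch \<longrightarrow> reduced_ring (closed_fiber B \<phi> m)) \<and>
     generic_fiber_is_affine_line Ch B \<phi> \<and>
     (\<forall>m m'. maximalideal m Ch \<and> maximalideal m' Ch \<and>
        \<not> domain (closed_fiber B \<phi> m) \<and> \<not> domain (closed_fiber B \<phi> m') \<longrightarrow> m = m')"

section \<open>Rooted trees\<close>

locale rooted_tree =
  fixes N :: "'a set" and le :: "'a rel" and root :: 'a
  assumes finite_nodes: "finite N"
    and nodes_nonempty: "N \<noteq> {}"
    and order: "partial_order_on N le"
    and unique_minimal: "{e \<in> N. \<forall>x\<in>N. (x, e) \<in> le \<longrightarrow> x = e} = {root}"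
    and down_chain: "e \<in> N \<Longrightarrow> total_on {x \<in> N. (x, e) \<in> le} le"
begin

definition down :: "'a \<Rightarrow> 'a set" where
  "down e = {x \<in> N. (x, e) \<in> le}"

definition Leaves :: "'a set" where
  "Leaves = {e \<in> N. \<forall>x\<in>N. (e, x) \<in> le \<longrightarrow> x = e}"

definition Parents :: "'a set" where
  "Parents = N - Leaves"

definition Anc :: "'a \<Rightarrow> 'a set" where
  "Anc e = down e - {e}"

definition Par :: "'a \<Rightarrow> 'a" where
  "Par e = (THE p. p \<in> Anc e \<and> (\<forall>x\<in>Anc e. (p, x) \<in> le \<longrightarrow> x = p))"

definition Child :: "'a \<Rightarrow> 'a set" where
  "Child e = {c \<in> N. (e, c) \<in> le \<and> c \<noteq> e \<and>
     (\<forall>x\<in>N. (e, x) \<in> le \<and> x \<noteq> e \<and> (x, c) \<in> le \<longrightarrow> x = c)}"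

lemma Par_in_Anc:
  assumes "e \<in> N" "e \<noteq> root"
  shows "Par e \<in> Anc e"
proof -
  have po: "refl_on N le" "trans le" "antisym le" "le \<subseteq> N \<times> N"
    using partial_order_onD[OF order] by auto
  have fin: "finite (Anc e)"
    using finite_nodes by (auto simp: Anc_def down_def)
  have ne: "Anc e \<noteq> {}"
    proof
    assume "Anc e = {}"
    then have "e \<in> {e \<in> N. \<forall>x\<in>N. (x, e) \<in> le \<longrightarrow> x = e}"
      using assms(1) by (auto simp: Anc_def down_def)
    then show False using unique_minimal assms(2) by blast
  qed
  have tot: "(x, y) \<in> le \<or> (y, x) \<in> le" if "x \<in> Anc e" "y \<in> Anc e" for x y
  proof (cases "x = y")
    case True
    then show ?thesis using that po(1) by (auto simp: Anc_def down_def intro: refl_onD)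
  next
    case False
    then show ?thesis using down_chain[OF assms(1)] that
      by (simp add: total_on_def Anc_def down_def)
  qed
  have "\<exists>p\<in>F. \<forall>x\<in>F. (x, p) \<in> le" if "finite F" "F \<noteq> {}" "F \<subseteq> Anc e" for F
    using that
  proof (induction F rule: finite_ne_induct)
    case (singleton x)
    then show ?case using tot[of x x] by simp
  next
    case (insert x F)
    then obtain p where p: "p \<in> F" "\<forall>y\<in>F. (y, p) \<in> le" by auto
    show ?case
    proof (cases "(x, p) \<in> le")
      case True
      then show ?thesis using p by (intro bexI[of _ p]) simp_all
    next
      case False
      have "x \<in> Anc e" "p \<in> Anc e" using insert.prems p(1) by auto
      then have px: "(p, x) \<in> le" and xx: "(x, x) \<in> le"
        using tot[of x x] tot[of x p] False by simp_all
      have "\<forall>y\<in>insert x F. (y, x) \<in> le"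
        using xx p(2) transD[OF po(2) _ px] by simp
      then show ?thesis by blast
    qed
  qed
  from this[OF fin ne] obtain p where p: "p \<in> Anc e" "\<forall>x\<in>Anc e. (x, p) \<in> le" by auto
  have "Par e = p"
    unfolding Par_def
  proof (rule the_equality)
    show "p \<in> Anc e \<and> (\<forall>x\<in>Anc e. (p, x) \<in> le \<longrightarrow> x = p)"
      using p antisymD[OF po(3)] by simp
  next
    fix q assume q: "q \<in> Anc e \<and> (\<forall>x\<in>Anc e. (q, x) \<in> le \<longrightarrow> x = q)"
    then have "(q, p) \<in> le" using p(2) by simp
    then show "q = p" using q p(1) by metis
  qed
  then show ?thesis using p(1) by simp
qed

lemma card_Anc_Par:
  assumes "e \<in> N" "e \<noteq> root"
  shows "card (Anc (Par e)) < card (Anc e)"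
proof -
  have po: "trans le" "antisym le"
    using partial_order_onD[OF order] by auto
  have P: "Par e \<in> Anc e" using Par_in_Anc[OF assms] .
  have "Anc (Par e) \<subset> Anc e"
  proof
    show "Anc (Par e) \<subseteq> Anc e"
    proof
      fix x assume "x \<in> Anc (Par e)"
      then have x: "x \<in> N" "(x, Par e) \<in> le" "x \<noteq> Par e"
        by (auto simp: Anc_def down_def)
      have p: "(Par e, e) \<in> le" using P by (simp add: Anc_def down_def)
      have "(x, e) \<in> le" using transD[OF po(1) x(2) p] .
      moreover have "x \<noteq> e" using antisymD[OF po(2) x(2)] p x(3) by blast
      ultimately show "x \<in> Anc e" using x(1) by (simp add: Anc_def down_def)
    qed
    show "Anc (Par e) \<noteq> Anc e"
      using P by (auto simp: Anc_def)
  qed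
  moreover have "finite (Anc e)"
    using finite_nodes by (auto simp: Anc_def down_def)
  ultimately show ?thesis by (rule psubset_card_mono[rotated])
qed

end

locale fine_labelled_rooted_tree = rooted_tree +
  fixes lb :: "'a \<Rightarrow> complex"
  assumes fine: "\<lbrakk>f \<in> N - {root}; f' \<in> N - {root}; f \<noteq> f'; Par f = Par f'\<rbrakk> \<Longrightarrow> lb f \<noteq> lb f'"

section \<open>The ring attached to a fine-labelled rooted tree\<close>

text \<open>Polynomials over \<open>\<complex>[h]\<close> as finitely supported coefficient functions on monomials. The
  variables are indexed by \<open>'a option\<close>: \<open>None\<close> stands for \<open>X\<^sub>0\<close>, and \<open>Some e\<close> for \<open>X\<^sub>e\<close>.\<close>

type_synonym 'a tree_poly = "('a option \<Rightarrow>\<^sub>0 nat) \<Rightarrow>\<^sub>0 complex poly"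

definition var :: "'a option \<Rightarrow> 'a tree_poly" where
  "var v = Poly_Mapping.single (Poly_Mapping.single v 1) 1"

definition cst :: "complex poly \<Rightarrow> 'a tree_poly" where
  "cst a = Poly_Mapping.single 0 a"

context fine_labelled_rooted_tree
begin

definition poly_ring_tree :: "'a tree_poly ring" where
  "poly_ring_tree = ring_of_type_algebra
     \<lparr>carrier := {p. \<forall>m\<in>Poly_Mapping.keys p. Poly_Mapping.keys m \<subseteq> insert None (Some ` Parents)}\<rparr>"

definition h :: "'a tree_poly" where
  "h = cst [:0, 1:]"

definition Xv :: "'a \<Rightarrow> 'a tree_poly" where
  "Xv e = var (Some e)"

definition XPar :: "'a \<Rightarrow> 'a tree_poly" where
  "XPar e = (if e = root then var None else Xv (Par e))"

definition S :: "'a \<Rightarrow> 'a set \<Rightarrow> 'a tree_poly" where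
  "S e J = (\<Prod>g\<in>Child e - J. XPar e - cst [:lb g:])"

function R :: "'a \<Rightarrow> 'a tree_poly" where
  "R e = (if e \<in> N - {root} then S (Par e) {e} * R (Par e) else 1)"
  by pat_completeness auto
termination
  by (relation "measure (\<lambda>e. card (Anc e))") (auto intro: card_Anc_Par)

declare R.simps [simp del]

definition Q :: "'a \<Rightarrow> 'a tree_poly" where
  "Q e = S e {} * R e"

definition Delta0 :: "'a \<Rightarrow> 'a tree_poly" where
  "Delta0 e = h * Xv e - Q e"

text \<open>The polynomial ring is a domain and \<open>R e''\<close> is nonzero, so \<open>D\<close> below is the quotient
  of \<open>Q e' * Xv e - Q e * Xv e'\<close> by \<open>R e''\<close>.\<close>

definition is_Delta :: "'a \<Rightarrow> 'a \<Rightarrow> 'a tree_poly \<Rightarrow> bool" where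
  "is_Delta e' e D \<longleftrightarrow> D \<in> carrier poly_ring_tree \<and>
     (\<exists>e''\<in>Child e' \<inter> down e. R e'' * D = Q e' * Xv e - Q e * Xv e')"

definition tree_ideal :: "'a tree_poly set" where
  "tree_ideal = Idl\<^bsub>poly_ring_tree\<^esub>
     ({Delta0 e | e. e \<in> Parents} \<union> {D. \<exists>e\<in>Parents. \<exists>e'\<in>Anc e. is_Delta e' e D})"

definition tree_ring :: "'a tree_poly set ring" where
  "tree_ring = poly_ring_tree Quot tree_ideal"

definition tree_proj :: "complex poly \<Rightarrow> 'a tree_poly set" where
  "tree_proj a = tree_ideal +>\<^bsub>poly_ring_tree\<^esub> cst a"

end

end

(*
  Let A = C[h] and K = Frac A. Sending X_0 to x and X_e to Q_e / h, recursively along the tree,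
  maps the ring B of the tree to K[x]. Every node p has a chart x = a + c t, with a in A and c a
  power of h, which resolves the coordinates along the path from the root to p: modulo h, the
  coordinates attached to proper ancestors become the labels on the path, the next one becomes an
  affine function of t, and the variables of nodes not above p stay regular. Passing to a child of p is one blow-up t = t_0 + h t'.

  Reducing modulo h in the chart at p identifies a quotient of B with C[t]. This gives the kernel
  of the evaluation: adjoin the variables one at a time and lower the degree in the last one, X_p,
  because a relation forces its leading coefficient to vanish modulo h in the chart at p, and then
  the relations of the tree absorb one factor X_p. It also shows that B / hB is reduced, by
  descending from the leaves to the root with the Chinese remainder theorem at every node.

  A subring B of K[x] that contains A[x], has denominators powers of h, is regular in one chart and
  has B / hB reduced is a generalized Danielewski surface: it is normal since B[1/h] is
  A[1/h][x] and h-denominators are removed one by one; the leading coefficients in each degree form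
  a principal fractional ideal, so B is free over A; its fibers away from h = 0 are affine lines;
  and its dimension is at most 2 because any three elements are algebraically dependent over C.
*)

theory Submission
  imports Defs
begin

section \<open>Localizations of rings embedded in a field\<close>

text \<open>Every property of B is read off inside K[x], so B has to embed there: the kernel of the
  evaluation must be the ideal of the given relations and nothing more. The relations
  \<open>Delta0\<close> fix X_e as Q_e / h, but in general they generate too small an ideal; the
  second family supplies the rest. What makes it suffice is a simple pole. In the chart at p the
  variable X_p has a pole of order exactly one along h = 0. Hence a relation of degree n in X_p,
  multiplied by h^n, keeps modulo h only its leading term. The coefficients P for which P X_p can be
  rewritten without X_p form an ideal: \<open>Delta0\<close> puts h into it, and the second family
  puts X_{Par e'} - lb(c) into it for every c on the path to p. Modulo this ideal the variables on
  the path are scalars, and those on side branches are solved for by dividing by a difference of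
  labels, where the fine labelling is essential. So the ideal is as large as the residue map of the
  chart allows. No variable belongs to a node above a leaf, so in the chart at a leaf all of B is
  regular; this is the one chart that the general criterion asks for.\<close>

lemma ring_of_type_algebra_simps [simp]:
  "carrier (ring_of_type_algebra :: 'a::ring_1 ring) = UNIV"
  "x \<otimes>\<^bsub>(ring_of_type_algebra :: 'a ring)\<^esub> y = x * y"
  "x \<oplus>\<^bsub>(ring_of_type_algebra :: 'a ring)\<^esub> y = x + y"
  "\<one>\<^bsub>(ring_of_type_algebra :: 'a ring)\<^esub> = 1"
  "\<zero>\<^bsub>(ring_of_type_algebra :: 'a ring)\<^esub> = 0"
  by (simp_all add: ring_of_type_algebra_def)

lemma a_inv_ring_of_type_algebra [simp]:
  "\<ominus>\<^bsub>(ring_of_type_algebra :: 'a::comm_ring_1 ring)\<^esub> x = - x"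
proof -
  interpret cring "ring_of_type_algebra :: 'a ring"
    by (rule cring_from_type_algebra)
  show ?thesis using minus_equality[of "- x" x] by simp
qed

text \<open>An injection that respects the operations pulls every ring axiom back from the target.
  This serves for localizations, for the polynomial ring of the tree and for restriction of scalars,
  so that no axiom is checked on their carriers.\<close>

lemma cring_of_embedding:
  fixes L :: "('b, 'z) ring_scheme" and \<Lambda> :: "'b \<Rightarrow> 'k::comm_ring_1"
  assumes inj: "inj_on \<Lambda> (carrier L)"
    and closed: "\<And>x y. x \<in> carrier L \<Longrightarrow> y \<in> carrier L \<Longrightarrow> x \<otimes>\<^bsub>L\<^esub> y \<in> carrier L"
      "\<And>x y. x \<in> carrier L \<Longrightarrow> y \<in> carrier L \<Longrightarrow> x \<oplus>\<^bsub>L\<^esub> y \<in> carrier L"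
      "\<one>\<^bsub>L\<^esub> \<in> carrier L" "\<zero>\<^bsub>L\<^esub> \<in> carrier L"
    and pres: "\<And>x y. x \<in> carrier L \<Longrightarrow> y \<in> carrier L \<Longrightarrow> \<Lambda> (x \<otimes>\<^bsub>L\<^esub> y) = \<Lambda> x * \<Lambda> y"
      "\<And>x y. x \<in> carrier L \<Longrightarrow> y \<in> carrier L \<Longrightarrow> \<Lambda> (x \<oplus>\<^bsub>L\<^esub> y) = \<Lambda> x + \<Lambda> y"
      "\<Lambda> \<one>\<^bsub>L\<^esub> = 1" "\<Lambda> \<zero>\<^bsub>L\<^esub> = 0"
    and neg: "\<And>x. x \<in> carrier L \<Longrightarrow> \<exists>y\<in>carrier L. \<Lambda> y = - \<Lambda> x"
  shows "cring L" and "\<Lambda> \<in> ring_hom L ring_of_type_algebra"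
proof -
  note eqI = inj[THEN inj_onD]
  show "cring L"
  proof (rule cringI)
    show "abelian_group L"
    proof (rule abelian_groupI)
      fix x assume x: "x \<in> carrier L"
      obtain y where "y \<in> carrier L" "\<Lambda> y = - \<Lambda> x" using neg[OF x] by blast
      then show "\<exists>y\<in>carrier L. y \<oplus>\<^bsub>L\<^esub> x = \<zero>\<^bsub>L\<^esub>"
        using x by (intro bexI[of _ y] eqI) (simp_all add: closed pres)
    qed (auto intro!: eqI simp: closed pres algebra_simps)
    show "Group.comm_monoid L"
      by (rule comm_monoidI) (auto intro!: eqI simp: closed pres algebra_simps)
  qed (auto intro!: eqI simp: closed pres algebra_simps)
  show "\<Lambda> \<in> ring_hom L ring_of_type_algebra"
    by (rule ring_hom_memI) (simp_all add: pres)
qed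

locale embedded_ring = cring R for R :: "('a, 'x) ring_scheme" (structure) +
  fixes j :: "'a \<Rightarrow> 'k::field"
  assumes j_hom: "j \<in> ring_hom R ring_of_type_algebra"
    and j_inj: "inj_on j (carrier R)"
begin

lemma j_simps [simp]:
  "x \<in> carrier R \<Longrightarrow> y \<in> carrier R \<Longrightarrow> j (x \<otimes> y) = j x * j y"
  "x \<in> carrier R \<Longrightarrow> y \<in> carrier R \<Longrightarrow> j (x \<oplus> y) = j x + j y"
  "j \<one> = 1" "j \<zero> = 0"
proof -
  have "ring (ring_of_type_algebra :: 'k ring)" by (rule ring_from_type_algebra)
  then interpret jj: ring_hom_ring R "ring_of_type_algebra :: 'k ring" j
    using j_hom by (simp add: ring_hom_ringI2 ring_axioms)
  show "x \<in> carrier R \<Longrightarrow> y \<in> carrier R \<Longrightarrow> j (x \<otimes> y) = j x * j y"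
    "x \<in> carrier R \<Longrightarrow> y \<in> carrier R \<Longrightarrow> j (x \<oplus> y) = j x + j y"
    "j \<one> = 1" "j \<zero> = 0"
    using jj.hom_mult jj.hom_add jj.hom_one jj.hom_zero by simp_all
qed

lemma j_eq_iff: "x \<in> carrier R \<Longrightarrow> y \<in> carrier R \<Longrightarrow> j x = j y \<longleftrightarrow> x = y"
  using j_inj by (auto dest: inj_onD)

lemma j_eq_0_iff: "x \<in> carrier R \<Longrightarrow> j x = 0 \<longleftrightarrow> x = \<zero>"
  using j_eq_iff[of x \<zero>] by simp

lemma j_a_inv [simp]: "x \<in> carrier R \<Longrightarrow> j (\<ominus> x) = - j x"
  using j_simps(2)[of x "\<ominus> x"]
    by (simp add: r_neg eq_neg_iff_add_eq_0 add.commute del: j_simps(2))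

lemma j_pow [simp]: "x \<in> carrier R \<Longrightarrow> j (x [^] (n::nat)) = j x ^ n"
  by (induction n) simp_all

lemma is_domain: "domain R"
proof
  show "\<one> \<noteq> \<zero>" using j_simps(3,4) by (metis zero_neq_one)
next
  fix a b assume "a \<otimes> b = \<zero>" and ab: "a \<in> carrier R" "b \<in> carrier R"
  then have "j a * j b = 0" using j_simps(1)[of a b] by simp
  then show "a = \<zero> \<or> b = \<zero>" using j_eq_0_iff ab by simp
qed

end

locale embedded_localization = embedded_ring R j
  for R :: "('a, 'x) ring_scheme" (structure) and j :: "'a \<Rightarrow> 'k::field" +
  fixes S :: "'a set"
  assumes S_sub: "S \<subseteq> carrier R - {\<zero>}"
    and S_one: "\<one> \<in> S"
    and S_mult: "\<And>s t. s \<in> S \<Longrightarrow> t \<in> S \<Longrightarrow> s \<otimes> t \<in> S"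
begin

text \<open>Classes of fractions are sets of pairs. Since the ring lies in a field, such a class is
  determined by its common value, and this parametrization by values is inverse to
  \<open>frac_val\<close>.\<close>

definition fractions_of :: "'k \<Rightarrow> ('a \<times> 'a) set" where
  "fractions_of v = {(b, t). b \<in> carrier R \<and> t \<in> S \<and> j b / j t = v}"

definition frac_val :: "('a \<times> 'a) set \<Rightarrow> 'k" where
  "frac_val U = (case SOME p. p \<in> U of (a, s) \<Rightarrow> j a / j s)"

definition fracs :: "'k set" where
  "fracs = {j a / j s | a s. a \<in> carrier R \<and> s \<in> S}"

lemma S_carrier [simp]: "s \<in> S \<Longrightarrow> s \<in> carrier R"
  using S_sub by auto

lemma j_S_nonzero [simp]: "s \<in> S \<Longrightarrow> j s \<noteq> 0"
  using S_sub j_eq_0_iff by auto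

lemma fraction_eq:
  assumes "a \<in> carrier R" "s \<in> S"
  shows "fraction R S a s = fractions_of (j a / j s)"
proof -
  have "(\<exists>u\<in>S. u \<otimes> (a \<otimes> t) = u \<otimes> (b \<otimes> s)) \<longleftrightarrow> j b / j t = j a / j s"
    if "b \<in> carrier R" "t \<in> S" for b t
  proof
    assume "\<exists>u\<in>S. u \<otimes> (a \<otimes> t) = u \<otimes> (b \<otimes> s)"
    then obtain u where u: "u \<in> S" "u \<otimes> (a \<otimes> t) = u \<otimes> (b \<otimes> s)"
      by blast
    then have "j u * (j a * j t) = j u * (j b * j s)"
      using assms that by (metis S_carrier j_simps(1) m_closed)
    then show "j b / j t = j a / j s" using u(1) assms(2) that(2) by (simp add: field_simps)
  next
    assume "j b / j t = j a / j s"
    then have "j (a \<otimes> t) = j (b \<otimes> s)" using assms that by (simp add: field_simps)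
    then have "a \<otimes> t = b \<otimes> s" using assms that j_eq_iff
      by (metis S_carrier m_closed)
    then show "\<exists>u\<in>S. u \<otimes> (a \<otimes> t) = u \<otimes> (b \<otimes> s)"
      using S_one by auto
  qed
  then show ?thesis unfolding fraction_def fractions_of_def by blast
qed

lemma fracsI: "a \<in> carrier R \<Longrightarrow> s \<in> S \<Longrightarrow> v = j a / j s \<Longrightarrow> v \<in> fracs"
  unfolding fracs_def by blast

lemma fracs_iff: "v \<in> fracs \<longleftrightarrow> fractions_of v \<noteq> {}"
  unfolding fracs_def fractions_of_def by auto

lemma frac_val_fractions_of [simp]:
  assumes "v \<in> fracs" shows "frac_val (fractions_of v) = v"
proof -
  have "(SOME p. p \<in> fractions_of v) \<in> fractions_of v"
    using assms fracs_iff some_in_eq by blast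
  then show ?thesis unfolding frac_val_def fractions_of_def by auto
qed

lemma frac_val_fraction [simp]:
  assumes "a \<in> carrier R" "s \<in> S"
  shows "frac_val (fraction R S a s) = j a / j s"
  using fracsI[OF assms refl] assms by (simp add: fraction_eq)

lemma carrier_localization: "carrier (localization R S) = fractions_of ` fracs"
proof -
  have "{fraction R S a s |a s. a \<in> carrier R \<and> s \<in> S}
      = {fractions_of (j a / j s) |a s. a \<in> carrier R \<and> s \<in> S}"
    using fraction_eq by metis
  then show ?thesis unfolding localization_def fracs_def by auto
qed

lemma
  assumes v: "v \<in> fracs" and w: "w \<in> fracs"
  shows fracs_mult: "v * w \<in> fracs" and fracs_add: "v + w \<in> fracs"
    and localization_mult: "fractions_of v \<otimes>\<^bsub>localization R S\<^esub> fractions_of w = fractions_of (v * w)"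
    and localization_add: "fractions_of v \<oplus>\<^bsub>localization R S\<^esub> fractions_of w = fractions_of (v + w)"
proof -
  obtain a s b t where as: "(a, s) \<in> fractions_of v" and bt: "(b, t) \<in> fractions_of w"
    using v w fracs_iff by (metis all_not_in_conv surj_pair)
  have m: "fraction R S (a \<otimes> b) (s \<otimes> t) = fractions_of (v * w)"
    if "(a, s) \<in> fractions_of v" "(b, t) \<in> fractions_of w" for a s b t
    using that by (auto simp: fractions_of_def fraction_eq S_mult)
  have p: "fraction R S (a \<otimes> t \<oplus> b \<otimes> s) (s \<otimes> t) = fractions_of (v + w)"
    if "(a, s) \<in> fractions_of v" "(b, t) \<in> fractions_of w" for a s b t
    using that by (auto simp: fractions_of_def fraction_eq S_mult add_frac_eq)
  show "v * w \<in> fracs" "v + w \<in> fracs"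
    using as bt fracsI[of "a \<otimes> b" "s \<otimes> t"] fracsI[of "a \<otimes> t \<oplus> b \<otimes> s" "s \<otimes> t"]
    by (auto simp: fractions_of_def S_mult add_frac_eq)
  \<comment> \<open>The product in \<open>localization\<close> is a union over all representatives.
    All of them give the same class and at least one pair exists, so the union is taken over a
    singleton.\<close>
  have "{fraction R S (a \<otimes> b) (s \<otimes> t) |a s b t. (a, s) \<in> fractions_of v \<and> (b, t) \<in> fractions_of w}
      = {fractions_of (v * w)}"
    using m as bt by blast
  then show "fractions_of v \<otimes>\<^bsub>localization R S\<^esub> fractions_of w = fractions_of (v * w)"
    by (simp add: localization_def)
  have "{fraction R S (a \<otimes> t \<oplus> b \<otimes> s) (s \<otimes> t) |a s b t.
        (a, s) \<in> fractions_of v \<and> (b, t) \<in> fractions_of w} = {fractions_of (v + w)}"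
    using p as bt by blast
  then show "fractions_of v \<oplus>\<^bsub>localization R S\<^esub> fractions_of w = fractions_of (v + w)"
    by (simp add: localization_def)
qed

lemma one_localization: "\<one>\<^bsub>localization R S\<^esub> = fractions_of 1" "1 \<in> fracs"
  using S_one fracsI[of \<one> \<one>] by (simp_all add: localization_def fraction_eq)

lemma zero_localization: "\<zero>\<^bsub>localization R S\<^esub> = fractions_of 0" "0 \<in> fracs"
  using S_one fracsI[of \<zero> \<one>] by (simp_all add: localization_def fraction_eq)

lemma fracs_neg: "v \<in> fracs \<Longrightarrow> - v \<in> fracs"
proof -
  assume "v \<in> fracs"
  then obtain a s where "a \<in> carrier R" "s \<in> S" "v = j a / j s" unfolding fracs_def by blast
  then show "- v \<in> fracs" using fracsI[of "\<ominus> a" s "- v"] by simp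
qed

lemma frac_val_inj: "inj_on frac_val (carrier (localization R S))"
  by (rule inj_onI) (auto simp: carrier_localization)

lemma localization_cring: "cring (localization R S)"
  and frac_val_hom: "frac_val \<in> ring_hom (localization R S) ring_of_type_algebra"
proof -
  note * = cring_of_embedding[of frac_val "localization R S", OF frac_val_inj]
  have "cring (localization R S) \<and> frac_val \<in> ring_hom (localization R S) ring_of_type_algebra"
    by (intro conjI *; auto simp: carrier_localization fracs_mult fracs_add localization_mult
        localization_add one_localization zero_localization
        intro: fracs_neg intro!: bexI[of _ "- _"])
  then show "cring (localization R S)" "frac_val \<in> ring_hom (localization R S) ring_of_type_algebra"
    by auto
qed

lemma frac_val_image: "frac_val ` carrier (localization R S) = fracs"
  by (auto simp: carrier_localization image_image)

lemma fraction_in_carrier: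
  "a \<in> carrier R \<Longrightarrow> s \<in> S \<Longrightarrow> fraction R S a s \<in> carrier (localization R S)"
  by (auto simp: localization_def)

sublocale loc: embedded_ring "localization R S" frac_val
  using localization_cring frac_val_hom frac_val_inj
  by (simp add: embedded_ring_def embedded_ring_axioms_def)

end

lemma (in embedded_ring) embedded_localization_nonzero:
  "embedded_localization R j (nonzero_elements R)"
proof -
  interpret domain R by (rule is_domain)
  show ?thesis
    by unfold_locales (auto simp: nonzero_elements_def integral_iff)
qed

section \<open>Flatness of free modules\<close>

lemma carrier_free_diff:
  "x \<in> carrier (free_Abelian_group S) \<Longrightarrow> y \<in> carrier (free_Abelian_group S) \<Longrightarrow>
    x - y \<in> carrier (free_Abelian_group S)"
  using keys_diff[of x y] by auto

lemma carrier_free_add: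
  "x \<in> carrier (free_Abelian_group S) \<Longrightarrow> y \<in> carrier (free_Abelian_group S) \<Longrightarrow>
    x + y \<in> carrier (free_Abelian_group S)"
  using Poly_Mapping.keys_add[of x y] by auto

text \<open>The \<open>c i\<close> are the coordinates with respect to the basis \<open>b\<close>; the expansion is stated for all large
  \<open>k\<close> so that no bound on the support of the coordinates is needed.\<close>

locale module_coordinates = module A N
  for A :: "('a, 'x) ring_scheme" (structure) and N :: "('a, 'n) module" +
  fixes c :: "nat \<Rightarrow> 'n \<Rightarrow> 'a" and b :: "nat \<Rightarrow> 'n"
  assumes b_closed: "b i \<in> carrier N"
    and c_closed: "n \<in> carrier N \<Longrightarrow> c i n \<in> carrier A"
    and c_add: "n \<in> carrier N \<Longrightarrow> n' \<in> carrier N \<Longrightarrow> c i (n \<oplus>\<^bsub>N\<^esub> n') = c i n \<oplus> c i n'"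
    and c_smult: "a \<in> carrier A \<Longrightarrow> n \<in> carrier N \<Longrightarrow> c i (a \<odot>\<^bsub>N\<^esub> n) = a \<otimes> c i n"
    and expansion: "n \<in> carrier N \<Longrightarrow>
      \<exists>k0. \<forall>k\<ge>k0. n = (\<Oplus>\<^bsub>N\<^esub>i\<in>{..<k}. c i n \<odot>\<^bsub>N\<^esub> b i)"

locale tensor_with_coordinates = module_coordinates A N c b + M: module A M
  for A :: "('a, 'x) ring_scheme" (structure) and N :: "('a, 'n) module" and c b
    and M :: "('a, 'm) module"
begin

abbreviation "FM \<equiv> free_Abelian_group (carrier M \<times> carrier N)"
abbreviation "rel \<equiv> tensor_relations A M N"

lemma rel_subgroup: "subgroup rel FM"
  unfolding tensor_relations_def
  by (rule group.generate_is_subgroup[OF group_free_Abelian_group])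
    (auto simp del: carrier_free_Abelian_group_iff intro!: carrier_free_diff)

lemma rel_0: "0 \<in> rel"
  using subgroup.one_closed[OF rel_subgroup] by simp

lemma rel_add: "x \<in> rel \<Longrightarrow> y \<in> rel \<Longrightarrow> x + y \<in> rel"
  using subgroup.m_closed[OF rel_subgroup] by simp

lemma rel_carrier: "x \<in> rel \<Longrightarrow> Poly_Mapping.keys x \<subseteq> carrier M \<times> carrier N"
  using subgroup.mem_carrier[OF rel_subgroup] by simp

lemma rel_minus: "x \<in> rel \<Longrightarrow> - x \<in> rel"
  using subgroup.m_inv_closed[OF rel_subgroup, of x] rel_carrier[of x] by simp

lemma rel_diff: "x \<in> rel \<Longrightarrow> y \<in> rel \<Longrightarrow> x - y \<in> rel"
  using rel_add[of x "- y"] rel_minus by simp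

lemma rel_sum: "(\<And>i. i \<in> I \<Longrightarrow> x i \<in> rel) \<Longrightarrow> sum x I \<in> rel"
  by (induction I rule: infinite_finite_induct) (auto intro: rel_0 rel_add)

lemma rel_left:
  "m \<in> carrier M \<Longrightarrow> m' \<in> carrier M \<Longrightarrow> n \<in> carrier N \<Longrightarrow>
    frag_of (m \<oplus>\<^bsub>M\<^esub> m', n) - frag_of (m, n) - frag_of (m', n) \<in> rel"
  unfolding tensor_relations_def by (rule generate.incl) blast

lemma rel_right:
  "m \<in> carrier M \<Longrightarrow> n \<in> carrier N \<Longrightarrow> n' \<in> carrier N \<Longrightarrow>
    frag_of (m, n \<oplus>\<^bsub>N\<^esub> n') - frag_of (m, n) - frag_of (m, n') \<in> rel"
  unfolding tensor_relations_def by (rule generate.incl) blast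

lemma rel_scalar:
  "a \<in> carrier A \<Longrightarrow> m \<in> carrier M \<Longrightarrow> n \<in> carrier N \<Longrightarrow>
    frag_of (a \<odot>\<^bsub>M\<^esub> m, n) - frag_of (m, a \<odot>\<^bsub>N\<^esub> n) \<in> rel"
  unfolding tensor_relations_def by (rule generate.incl) blast

lemma rel_zero_left: "n \<in> carrier N \<Longrightarrow> frag_of (\<zero>\<^bsub>M\<^esub>, n) \<in> rel"
  using rel_left[of "\<zero>\<^bsub>M\<^esub>" "\<zero>\<^bsub>M\<^esub>" n] rel_minus by fastforce

lemma rel_zero_right: "m \<in> carrier M \<Longrightarrow> frag_of (m, \<zero>\<^bsub>N\<^esub>) \<in> rel"
  using rel_right[of m "\<zero>\<^bsub>N\<^esub>" "\<zero>\<^bsub>N\<^esub>"] rel_minus by fastforce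

lemma rel_diff_left:
  assumes "m \<in> carrier M" "m' \<in> carrier M" "n \<in> carrier N"
  shows "frag_of (m \<ominus>\<^bsub>M\<^esub> m', n) - (frag_of (m, n) - frag_of (m', n)) \<in> rel"
proof -
  have "(m \<ominus>\<^bsub>M\<^esub> m') \<oplus>\<^bsub>M\<^esub> m' = m"
    using assms by (simp add: M.minus_eq M.a_assoc M.l_neg)
  then have "frag_of (m, n) - frag_of (m \<ominus>\<^bsub>M\<^esub> m', n) - frag_of (m', n) \<in> rel"
    using rel_left[of "m \<ominus>\<^bsub>M\<^esub> m'" m' n] assms by simp
  from rel_minus[OF this] show ?thesis by (simp add: algebra_simps)
qed

lemma rel_finsum_right:
  assumes m: "m \<in> carrier M" and x: "\<And>i. x i \<in> carrier N"
  shows "frag_of (m, \<Oplus>\<^bsub>N\<^esub>i\<in>{..<k::nat}. x i) - (\<Sum>i<k. frag_of (m, x i)) \<in> rel"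
proof (induction k)
  case 0
  then show ?case using rel_zero_right[OF m] by simp
next
  case (Suc k)
  let ?s = "\<Oplus>\<^bsub>N\<^esub>i\<in>{..<k}. x i"
  have "(\<Oplus>\<^bsub>N\<^esub>i\<in>{..<Suc k}. x i) = x k \<oplus>\<^bsub>N\<^esub> ?s"
    using x by (simp add: lessThan_Suc finsum_insert Pi_def)
  then have "frag_of (m, \<Oplus>\<^bsub>N\<^esub>i\<in>{..<Suc k}. x i) - frag_of (m, x k) - frag_of (m, ?s) \<in> rel"
    using rel_right[OF m x, of ?s k] x by (simp add: finsum_closed Pi_def)
  from rel_add[OF this Suc] show ?case by (simp add: algebra_simps)
qed

text \<open>The assignment of \<open>c i n \<odot> m\<close> to \<open>(m, n)\<close> is bilinear
  and should be the i-th coordinate of a tensor. It is first built on the free abelian group, where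
  no relation has to be respected; \<open>\<Phi>_rel\<close> then shows that it descends.\<close>

lemma coordinate_hom:
  obtains \<Phi> where "\<And>i. \<Phi> i \<in> hom FM (add_monoid M)"
    "\<And>i m n. m \<in> carrier M \<Longrightarrow> n \<in> carrier N \<Longrightarrow> \<Phi> i (frag_of (m, n)) = c i n \<odot>\<^bsub>M\<^esub> m"
proof -
  have "\<exists>\<phi>. \<phi> \<in> hom FM (add_monoid M) \<and> (\<forall>m\<in>carrier M. \<forall>n\<in>carrier N.
      \<phi> (frag_of (m, n)) = c i n \<odot>\<^bsub>M\<^esub> m)" for i
  proof -
    obtain \<phi> where "\<phi> \<in> hom FM (add_monoid M)"
      "\<And>p. p \<in> carrier M \<times> carrier N \<Longrightarrow> \<phi> (frag_of p) = (\<lambda>(m, n). c i n \<odot>\<^bsub>M\<^esub> m) p"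
      by (rule comm_group.free_Abelian_group_universal[OF M.a_comm_group,
            of "\<lambda>(m, n). c i n \<odot>\<^bsub>M\<^esub> m" "carrier M \<times> carrier N"]) (auto simp: c_closed)
    then show ?thesis by (intro exI[of _ \<phi>]) auto
  qed
  then obtain \<Phi> where "\<And>i. \<Phi> i \<in> hom FM (add_monoid M) \<and> (\<forall>m\<in>carrier M. \<forall>n\<in>carrier N.
      \<Phi> i (frag_of (m, n)) = c i n \<odot>\<^bsub>M\<^esub> m)" by metis
  then show ?thesis using that by blast
qed

context
  fixes \<Phi> :: "nat \<Rightarrow> ('m \<times> 'n \<Rightarrow>\<^sub>0 int) \<Rightarrow> 'm"
  assumes \<Phi>_hom: "\<And>i. \<Phi> i \<in> hom FM (add_monoid M)"
    and \<Phi>_of: "\<And>i m n. m \<in> carrier M \<Longrightarrow> n \<in> carrier N \<Longrightarrow>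
      \<Phi> i (frag_of (m, n)) = c i n \<odot>\<^bsub>M\<^esub> m"
begin

lemma \<Phi>_group_hom: "group_hom FM (add_monoid M) (\<Phi> i)"
  using \<Phi>_hom M.a_group by (simp add: group_hom_def group_hom_axioms_def)

lemma \<Phi>_closed: "w \<in> carrier FM \<Longrightarrow> \<Phi> i w \<in> carrier M"
  using group_hom.hom_closed[OF \<Phi>_group_hom] by simp

lemma \<Phi>_add: "w \<in> carrier FM \<Longrightarrow> w' \<in> carrier FM \<Longrightarrow> \<Phi> i (w + w') = \<Phi> i w \<oplus>\<^bsub>M\<^esub> \<Phi> i w'"
  using group_hom.hom_mult[OF \<Phi>_group_hom, of w w' i] by simp

lemma \<Phi>_0: "\<Phi> i 0 = \<zero>\<^bsub>M\<^esub>"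
  using group_hom.hom_one[OF \<Phi>_group_hom, of i] by simp

lemma \<Phi>_diff:
  assumes w: "w \<in> carrier FM" "w' \<in> carrier FM"
  shows "\<Phi> i (w - w') = \<Phi> i w \<ominus>\<^bsub>M\<^esub> \<Phi> i w'"
proof -
  have "\<Phi> i w = \<Phi> i (w - w') \<oplus>\<^bsub>M\<^esub> \<Phi> i w'"
    using \<Phi>_add[OF carrier_free_diff[OF w] w(2)] by simp
  then show ?thesis
    using \<Phi>_closed[OF carrier_free_diff[OF w]] \<Phi>_closed[OF w(2)]
    by (simp add: M.minus_eq M.a_assoc M.r_neg)
qed

lemma \<Phi>_rel:
  assumes "w \<in> rel" shows "\<Phi> i w = \<zero>\<^bsub>M\<^esub>"
proof -
  have "rel \<subseteq> kernel FM (add_monoid M) (\<Phi> i)"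
    unfolding tensor_relations_def
  proof (rule group.generate_subgroup_incl[OF group_free_Abelian_group])
    show "subgroup (kernel FM (add_monoid M) (\<Phi> i)) FM"
      by (rule group_hom.subgroup_kernel[OF \<Phi>_group_hom])
  next
    have left: "\<Phi> i (frag_of (m \<oplus>\<^bsub>M\<^esub> m', n) - frag_of (m, n) - frag_of (m', n)) = \<zero>\<^bsub>M\<^esub>"
      if "m \<in> carrier M" "m' \<in> carrier M" "n \<in> carrier N" for m m' n
      using that c_closed[of n i]
      by (simp add: \<Phi>_diff carrier_free_diff \<Phi>_of M.smult_r_distr M.minus_eq M.a_ac M.r_neg
          M.r_neg1 del: carrier_free_Abelian_group_iff)
    have right: "\<Phi> i (frag_of (m, n \<oplus>\<^bsub>N\<^esub> n') - frag_of (m, n) - frag_of (m, n')) = \<zero>\<^bsub>M\<^esub>"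
      if "m \<in> carrier M" "n \<in> carrier N" "n' \<in> carrier N" for m n n'
      using that c_closed[of n i] c_closed[of n' i]
      by (simp add: \<Phi>_diff carrier_free_diff \<Phi>_of c_add M.smult_l_distr M.minus_eq M.a_ac M.r_neg
          M.r_neg1 del: carrier_free_Abelian_group_iff)
    have scalar: "\<Phi> i (frag_of (a \<odot>\<^bsub>M\<^esub> m, n) - frag_of (m, a \<odot>\<^bsub>N\<^esub> n)) = \<zero>\<^bsub>M\<^esub>"
      if "a \<in> carrier A" "m \<in> carrier M" "n \<in> carrier N" for a m n
      using that c_closed[of n i]
      by (simp add: \<Phi>_diff \<Phi>_of c_smult M.smult_assoc1[symmetric] m_comm M.minus_eq M.r_neg
          del: carrier_free_Abelian_group_iff)
    show "{frag_of (m \<oplus>\<^bsub>M\<^esub> m', n) - frag_of (m, n) - frag_of (m', n) | m m' n.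
          m \<in> carrier M \<and> m' \<in> carrier M \<and> n \<in> carrier N}
       \<union> {frag_of (m, n \<oplus>\<^bsub>N\<^esub> n') - frag_of (m, n) - frag_of (m, n') | m n n'.
          m \<in> carrier M \<and> n \<in> carrier N \<and> n' \<in> carrier N}
       \<union> {frag_of (a \<odot>\<^bsub>M\<^esub> m, n) - frag_of (m, a \<odot>\<^bsub>N\<^esub> n) | a m n.
          a \<in> carrier A \<and> m \<in> carrier M \<and> n \<in> carrier N} \<subseteq> kernel FM (add_monoid M) (\<Phi> i)"
      using left right scalar unfolding kernel_def
      by (auto simp del: carrier_free_Abelian_group_iff intro!: carrier_free_diff)
  qed
  then show ?thesis using assms by (auto simp: kernel_def)
qed

text \<open>On a generator this is the expansion of its second entry moved across the tensor sign,
  and it passes to differences. Together with \<open>\<Phi>_rel\<close> it shows that a tensor is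
  zero exactly when all its coordinates are.\<close>

lemma tensor_expansion:
  assumes "w \<in> carrier FM"
  shows "\<exists>k0. \<forall>k\<ge>k0. w - (\<Sum>i<k. frag_of (\<Phi> i w, b i)) \<in> rel"
proof -
  have "Poly_Mapping.keys w \<subseteq> carrier M \<times> carrier N" using assms by simp
  then show ?thesis
  proof (induction w rule: free_Abelian_group_induct[consumes 1, case_names 1 2 3])
    case 1
    then show ?case
      by (intro exI[of _ 0] allI impI rel_diff rel_0 rel_sum) (simp add: \<Phi>_0 b_closed rel_zero_left)
  next
    case (2 x y)
    then obtain k1 k2 where k: "\<And>k. k \<ge> k1 \<Longrightarrow> x - (\<Sum>i<k. frag_of (\<Phi> i x, b i)) \<in> rel"
      "\<And>k. k \<ge> k2 \<Longrightarrow> y - (\<Sum>i<k. frag_of (\<Phi> i y, b i)) \<in> rel"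
        by blast
    show ?case
    proof (intro exI[of _ "max k1 k2"] allI impI)
      fix k assume "max k1 k2 \<le> k"
      then have "x - (\<Sum>i<k. frag_of (\<Phi> i x, b i)) \<in> rel" "y - (\<Sum>i<k. frag_of (\<Phi> i y, b i)) \<in> rel"
        using k by auto
      from rel_diff[OF this]
      have 1: "x - y - ((\<Sum>i<k. frag_of (\<Phi> i x, b i)) - (\<Sum>i<k. frag_of (\<Phi> i y, b i))) \<in> rel"
        by (simp add: algebra_simps)
      have "(\<Sum>i<k. frag_of (\<Phi> i (x - y), b i) - (frag_of (\<Phi> i x, b i) - frag_of (\<Phi> i y, b i))) \<in> rel"
        using 2(1,2) by (intro rel_sum) (simp add: \<Phi>_diff \<Phi>_closed rel_diff_left b_closed)
      from rel_diff[OF 1 this]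
      show "x - y - (\<Sum>i<k. frag_of (\<Phi> i (x - y), b i)) \<in> rel"
        by (simp add: sum_subtractf sum.distrib algebra_simps)
    qed
  next
    case (3 p)
    then obtain m n where p: "p = (m, n)" "m \<in> carrier M" "n \<in> carrier N" by auto
    obtain k0 where k0: "\<And>k. k \<ge> k0 \<Longrightarrow> n = (\<Oplus>\<^bsub>N\<^esub>i\<in>{..<k}. c i n \<odot>\<^bsub>N\<^esub> b i)"
      using expansion[OF p(3)] by blast
    show ?case
    proof (intro exI[of _ k0] allI impI)
      fix k assume k: "k0 \<le> k"
      have cb: "\<And>i. c i n \<odot>\<^bsub>N\<^esub> b i \<in> carrier N" using p(3)
        by (simp add: c_closed b_closed)
      have 1: "frag_of (m, n) - (\<Sum>i<k. frag_of (m, c i n \<odot>\<^bsub>N\<^esub> b i)) \<in> rel"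
        using rel_finsum_right[of m "\<lambda>i. c i n \<odot>\<^bsub>N\<^esub> b i" k, OF p(2) cb] k0[OF k] by simp
      have "(\<Sum>i<k. frag_of (c i n \<odot>\<^bsub>M\<^esub> m, b i) - frag_of (m, c i n \<odot>\<^bsub>N\<^esub> b i)) \<in> rel"
        using p by (intro rel_sum rel_scalar) (simp_all add: c_closed b_closed)
      from rel_diff[OF 1 this]
      show "frag_of p - (\<Sum>i<k. frag_of (\<Phi> i (frag_of p), b i)) \<in> rel"
        using p by (simp add: \<Phi>_of sum_subtractf algebra_simps)
    qed
  qed
qed

end

end

text \<open>In coordinates the map induced by \<open>f\<close> is \<open>f\<close> applied to each
  coordinate. A tensor that maps to zero has coordinates killed by the injective \<open>f\<close>,
  so they vanish, and its expansion consists of terms with first entry zero.\<close>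

lemma (in module_coordinates) flat: "flat TYPE('m) A N"
  unfolding flat_def
proof (intro allI impI, elim conjE)
  fix M M' :: "('a, 'm) module" and f
  assume M: "module A M" and M': "module A M'" and lin: "linear_map A M M' f"
    and inj: "inj_on f (carrier M)"
  interpret M: module A M by (rule M)
  interpret M': module A M' by (rule M')
  interpret T: tensor_with_coordinates A N c b M ..
  interpret T': tensor_with_coordinates A N c b M' ..
  obtain \<Phi> where \<Phi>: "\<And>i. \<Phi> i \<in> hom T.FM (add_monoid M)"
    "\<And>i m n. m \<in> carrier M \<Longrightarrow> n \<in> carrier N \<Longrightarrow> \<Phi> i (frag_of (m, n)) = c i n \<odot>\<^bsub>M\<^esub> m"
    using T.coordinate_hom by blast
  obtain \<Phi>' where \<Phi>': "\<And>i. \<Phi>' i \<in> hom T'.FM (add_monoid M')"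
    "\<And>i m n. m \<in> carrier M' \<Longrightarrow> n \<in> carrier N \<Longrightarrow> \<Phi>' i (frag_of (m, n)) = c i n \<odot>\<^bsub>M'\<^esub> m"
    using T'.coordinate_hom by blast
  have f: "f x \<in> carrier M'" "f (x \<oplus>\<^bsub>M\<^esub> y) = f x \<oplus>\<^bsub>M'\<^esub> f y" "f (a \<odot>\<^bsub>M\<^esub> x) = a \<odot>\<^bsub>M'\<^esub> f x"
    if "x \<in> carrier M" "y \<in> carrier M" "a \<in> carrier A" for x y a
    using lin that unfolding linear_map_def by auto
  have f0: "f \<zero>\<^bsub>M\<^esub> = \<zero>\<^bsub>M'\<^esub>"
    using f(1,2)[of "\<zero>\<^bsub>M\<^esub>" "\<zero>\<^bsub>M\<^esub>" \<zero>] M'.add.l_cancel_one' by auto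
  have fdiff: "f (x \<ominus>\<^bsub>M\<^esub> y) = f x \<ominus>\<^bsub>M'\<^esub> f y"
    if "x \<in> carrier M" "y \<in> carrier M" for x y
  proof -
    have "f x = f (x \<ominus>\<^bsub>M\<^esub> y) \<oplus>\<^bsub>M'\<^esub> f y"
      using that f(2)[of "x \<ominus>\<^bsub>M\<^esub> y" y \<zero>]
        by (simp add: M.minus_eq M.a_assoc M.l_neg)
    then show ?thesis
      using that f(1)[of _ "\<zero>\<^bsub>M\<^esub>" \<zero>]
        by (simp add: M'.minus_eq M'.a_assoc M'.r_neg)
  qed
  define F where "F = frag_extend (\<lambda>(m, n). frag_of (f m, n :: 'n))"
  have F: "F w \<in> carrier T'.FM \<and> (\<forall>i. \<Phi>' i (F w) = f (\<Phi> i w))"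
    if "w \<in> carrier T.FM" for w
  proof -
    have "Poly_Mapping.keys w \<subseteq> carrier M \<times> carrier N" using that by simp
    then show ?thesis
    proof (induction w rule: free_Abelian_group_induct[consumes 1, case_names 1 2 3])
      case 1
      then show ?case
        by (simp add: F_def T.\<Phi>_0[OF \<Phi>] T'.\<Phi>_0[OF \<Phi>'] f0)
    next
      case (2 x y)
      then show ?case
        using T.\<Phi>_closed[OF \<Phi>]
        by (simp add: F_def frag_extend_diff T.\<Phi>_diff[OF \<Phi>] T'.\<Phi>_diff[OF \<Phi>'] fdiff
            carrier_free_diff[simplified])
    next
      case (3 a)
      then show ?case
        using f(1)[of _ "\<zero>\<^bsub>M\<^esub>" \<zero>] f(3)[of _ "\<zero>\<^bsub>M\<^esub>"]
          by (auto simp: F_def \<Phi> \<Phi>' c_closed)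
    qed
  qed
  have ker: "w \<in> T.rel" if w: "w \<in> carrier T.FM" "F w \<in> T'.rel" for w
  proof -
    have "f (\<Phi> i w) = f \<zero>\<^bsub>M\<^esub>" for i
      using F[OF that(1)] T'.\<Phi>_rel[OF \<Phi>' that(2)] f0 by metis
    then have 0: "\<Phi> i w = \<zero>\<^bsub>M\<^esub>" for i
      using inj_onD[OF inj] T.\<Phi>_closed[OF \<Phi> that(1)] by blast
    obtain k where "w - (\<Sum>i<k. frag_of (\<Phi> i w, b i)) \<in> T.rel"
      using T.tensor_expansion[OF \<Phi> w(1)] by blast
    moreover have "(\<Sum>i<k. frag_of (\<Phi> i w, b i)) \<in> T.rel"
      by (rule T.rel_sum) (simp add: 0 T.rel_zero_left b_closed)
    ultimately show ?thesis using T.rel_add by fastforce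
  qed
  show "inj_on (tensor_map_left A f M' N) (carrier (tensor_product A M N))"
  proof (rule inj_onI)
    fix U V assume UV: "U \<in> carrier (tensor_product A M N)" "V \<in> carrier (tensor_product A M N)"
      and eq: "tensor_map_left A f M' N U = tensor_map_left A f M' N V"
    obtain u v where uv: "u \<in> carrier T.FM" "v \<in> carrier T.FM"
      and U: "U = T.rel #>\<^bsub>T.FM\<^esub> u" and V: "V = T.rel #>\<^bsub>T.FM\<^esub> v"
      using UV unfolding tensor_product_def FactGroup_def RCOSETS_def by auto
    have coset: "x \<in> T.rel #>\<^bsub>T.FM\<^esub> w \<longleftrightarrow> x - w \<in> T.rel"
      for x w
      unfolding r_coset_def by (auto intro!: bexI[of _ "x - w"])
    have coset': "x \<in> T'.rel #>\<^bsub>T'.FM\<^esub> w \<longleftrightarrow> x - w \<in> T'.rel"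
      for x w
      unfolding r_coset_def by (auto intro!: bexI[of _ "x - w"])
    have map: "y \<in> tensor_map_left A f M' N W \<longleftrightarrow> (\<exists>x\<in>W. y - F x \<in> T'.rel)" for y W
      unfolding tensor_map_left_def F_def[symmetric] using coset' by auto
    have "F u \<in> tensor_map_left A f M' N U"
      unfolding map U using T'.rel_0 T.rel_0 coset by (intro bexI[of _ u]) auto
    then obtain x where x: "x - v \<in> T.rel" "F u - F x \<in> T'.rel"
      unfolding eq map V by (auto simp: coset)
    have "x \<in> carrier T.FM"
      using carrier_free_add[OF _ uv(2), of "x - v"] T.rel_carrier[OF x(1)] by simp
    then have "u - x \<in> T.rel"
      using x(2) uv(1) by (intro ker carrier_free_diff) (auto simp: F_def frag_extend_diff)
    then have "u - v \<in> T.rel" using T.rel_add[OF _ x(1)] by fastforce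
    then have "x - u \<in> T.rel \<longleftrightarrow> x - v \<in> T.rel" for x
      using T.rel_add[of "x - u" "u - v"] T.rel_diff[of "x - v" "u - v"] by auto
    then show "U = V" unfolding U V using coset by blast
  qed
qed

section \<open>Chains of primes\<close>

lemma exists_kernel_vector:
  fixes M :: "'i \<Rightarrow> 'j \<Rightarrow> 'f::field"
  assumes "finite J" "finite I" "card J < card I"
  shows "\<exists>\<kappa>. (\<exists>i\<in>I. \<kappa> i \<noteq> 0) \<and> (\<forall>j\<in>J. (\<Sum>i\<in>I. \<kappa> i * M i j) = 0)"
  using assms
proof (induction J arbitrary: I M rule: finite_induct)
  case empty
  then have "I \<noteq> {}" by auto
  then show ?case by (intro exI[of _ "\<lambda>_. 1"]) auto
next
  case (insert j J)
  show ?case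
  proof (cases "\<forall>i\<in>I. M i j = 0")
    case True
    obtain \<kappa>
      where "\<exists>i\<in>I. \<kappa> i \<noteq> 0" "\<forall>l\<in>J. (\<Sum>i\<in>I. \<kappa> i * M i l) = 0"
      using insert.IH[of I M] insert.prems insert.hyps by auto
    then show ?thesis using True by (intro exI[of _ \<kappa>]) simp
  next
    case False
    then obtain p where p: "p \<in> I" "M p j \<noteq> 0" by blast
    \<comment> \<open>One step of Gaussian elimination: \<open>p\<close> is a pivot for the equation
      \<open>j\<close>, and in \<open>M'\<close> the column \<open>j\<close> is cleared.\<close>
    define M' where "M' i l = M i l - M i j / M p j * M p l" for i l
    have "card J < card (I - {p})"
      using insert.prems insert.hyps p by simp
    then obtain \<kappa> where \<kappa>: "\<exists>i\<in>I - {p}. \<kappa> i \<noteq> 0"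
      "\<forall>l\<in>J. (\<Sum>i\<in>I - {p}. \<kappa> i * M' i l) = 0"
      using insert.IH[of "I - {p}" M'] insert.prems by auto
    \<comment> \<open>The value at the pivot is forced by the equation \<open>j\<close>; with this
      value the other equations for \<open>M\<close> become those for \<open>M'\<close>.\<close>
    define \<mu> where "\<mu> i = (if i = p then - (\<Sum>i\<in>I - {p}. \<kappa> i * M i j) / M p j else \<kappa> i)" for i
    have split: "(\<Sum>i\<in>I. \<mu> i * M i l)
        = - (\<Sum>i\<in>I - {p}. \<kappa> i * M i j) / M p j * M p l + (\<Sum>i\<in>I - {p}. \<kappa> i * M i l)" for l
      using p insert.prems by (subst sum.remove[of I p]) (auto simp: \<mu>_def intro!: sum.cong)
    have "(\<Sum>i\<in>I. \<mu> i * M i l) = (\<Sum>i\<in>I - {p}. \<kappa> i * M' i l)" for l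
      unfolding split M'_def
      by (simp add: algebra_simps sum_subtractf sum_distrib_left sum_divide_distrib)
    moreover have "(\<Sum>i\<in>I. \<mu> i * M i j) = 0" using split[of j] p by simp
    moreover have "\<exists>i\<in>I. \<mu> i \<noteq> 0" using \<kappa>(1) by (auto simp: \<mu>_def)
    ultimately show ?thesis using \<kappa>(2) by (intro exI[of _ \<mu>]) auto
  qed
qed

abbreviation hp :: "complex poly poly" where "hp \<equiv> [:[:0, 1:]:]"

definition bidegree_le :: "nat \<Rightarrow> complex poly poly \<Rightarrow> bool" where
  "bidegree_le d u \<longleftrightarrow> degree u \<le> d \<and> (\<forall>i. degree (coeff u i) \<le> d)"

lemma bidegree_le_mono: "bidegree_le d u \<Longrightarrow> d \<le> d' \<Longrightarrow> bidegree_le d' u"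
  unfolding bidegree_le_def using order_trans by blast

lemma bidegree_le_mult:
  assumes "bidegree_le d u" "bidegree_le e v"
  shows "bidegree_le (d + e) (u * v)"
proof -
  have "degree (coeff u i * coeff v l) \<le> d + e" for i l
    using assms degree_mult_le[of "coeff u i" "coeff v l"] unfolding bidegree_le_def
    by (meson add_mono order_trans)
  then have "degree (coeff (u * v) n) \<le> d + e" for n
    by (auto simp: coeff_mult intro!: degree_sum_le)
  moreover have "degree (u * v) \<le> d + e"
    using assms degree_mult_le[of u v] unfolding bidegree_le_def by linarith
  ultimately show ?thesis unfolding bidegree_le_def by blast
qed

lemma bidegree_le_power: "bidegree_le d u \<Longrightarrow> bidegree_le (n * d) (u ^ n)"
proof (induction n)
  case 0 then show ?case by (simp add: bidegree_le_def coeff_1 if_distrib)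
next
  case (Suc n) then show ?case using bidegree_le_mult[of d u "n * d" "u ^ n"] by simp
qed

lemma bidegree_le_exists: "\<exists>d. bidegree_le d u"
proof -
  let ?d = "max (degree u) (Max ((\<lambda>i. degree (coeff u i)) ` {..degree u}))"
  have "degree (coeff u i) \<le> ?d" for i
  proof (cases "i \<le> degree u")
    case True
    then have "degree (coeff u i) \<le> Max ((\<lambda>i. degree (coeff u i)) ` {..degree u})"
      by (intro Max_ge) auto
    then show ?thesis by simp
  qed (simp add: coeff_eq_0)
  then show ?thesis unfolding bidegree_le_def by (intro exI[of _ ?d]) auto
qed

lemma bidegree_le_hp: "bidegree_le 1 hp"
  by (auto simp: bidegree_le_def coeff_pCons split: nat.splits)

text \<open>A polynomial of bidegree at most \<open>d\<close> has \<open>(d + 1)\<^sup>2\<close>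
  coefficients over the complex numbers, so a larger family is linearly dependent.\<close>

lemma sum_coeff_eq_0:
  assumes fin: "finite I" and bd: "\<And>i. i \<in> I \<Longrightarrow> bidegree_le d (u i)"
    and card: "(d + 1)\<^sup>2 < card I"
  shows "\<exists>\<kappa>. (\<exists>i\<in>I. \<kappa> i \<noteq> 0) \<and> (\<Sum>i\<in>I. [:[:\<kappa> i:]:] * u i) = 0"
proof -
  have "card ({..d} \<times> {..d}) < card I" using card by (simp add: power2_eq_square)
  then obtain \<kappa> where \<kappa>: "\<exists>i\<in>I. \<kappa> i \<noteq> 0"
    "\<And>a b. a \<le> d \<Longrightarrow> b \<le> d \<Longrightarrow> (\<Sum>i\<in>I. \<kappa> i * coeff (coeff (u i) a) b) = 0"
    using exists_kernel_vector[of "{..d} \<times> {..d}" I "\<lambda>i (a, b). coeff (coeff (u i) a) b"] fin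
    by auto
  have "(\<Sum>i\<in>I. [:[:\<kappa> i:]:] * u i) = 0"
  proof (rule poly_eqI, rule poly_eqI)
    fix a b
    have "coeff (coeff (\<Sum>i\<in>I. [:[:\<kappa> i:]:] * u i) a) b = (\<Sum>i\<in>I. \<kappa> i * coeff (coeff (u i) a) b)"
      by (simp add: coeff_sum)
    also have "\<dots> = 0"
    proof (cases "a \<le> d \<and> b \<le> d")
      case False
      then have "coeff (coeff (u i) a) b = 0" if "i \<in> I" for i
        using bd[OF that] unfolding bidegree_le_def
        by (metis coeff_0 coeff_eq_0 le_degree order_trans)
      then show ?thesis by simp
    qed (use \<kappa> in auto)
    finally show "coeff (coeff (\<Sum>i\<in>I. [:[:\<kappa> i:]:] * u i) a) b = coeff (coeff 0 a) b"
      by simp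
  qed
  then show ?thesis using \<kappa>(1) by blast
qed

type_synonym KX = "complex poly fract poly"

abbreviation (input) cc :: "complex \<Rightarrow> KX" where "cc a \<equiv> [:to_fract [:a:]:]"

definition HX :: KX where "HX = [:to_fract [:0, 1:]:]"

lemma HX_nonzero [simp]: "HX \<noteq> 0"
  by (simp add: HX_def)

lemma fract_poly_hp: "fract_poly hp = HX"
  by (simp add: HX_def map_poly_pCons)

lemma fract_poly_power [simp]: "fract_poly (p ^ n) = fract_poly p ^ n"
  by (induction n) simp_all

lemma fract_poly_sum: "fract_poly (sum f A) = (\<Sum>i\<in>A. fract_poly (f i))"
  by (induction A rule: infinite_finite_induct) simp_all

text \<open>There are \<open>n\<^sup>3\<close> monomials in \<open>x, y, z\<close> with exponents below \<open>n\<close>, but after clearing denominators they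
  lie in a space of dimension quadratic in \<open>n\<close>.\<close>

lemma algebraic_relation:
  fixes x y z :: KX
  assumes "\<exists>N u. HX ^ N * x = fract_poly u" "\<exists>N u. HX ^ N * y = fract_poly u"
    "\<exists>N u. HX ^ N * z = fract_poly u"
  obtains n and \<kappa> :: "nat \<times> nat \<times> nat \<Rightarrow> complex"
    where "\<exists>i<n. \<exists>j<n. \<exists>k<n. \<kappa> (i, j, k) \<noteq> 0"
      "(\<Sum>i<n. \<Sum>j<n. \<Sum>k<n. cc (\<kappa> (i, j, k)) * x ^ i * y ^ j * z ^ k) = 0"
proof -
  obtain N1 u1 N2 u2 N3 u3 where u: "HX ^ N1 * x = fract_poly u1" "HX ^ N2 * y = fract_poly u2"
    "HX ^ N3 * z = fract_poly u3" using assms by blast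
  define N where "N = N1 + N2 + N3"
  define U where "U = hp ^ (N2 + N3) * u1"
  define V where "V = hp ^ (N1 + N3) * u2"
  define W where "W = hp ^ (N1 + N2) * u3"
  have XYZ: "fract_poly U = HX ^ N * x" "fract_poly V = HX ^ N * y" "fract_poly W = HX ^ N * z"
    unfolding U_def V_def W_def fract_poly_mult fract_poly_power fract_poly_hp u[symmetric] N_def
    by (simp_all add: power_add mult_ac)
  obtain d1 d2 d3 where d: "bidegree_le d1 U" "bidegree_le d2 V" "bidegree_le d3 W"
    using bidegree_le_exists by metis
  define d where "d = d1 + d2 + d3"
  define e where "e = 3 * (d + N)"
  \<comment> \<open>The cleared monomials will have bidegree at most \<open>e * n\<close>, so they
    span a space of dimension at most \<open>(e * n + 1)\<^sup>2\<close>, which is at most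
    \<open>n\<^sup>2 * (e + 1)\<^sup>2\<close>. Any \<open>n\<close> above
    \<open>(e + 1)\<^sup>2\<close> makes this smaller than the number of monomials.\<close>
  define n where "n = (e + 1)\<^sup>2 + 1"
  define I where "I = {..<n} \<times> {..<n} \<times> {..<n}"
  \<comment> \<open>The extra power of h brings all monomials to the same denominator: each
    \<open>w (i, j, k)\<close> is \<open>HX ^ (N * (3 * n))\<close> times the monomial, whatever its
    degree.\<close>
  define w where "w = (\<lambda>(i, j, k). hp ^ (N * (3 * n - (i + j + k))) * (U ^ i * (V ^ j * W ^ k)))"
  have dd: "bidegree_le d U" "bidegree_le d V" "bidegree_le d W"
    using d bidegree_le_mono unfolding d_def by (meson le_add1 le_add2 order_trans)+
  have w_bd: "bidegree_le (e * n) (w p)" if "p \<in> I" for p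
  proof -
    obtain i j k where p: "p = (i, j, k)" "i < n" "j < n" "k < n"
      using \<open>p \<in> I\<close> unfolding I_def by (cases p) auto
    have "bidegree_le (N * (3 * n - (i + j + k)) * 1 + (i * d + (j * d + k * d))) (w p)"
      unfolding p w_def prod.case
      by (intro bidegree_le_mult bidegree_le_power dd bidegree_le_hp)
    moreover have "N * (3 * n - (i + j + k)) * 1 + (i * d + (j * d + k * d)) \<le> e * n"
    proof -
      have "N * (3 * n - (i + j + k)) \<le> N * (3 * n)" by simp
      moreover have "i * d + (j * d + k * d) \<le> n * d + (n * d + n * d)"
        using p by (intro add_mono mult_right_mono) auto
      ultimately show ?thesis unfolding e_def by (simp add: algebra_simps)
    qed
    ultimately show ?thesis by (rule bidegree_le_mono)
  qed
  have "(e * n + 1)\<^sup>2 \<le> (n * (e + 1))\<^sup>2"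
    by (intro power_mono) (simp_all add: n_def algebra_simps)
  also have "\<dots> = n\<^sup>2 * (e + 1)\<^sup>2" by (rule power_mult_distrib)
  also have "\<dots> < n\<^sup>2 * n" by (intro mult_strict_left_mono) (simp_all add: n_def)
  also have "\<dots> = card I" unfolding I_def by (simp add: power2_eq_square)
  finally obtain \<kappa> where \<kappa>: "\<exists>p\<in>I. \<kappa> p \<noteq> 0" "(\<Sum>p\<in>I. [:[:\<kappa> p:]:] * w p) = 0"
    using sum_coeff_eq_0[of I "e * n" w] w_bd unfolding I_def by auto
  have "fract_poly ([:[:\<kappa> (i, j, k):]:] * w (i, j, k))
      = HX ^ (N * (3 * n)) * (cc (\<kappa> (i, j, k)) * x ^ i * y ^ j * z ^ k)"
    if "i < n" "j < n" "k < n" for i j k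
  proof -
    have "N * (3 * n) = N * (3 * n - (i + j + k)) + N * i + N * j + N * k"
      using that by (simp flip: distrib_left)
    then have "HX ^ (N * (3 * n)) = HX ^ (N * (3 * n - (i + j + k))) * (HX ^ N) ^ i * (HX ^ N) ^ j * (HX ^ N) ^ k"
      by (simp only: power_add power_mult)
    then show ?thesis
      unfolding w_def prod.case fract_poly_mult fract_poly_power fract_poly_hp XYZ
      by (simp add: power_mult_distrib map_poly_pCons mult_ac)
  qed
  then have "(\<Sum>p\<in>I. fract_poly ([:[:\<kappa> p:]:] * w p))
      = (\<Sum>(i, j, k)\<in>I. HX ^ (N * (3 * n)) * (cc (\<kappa> (i, j, k)) * x ^ i * y ^ j * z ^ k))"
    unfolding I_def by (intro sum.cong refl) auto
  also have "\<dots> = HX ^ (N * (3 * n)) * (\<Sum>i<n. \<Sum>j<n. \<Sum>k<n. cc (\<kappa> (i, j, k)) * x ^ i * y ^ j * z ^ k)"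
    unfolding I_def by (simp only: sum.cartesian_product[symmetric] sum_distrib_left)
  finally have "(\<Sum>i<n. \<Sum>j<n. \<Sum>k<n. cc (\<kappa> (i, j, k)) * x ^ i * y ^ j * z ^ k) = 0"
    using \<kappa>(2) unfolding fract_poly_sum[symmetric] by simp
  then show ?thesis using \<kappa>(1) unfolding I_def by (intro that[of n \<kappa>]) auto
qed

section \<open>Chains of primes in subrings of K[x]\<close>

definition prime_in :: "'a::comm_ring_1 set \<Rightarrow> 'a set \<Rightarrow> bool" where
  "prime_in B P \<longleftrightarrow> P \<subseteq> B \<and> 0 \<in> P \<and> (\<forall>x\<in>P. \<forall>y\<in>P. x - y \<in> P) \<and> (\<forall>b\<in>B. \<forall>x\<in>P. b * x \<in> P) \<and>
    1 \<notin> P \<and> (\<forall>x\<in>B. \<forall>y\<in>B. x * y \<in> P \<longrightarrow> x \<in> P \<or> y \<in> P)"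

definition subring_set :: "'a::comm_ring_1 set \<Rightarrow> bool" where
  "subring_set B \<longleftrightarrow> 0 \<in> B \<and> 1 \<in> B \<and> (\<forall>x\<in>B. \<forall>y\<in>B. x + y \<in> B \<and> x * y \<in> B \<and> x - y \<in> B)"

lemma subring_setD:
  assumes "subring_set B"
  shows "0 \<in> B" "1 \<in> B" "x \<in> B \<Longrightarrow> y \<in> B \<Longrightarrow> x + y \<in> B" "x \<in> B \<Longrightarrow> y \<in> B \<Longrightarrow> x * y \<in> B"
    "x \<in> B \<Longrightarrow> y \<in> B \<Longrightarrow> x - y \<in> B"
  using assms unfolding subring_set_def by auto

lemma subring_set_power: "subring_set B \<Longrightarrow> x \<in> B \<Longrightarrow> x ^ n \<in> B"
  by (induction n) (auto intro: subring_setD)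

lemma subring_set_sum: "subring_set B \<Longrightarrow> (\<And>i. i \<in> I \<Longrightarrow> f i \<in> B) \<Longrightarrow> sum f I \<in> B"
  by (induction I rule: infinite_finite_induct) (auto intro: subring_setD)

lemma subring_set_prod: "subring_set B \<Longrightarrow> (\<And>i. i \<in> I \<Longrightarrow> f i \<in> B) \<Longrightarrow> prod f I \<in> B"
  by (induction I rule: infinite_finite_induct) (auto intro: subring_setD)

text \<open>Along a strict chain of primes, a polynomial relation passes to its lowest coefficient.\<close>

lemma lowest_coefficient_in_prime:
  assumes B: "subring_set B" and P: "prime_in B P" and P': "prime_in B P'"
    and sub: "P \<subseteq> P'" and y: "y \<in> P'" "y \<notin> P"
    and g: "\<And>i. g i \<in> B" and m: "\<And>i. i < m \<Longrightarrow> g i = 0" "m < n"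
    and sum: "(\<Sum>i<n. g i * y ^ i) \<in> P"
  shows "g m \<in> P'"
proof -
  have yB: "y \<in> B" using y(1) P' unfolding prime_in_def by auto
  define q where "q = (\<Sum>i<n - Suc m. g (Suc m + i) * y ^ i)"
  have "(\<Sum>i<n. g i * y ^ i) = (\<Sum>i\<in>{m..<n}. g i * y ^ i)"
    using m by (intro sum.mono_neutral_right) auto
  also have "\<dots> = g m * y ^ m + (\<Sum>i\<in>{Suc m..<n}. g i * y ^ i)"
    using m(2) by (simp add: sum.atLeast_Suc_lessThan)
  also have "(\<Sum>i\<in>{Suc m..<n}. g i * y ^ i) = (\<Sum>i<n - Suc m. g (Suc m + i) * y ^ (Suc m + i))"
    by (rule sum.reindex_bij_witness[of _ "\<lambda>i. Suc m + i" "\<lambda>i. i - Suc m"]) auto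
  also have "g m * y ^ m + \<dots> = y ^ m * (g m + q * y)"
    unfolding q_def by (simp add: power_add algebra_simps sum_distrib_left sum_distrib_right)
  finally have "y ^ m * (g m + q * y) \<in> P" using sum by simp
  moreover have "q \<in> B"
    unfolding q_def by (intro subring_set_sum B subring_setD(4)[OF B] g subring_set_power yB)
  then have "g m + q * y \<in> B" using B g yB by (auto intro: subring_setD)
  moreover have "y ^ k \<notin> P" for k
    by (induction k) (use P yB y(2) subring_set_power[OF B yB] in \<open>auto simp: prime_in_def\<close>)
  ultimately have "g m + q * y \<in> P'"
    using P sub subring_set_power[OF B yB] unfolding prime_in_def by blast
  moreover have "q * y \<in> P'" using \<open>q \<in> B\<close> y(1) P' unfolding prime_in_def
    by blast
  ultimately have "(g m + q * y) - q * y \<in> P'" using P' unfolding prime_in_def by blast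
  then show ?thesis by simp
qed

text \<open>Take \<open>x\<close>, \<open>y\<close>, \<open>z\<close> in the three successive
  differences of the chain, and a nontrivial algebraic relation among them over the complex numbers.
  Its lowest coefficient in \<open>x\<close> lies in the second prime, the lowest coefficient of
  that in \<open>y\<close> in the third, and the lowest one in \<open>z\<close> in the fourth. The
  least indices \<open>m\<close>, \<open>l\<close>, \<open>r\<close> are chosen so that this last
  coefficient is a nonzero constant, which no prime contains.\<close>

lemma no_long_prime_chain:
  fixes B :: "KX set"
  assumes B: "subring_set B" and const: "\<And>a. cc a \<in> B"
    and int: "\<And>b. b \<in> B \<Longrightarrow> \<exists>N u. HX ^ N * b = fract_poly u"
    and P: "\<And>i. i \<le> 3 \<Longrightarrow> prime_in B (P i)"
      and chain: "\<And>i. i < 3 \<Longrightarrow> P i \<subset> P (Suc i)"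
  shows False
proof -
  have "\<exists>b. b \<in> P (Suc i) \<and> b \<notin> P i" if "i < 3" for i using chain[OF that]
    by blast
  then obtain b where b: "\<And>i. i < 3 \<Longrightarrow> b i \<in> P (Suc i) \<and> b i \<notin> P i" by metis
  define x y z where "x = b 0" and "y = b 1" and "z = b 2"
  have xyz: "x \<in> P 1" "x \<notin> P 0" "y \<in> P 2" "y \<notin> P 1" "z \<in> P 3" "z \<notin> P 2"
    using b[of 0] b[of 1] b[of 2] by (simp_all add: x_def y_def z_def numeral_eq_Suc)
  have PB: "\<And>i. i \<le> 3 \<Longrightarrow> P i \<subseteq> B" using P unfolding prime_in_def
    by blast
  have inB: "x \<in> B" "y \<in> B" "z \<in> B"
    using xyz PB[of 1] PB[of 2] PB[of 3] by auto
  obtain n \<kappa> where ex: "\<exists>i<n. \<exists>j<n. \<exists>k<n. \<kappa> (i, j, k) \<noteq> 0"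
    and rel: "(\<Sum>i<n. \<Sum>j<n. \<Sum>k<n. cc (\<kappa> (i, j, k)) * x ^ i * y ^ j * z ^ k) = 0"
    using algebraic_relation[OF int int int, OF inB] .
  define f where "f i = (\<Sum>j<n. \<Sum>k<n. cc (\<kappa> (i, j, k)) * y ^ j * z ^ k)" for i
  define m where "m = (LEAST i. i < n \<and> (\<exists>j<n. \<exists>k<n. \<kappa> (i, j, k) \<noteq> 0))"
  have m: "m < n" "\<exists>j<n. \<exists>k<n. \<kappa> (m, j, k) \<noteq> 0"
    using LeastI_ex[OF ex] unfolding m_def by auto
  have m0: "\<kappa> (i, j, k) = 0" if "i < m" "j < n" "k < n" for i j k
    using that not_less_Least[of i "\<lambda>i. i < n \<and> (\<exists>j<n. \<exists>k<n. \<kappa> (i, j, k) \<noteq> 0)"] m(1)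
    unfolding m_def by auto
  note closed = subring_set_sum[OF B] subring_setD(4)[OF B] subring_set_power[OF B] const inB
  have fB: "f i \<in> B" for i unfolding f_def by (intro closed)
  have f0: "f i = 0" if "i < m" for i using m0[OF that] unfolding f_def by simp
  have "(\<Sum>i<n. f i * x ^ i) = 0"
    using rel unfolding f_def by (simp add: sum_distrib_left sum_distrib_right mult_ac)
  then have "(\<Sum>i<n. f i * x ^ i) \<in> P 0" using P[of 0] unfolding prime_in_def by simp
  then have fm: "f m \<in> P 1"
    using xyz m(1) f0 fB chain[of 0]
    by (intro lowest_coefficient_in_prime[OF B P[of 0] P[of 1], of x f m n]) auto
  define g where "g j = (\<Sum>k<n. cc (\<kappa> (m, j, k)) * z ^ k)" for j
  define l where "l = (LEAST j. j < n \<and> (\<exists>k<n. \<kappa> (m, j, k) \<noteq> 0))"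
  have l: "l < n" "\<exists>k<n. \<kappa> (m, l, k) \<noteq> 0"
    using LeastI_ex[OF m(2)] unfolding l_def by auto
  have l0: "\<kappa> (m, j, k) = 0" if "j < l" "k < n" for j k
    using that not_less_Least[of j "\<lambda>j. j < n \<and> (\<exists>k<n. \<kappa> (m, j, k) \<noteq> 0)"] l(1)
    unfolding l_def by auto
  have gB: "g j \<in> B" for j unfolding g_def by (intro closed)
  have g0: "g j = 0" if "j < l" for j using l0[OF that] unfolding g_def by simp
  have "(\<Sum>j<n. g j * y ^ j) = f m"
    unfolding f_def g_def by (simp add: sum_distrib_left sum_distrib_right mult_ac)
  then have gl: "g l \<in> P 2"
    using xyz l(1) g0 gB chain[of 1] fm
    by (intro lowest_coefficient_in_prime[OF B P[of 1] P[of 2], of y g l n])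
      (auto simp: numeral_2_eq_2)
  define r where "r = (LEAST k. k < n \<and> \<kappa> (m, l, k) \<noteq> 0)"
  have r: "r < n" "\<kappa> (m, l, r) \<noteq> 0"
    using LeastI_ex[OF l(2)] unfolding r_def by auto
  have r0: "\<kappa> (m, l, k) = 0" if "k < r" for k
    using that not_less_Least[of k "\<lambda>k. k < n \<and> \<kappa> (m, l, k) \<noteq> 0"] r(1)
      unfolding r_def by auto
  have \<kappa>P: "cc (\<kappa> (m, l, r)) \<in> P 3"
    using xyz r(1) r0 chain[of 2] gl
    by (intro lowest_coefficient_in_prime[OF B P[of 2] P[of 3], of z "\<lambda>k. cc (\<kappa> (m, l, k))" r n])
      (auto simp: g_def numeral_3_eq_3 numeral_2_eq_2 simp del: mult_pCons_left intro: const)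
  have "cc (inverse (\<kappa> (m, l, r))) * cc (\<kappa> (m, l, r)) = 1"
    using r(2) by (simp flip: to_fract_mult add: one_pCons[symmetric])
  then have "1 \<in> P 3" using \<kappa>P const P[of 3] unfolding prime_in_def by (metis order_refl)
  then show False using P[of 3] unfolding prime_in_def by simp
qed

text \<open>A longer chain has four members at its start, and their images under \<open>j\<close>
  form a chain of primes in a subring of K[x].\<close>

lemma krull_dim_le_2:
  fixes j :: "'b \<Rightarrow> KX"
  assumes R: "ring R" and j: "j \<in> ring_hom R ring_of_type_algebra" "inj_on j (carrier R)"
    and const: "\<And>a. cc a \<in> j ` carrier R"
    and int: "\<And>b. b \<in> carrier R \<Longrightarrow> \<exists>N u. HX ^ N * j b = fract_poly u"
    and P: "\<And>i. i \<le> n \<Longrightarrow> primeideal (P i) R"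
      and chain: "\<And>i. i < n \<Longrightarrow> P i \<subset> P (Suc i)"
  shows "n \<le> 2"
proof (rule ccontr)
  assume "\<not> n \<le> 2"
  then have n: "3 \<le> n" by simp
  interpret ring_hom_ring R "ring_of_type_algebra :: KX ring" j
    using R j(1) ring_from_type_algebra by (auto intro!: ring_hom_ringI2)
  note hom = hom_mult hom_add hom_one hom_zero
  have B: "subring_set (j ` carrier R)"
    unfolding subring_set_def
  proof (intro conjI ballI; (elim imageE)?)
    show "0 \<in> j ` carrier R" "1 \<in> j ` carrier R"
      using hom_one hom_zero imageI[OF R.one_closed, of j] imageI[OF R.zero_closed, of j] by auto
    fix x y u v assume "x = j u" "y = j v" "u \<in> carrier R" "v \<in> carrier R"
    moreover have "j u - j v = j (u \<ominus>\<^bsub>R\<^esub> v)"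
      if "u \<in> carrier R" "v \<in> carrier R" for u v
      using that by (simp add: R.minus_eq)
    ultimately show "x + y \<in> j ` carrier R" "x * y \<in> j ` carrier R" "x - y \<in> j ` carrier R"
      using hom_add[of u v] hom_mult[of u v] imageI[OF R.a_closed[of u v], of j]
        imageI[OF R.m_closed[of u v], of j] imageI[OF R.minus_closed[of u v], of j] by auto
  qed
  have "prime_in (j ` carrier R) (j ` P i)" if "i \<le> 3" for i
  proof -
    interpret Pi: primeideal "P i" R using P that n by simp
    have mem: "j u \<in> j ` P i \<longleftrightarrow> u \<in> P i" if "u \<in> carrier R" for u
      using that inj_onD[OF j(2), of u] Pi.a_subset by blast
    have p1: "1 \<notin> j ` P i"
      using mem[of "\<one>\<^bsub>R\<^esub>"] Pi.I_notcarr Pi.one_imp_carrier by auto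
    have p2: "0 \<in> j ` P i"
      using mem[of "\<zero>\<^bsub>R\<^esub>"] by auto
    have p3: "x - y \<in> j ` P i" if "x \<in> j ` P i" "y \<in> j ` P i" for x y
    proof -
      obtain u v where uv: "x = j u" "y = j v" "u \<in> P i" "v \<in> P i"
        using \<open>x \<in> j ` P i\<close> \<open>y \<in> j ` P i\<close> by blast
      then have c: "u \<in> carrier R" "v \<in> carrier R" using Pi.a_subset by auto
      have eq: "x - y = j (u \<oplus>\<^bsub>R\<^esub> \<ominus>\<^bsub>R\<^esub> v)" using uv c
        by simp
      have "j (u \<oplus>\<^bsub>R\<^esub> \<ominus>\<^bsub>R\<^esub> v) \<in> j ` P i"
        using uv by (intro imageI Pi.a_closed Pi.a_inv_closed)
      then show ?thesis unfolding eq .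
    qed
    have p4: "b * x \<in> j ` P i" if "b \<in> j ` carrier R" "x \<in> j ` P i" for b x
    proof -
      obtain u v where uv: "x = j u" "b = j v" "u \<in> P i" "v \<in> carrier R"
        using \<open>x \<in> j ` P i\<close> \<open>b \<in> _\<close> by blast
      then have c: "u \<in> carrier R" using Pi.a_subset by auto
      have eq: "b * x = j (v \<otimes>\<^bsub>R\<^esub> u)" using uv c by simp
      have "j (v \<otimes>\<^bsub>R\<^esub> u) \<in> j ` P i"
        using uv by (intro imageI Pi.I_l_closed)
      then show ?thesis unfolding eq .
    qed
    have p5: "x \<in> j ` P i \<or> y \<in> j ` P i"
      if "x \<in> j ` carrier R" "y \<in> j ` carrier R" "x * y \<in> j ` P i" for x y
    proof -
      obtain u v where uv: "x = j u" "y = j v" "u \<in> carrier R" "v \<in> carrier R"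
        using \<open>x \<in> j ` carrier R\<close> \<open>y \<in> _\<close> by blast
      then have "u \<otimes>\<^bsub>R\<^esub> v \<in> P i"
        using \<open>x * y \<in> _\<close> mem[of "u \<otimes>\<^bsub>R\<^esub> v"] by simp
      then show ?thesis using Pi.I_prime[of u v] uv by blast
    qed
    have p6: "j ` P i \<subseteq> j ` carrier R" using Pi.a_subset by auto
    show ?thesis
      unfolding prime_in_def by (intro conjI ballI impI) (assumption | rule p1 p2 p3 p4 p5 p6)+
  qed
  moreover have "j ` P i \<subset> j ` P (Suc i)" if i3: "i < 3" for i
  proof -
    interpret Pi: primeideal "P i" R using P i3 n by simp
    interpret PSi: primeideal "P (Suc i)" R using P i3 n by simp
    obtain x where x: "x \<in> P (Suc i)" "x \<notin> P i" using chain[of i] i3 n by auto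
    have "j x \<notin> j ` P i"
    proof
      assume "j x \<in> j ` P i"
      then obtain w where "j x = j w" "w \<in> P i" by blast
      then show False
        using x inj_onD[OF j(2), of x w] PSi.a_subset Pi.a_subset by auto
    qed
    moreover have "P i \<subseteq> P (Suc i)" using chain[of i] i3 n by auto
    ultimately show ?thesis using x by blast
  qed
  ultimately show False
    by (intro no_long_prime_chain[OF B const, of "\<lambda>i. j ` P i"]) (use int in auto)
qed

lemma ring_hom_kernel_prime:
  fixes h :: "'b \<Rightarrow> 'k::idom"
  assumes R: "cring R" and h: "h \<in> ring_hom R ring_of_type_algebra"
  shows "primeideal {x \<in> carrier R. h x = 0} R"
proof -
  interpret R: cring R by (rule R)
  interpret ring_hom_ring R "ring_of_type_algebra :: 'k ring" h
    using h ring_from_type_algebra R.ring_axioms by (auto intro!: ring_hom_ringI2)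
  have "{x \<in> carrier R. h x = 0} = a_kernel R (ring_of_type_algebra :: 'k ring) h"
    unfolding a_kernel_def' by simp
  then have "ideal {x \<in> carrier R. h x = 0} R" using kernel_is_ideal by simp
  then show ?thesis
  proof (rule primeidealI[OF _ R])
    show "carrier R \<noteq> {x \<in> carrier R. h x = 0}"
    proof
      assume "carrier R = {x \<in> carrier R. h x = 0}"
      then have "h \<one>\<^bsub>R\<^esub> = 0" using R.one_closed by blast
      then show False using hom_one by simp
    qed
  next
    fix a b assume "a \<in> carrier R" "b \<in> carrier R" "a \<otimes>\<^bsub>R\<^esub> b \<in> {x \<in> carrier R. h x = 0}"
    then show "a \<in> {x \<in> carrier R. h x = 0} \<or> b \<in> {x \<in> carrier R. h x = 0}"
      using hom_mult[of a b] by simp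
  qed
qed

lemma reduced_quotientI:
  assumes R: "cring R" and I: "ideal I R"
    and rad: "\<And>x n. x \<in> carrier R \<Longrightarrow> x [^]\<^bsub>R\<^esub> (n::nat) \<in> I \<Longrightarrow> x \<in> I"
  shows "reduced_ring (R Quot I)"
  unfolding reduced_ring_def
proof (intro ballI allI impI)
  fix U n assume U: "U \<in> carrier (R Quot I)" "U [^]\<^bsub>R Quot I\<^esub> (n::nat) = \<zero>\<^bsub>R Quot I\<^esub>"
  interpret R: cring R by (rule R)
  interpret I: ideal I R by (rule I)
  interpret h: ring_hom_cring R "R Quot I" "(+>\<^bsub>R\<^esub>) I"
    by (rule I.rcos_ring_hom_cring[OF R])
  have "U \<in> (\<Union>a\<in>carrier R. {I +>\<^bsub>R\<^esub> a})"
    using U(1) unfolding FactRing_def A_RCOSETS_def' by (simp only: partial_object.simps)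
  then obtain x where x: "x \<in> carrier R" "U = I +>\<^bsub>R\<^esub> x" by blast
  have pow: "I +>\<^bsub>R\<^esub> (x [^]\<^bsub>R\<^esub> n) = (I +>\<^bsub>R\<^esub> x) [^]\<^bsub>R Quot I\<^esub> n"
    by (rule h.hom_pow[OF x(1)])
  have zero: "\<zero>\<^bsub>R Quot I\<^esub> = I" by (simp only: FactRing_def ring_record_simps)
  have "I +>\<^bsub>R\<^esub> (x [^]\<^bsub>R\<^esub> n) = I"
    using U(2) unfolding x(2) pow zero .
  then have "x [^]\<^bsub>R\<^esub> n \<in> I"
    using I.a_rcos_self[of "x [^]\<^bsub>R\<^esub> n"] x(1) by simp
  then have "x \<in> I" using rad x(1) by blast
  then show "U = \<zero>\<^bsub>R Quot I\<^esub>"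
    unfolding x(2) zero by (rule I.a_rcos_const)
qed

lemma (in embedded_ring) j_finsum:
  assumes "finite F" "\<And>i. i \<in> F \<Longrightarrow> f i \<in> carrier R"
  shows "j (finsum R f F) = (\<Sum>i\<in>F. j (f i))"
  using assms
proof (induction F rule: finite_induct)
  case (insert x F)
  then have "finsum R f F \<in> carrier R" by (intro finsum_closed) auto
  moreover have "finsum R f (insert x F) = f x \<oplus> finsum R f F"
    using insert by (intro finsum_insert) auto
  ultimately show ?case using insert by simp
qed simp

lemma to_fract_const_1 [simp]: "to_fract [:1 :: complex:] = 1"
  unfolding one_pCons[symmetric] by simp

section \<open>Residues modulo h\<close>

definition red :: "complex poly poly \<Rightarrow> complex poly" where
  "red u = map_poly (\<lambda>c. coeff c 0) u"

lemma coeff_red [simp]: "coeff (red u) i = coeff (coeff u i) 0"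
  by (simp add: red_def coeff_map_poly)

lemma red_simps [simp]:
  "red 0 = 0" "red 1 = 1" "red (u + v) = red u + red v" "red (u - v) = red u - red v"
  "red (u * v) = red u * red v" "red [:[:a:]:] = [:a:]" "red hp = 0"
  "red (smult b u) = smult (coeff b 0) (red u)" "red (pCons b u) = pCons (coeff b 0) (red u)"
  by (auto intro!: poly_eqI simp: coeff_mult coeff_sum coeff_pCons coeff_1 split: nat.splits)

lemma red_eq_0_iff: "red u = 0 \<longleftrightarrow> hp dvd u"
proof
  assume "red u = 0"
  then have 0: "coeff (coeff u i) 0 = 0" for i using coeff_red[of u i] by simp
  have "[:0, 1:] dvd coeff u i" for i
    using 0[of i] poly_eq_0_iff_dvd[of "coeff u i" 0] by (simp add: poly_0_coeff_0)
  then show "hp dvd u" by (simp add: const_poly_dvd_iff)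
qed (auto elim: dvdE)

text \<open>\<open>resid f g\<close> says that \<open>f\<close> has coefficients in \<open>\<complex>[h]\<close> and reduces to \<open>g\<close> modulo \<open>h\<close>; this is a partial
  ring homomorphism from \<open>K[t]\<close> to \<open>\<complex>[t]\<close>.\<close>

definition resid :: "KX \<Rightarrow> complex poly \<Rightarrow> bool" where
  "resid f g \<longleftrightarrow> (\<exists>u. f = fract_poly u \<and> red u = g)"

lemma resid_unique: "resid f g \<Longrightarrow> resid f g' \<Longrightarrow> g = g'"
  unfolding resid_def by (metis fract_poly_eq_iff)

lemma resid_add: "resid f g \<Longrightarrow> resid f' g' \<Longrightarrow> resid (f + f') (g + g')"
  unfolding resid_def by (metis fract_poly_add red_simps(3))

lemma resid_diff: "resid f g \<Longrightarrow> resid f' g' \<Longrightarrow> resid (f - f') (g - g')"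
  unfolding resid_def by (metis fract_poly_diff red_simps(4))

lemma resid_mult: "resid f g \<Longrightarrow> resid f' g' \<Longrightarrow> resid (f * f') (g * g')"
  unfolding resid_def by (metis fract_poly_mult red_simps(5))

lemma resid_1: "resid 1 1" unfolding resid_def by (intro exI[of _ 1]) simp

lemma resid_const: "resid [:to_fract a:] [:coeff a 0:]"
  unfolding resid_def by (intro exI[of _ "[:a:]"]) (simp add: map_poly_pCons)

lemma resid_prod: "(\<And>i. i \<in> I \<Longrightarrow> resid (f i) (g i)) \<Longrightarrow> resid (prod f I) (prod g I)"
  by (induction I rule: infinite_finite_induct) (auto intro: resid_1 resid_mult)

lemma resid_power: "resid f g \<Longrightarrow> resid (f ^ n) (g ^ n)"
  by (induction n) (auto intro: resid_1 resid_mult)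

lemma resid_0_iff: "resid f 0 \<longleftrightarrow> (\<exists>u. f = HX * fract_poly u)"
proof
  assume "resid f 0"
  then obtain u where "f = fract_poly (hp * u)" unfolding resid_def red_eq_0_iff
    by (auto elim: dvdE)
  then show "\<exists>u. f = HX * fract_poly u" unfolding fract_poly_mult fract_poly_hp by blast
next
  assume "\<exists>u. f = HX * fract_poly u"
  then obtain u where "f = fract_poly (hp * u)" unfolding fract_poly_mult fract_poly_hp by blast
  then show "resid f 0" unfolding resid_def by (intro exI[of _ "hp * u"]) simp
qed

lemma integral_imp_resid: "f = fract_poly u \<Longrightarrow> \<exists>g. resid f g"
  unfolding resid_def by blast

text \<open>The criterion by which the surface is recognized. \<open>radical\<close> is reducedness
  of the quotient by h. The substitution of \<open>\<sigma> + \<tau> * t\<close> for x is a chart in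
  which all of B is regular: \<open>chart\<close> bounds the denominators of leading coefficients,
  which gives a basis, and \<open>chart_nonconst\<close> makes its residue map onto functions of t
  nonconstant, which gives a chain of primes over h = 0.\<close>

locale danielewski_model = cring B for B :: "('b, 'y) ring_scheme" (structure) +
  fixes \<phi> :: "complex poly \<Rightarrow> 'b" and j :: "'b \<Rightarrow> KX" and \<sigma> \<tau> :: "complex poly"
  assumes j_hom: "j \<in> ring_hom B ring_of_type_algebra"
    and j_inj: "inj_on j (carrier B)"
    and \<phi>_closed [simp]: "\<phi> a \<in> carrier B"
    and j_\<phi> [simp]: "j (\<phi> a) = [:to_fract a:]"
    and x_in: "[:0, 1:] \<in> j ` carrier B"
    and denominators: "b \<in> carrier B \<Longrightarrow> \<exists>N u. HX ^ N * j b = fract_poly u"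
    and radical: "b \<in> carrier B \<Longrightarrow> c \<in> carrier B \<Longrightarrow> j b ^ n = HX * j c \<Longrightarrow>
      \<exists>d\<in>carrier B. j b = HX * j d"
    and \<tau>_nonzero: "\<tau> \<noteq> 0"
    and chart: "b \<in> carrier B \<Longrightarrow> \<exists>u. pcompose (j b) (fract_poly [:\<sigma>, \<tau>:]) = fract_poly u"
    and chart_nonconst: "\<exists>b\<in>carrier B. \<exists>d c0. c0 \<noteq> 0 \<and>
      resid (pcompose (j b) (fract_poly [:\<sigma>, \<tau>:])) [:d, c0:]"
    and finite_generation: "\<exists>F. finite F \<and> F \<subseteq> carrier B \<and>
      generate_ring B (range (\<lambda>c. \<phi> [:c:]) \<union> F) = carrier B"
begin

lemma field_embedding: "embedded_ring B (\<lambda>b. to_fract (j b))"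
proof
  show "(\<lambda>b. to_fract (j b)) \<in> ring_hom B ring_of_type_algebra"
    using j_hom by (auto simp: ring_hom_def)
  show "inj_on (\<lambda>b. to_fract (j b)) (carrier B)"
    using j_inj by (auto simp: inj_on_def)
qed

sublocale F: embedded_ring B "\<lambda>b. to_fract (j b)" by (rule field_embedding)

lemma j_simps [simp]:
  "x \<in> carrier B \<Longrightarrow> y \<in> carrier B \<Longrightarrow> j (x \<otimes> y) = j x * j y"
  "x \<in> carrier B \<Longrightarrow> y \<in> carrier B \<Longrightarrow> j (x \<oplus> y) = j x + j y"
  "j \<one> = 1" "j \<zero> = 0"
  "x \<in> carrier B \<Longrightarrow> j (\<ominus> x) = - j x"
  "x \<in> carrier B \<Longrightarrow> j (x [^] (n::nat)) = j x ^ n"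
proof -
  show "x \<in> carrier B \<Longrightarrow> y \<in> carrier B \<Longrightarrow> j (x \<otimes> y) = j x * j y"
    "x \<in> carrier B \<Longrightarrow> y \<in> carrier B \<Longrightarrow> j (x \<oplus> y) = j x + j y" "j \<one> = 1"
    using j_hom by (auto simp: ring_hom_def)
  show "j \<zero> = 0" using F.j_simps(4) unfolding to_fract_eq_0_iff .
  show "x \<in> carrier B \<Longrightarrow> j (\<ominus> x) = - j x"
    by (metis F.j_a_inv to_fract_eq_iff to_fract_uminus)
  show "x \<in> carrier B \<Longrightarrow> j (x [^] (n::nat)) = j x ^ n"
    by (induction n) (use j_hom in \<open>auto simp: ring_hom_def mult.commute\<close>)
qed

lemma j_minus [simp]: "x \<in> carrier B \<Longrightarrow> y \<in> carrier B \<Longrightarrow> j (x \<ominus> y) = j x - j y"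
  by (simp add: minus_eq)

lemma j_eq_iff: "x \<in> carrier B \<Longrightarrow> y \<in> carrier B \<Longrightarrow> j x = j y \<longleftrightarrow> x = y"
  using j_inj by (auto dest: inj_onD)

lemma j_finsum:
  "finite I \<Longrightarrow> (\<And>i. i \<in> I \<Longrightarrow> f i \<in> carrier B) \<Longrightarrow> j (finsum B f I) = (\<Sum>i\<in>I. j (f i))"
  using F.j_finsum[of I f] by (simp flip: to_fract_sum)

abbreviation "Bim \<equiv> j ` carrier B"

lemma Bim_closed:
  "x \<in> Bim \<Longrightarrow> y \<in> Bim \<Longrightarrow> x + y \<in> Bim" "x \<in> Bim \<Longrightarrow> y \<in> Bim \<Longrightarrow> x * y \<in> Bim"
  "x \<in> Bim \<Longrightarrow> - x \<in> Bim" "0 \<in> Bim" "1 \<in> Bim"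
proof -
  fix x y assume "x \<in> Bim" "y \<in> Bim"
  then obtain u v where *: "u \<in> carrier B" "v \<in> carrier B" "x = j u" "y = j v" by blast
  then have "x + y = j (u \<oplus> v)" "x * y = j (u \<otimes> v)" "- x = j (\<ominus> u)"
    by simp_all
  then show "x + y \<in> Bim" "x * y \<in> Bim" using * by (auto simp del: j_simps)
next
  fix x assume "x \<in> Bim"
  then obtain u where *: "u \<in> carrier B" "x = j u" by blast
  then have "- x = j (\<ominus> u)" by simp
  then show "- x \<in> Bim" using * by (auto simp del: j_simps)
next
  show "0 \<in> Bim" "1 \<in> Bim" using j_simps(3,4) one_closed zero_closed by (metis imageI)+
qed

lemma const_in_Bim: "[:to_fract a:] \<in> Bim"
  using imageI[OF \<phi>_closed, of j a] by simp

lemma HX_in_Bim: "HX \<in> Bim"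
  unfolding HX_def by (rule const_in_Bim)

lemma Bim_sum: "(\<And>i. i \<in> I \<Longrightarrow> f i \<in> Bim) \<Longrightarrow> sum f I \<in> Bim"
  by (induction I rule: infinite_finite_induct) (auto intro: Bim_closed)

lemma Bim_power: "x \<in> Bim \<Longrightarrow> x ^ n \<in> Bim"
  by (induction n) (auto intro: Bim_closed)

lemma integral_in_Bim: "fract_poly u \<in> Bim"
proof (induction u)
  case (pCons a u)
  have "fract_poly (pCons a u) = [:to_fract a:] + [:0, 1:] * fract_poly u"
    by (simp add: map_poly_pCons)
  then show ?case using pCons x_in const_in_Bim Bim_closed by metis
qed (simp add: Bim_closed)

lemma \<phi>_hom: "\<phi> \<in> ring_hom Ch B"
proof (rule ring_hom_memI)
  fix a b :: "complex poly"
  show "\<phi> (a \<otimes>\<^bsub>Ch\<^esub> b) = \<phi> a \<otimes> \<phi> b" "\<phi> (a \<oplus>\<^bsub>Ch\<^esub> b) = \<phi> a \<oplus> \<phi> b"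
    by (simp_all flip: j_eq_iff)
qed (simp_all flip: j_eq_iff add: one_pCons)

lemma \<phi>_simps: "\<phi> (a * b) = \<phi> a \<otimes> \<phi> b" "\<phi> 1 = \<one>" "\<phi> 0 = \<zero>" "\<phi> (a + b) = \<phi> a \<oplus> \<phi> b"
  by (simp_all flip: j_eq_iff add: one_pCons)

lemma domain_B: "domain B" by (rule F.is_domain)

subsection \<open>Dimension\<close>

text \<open>Residues are unique, so choosing one for each element already gives a homomorphism:
  restriction to the curve h = 0 of the chart.\<close>

lemma chart_residue_hom:
  obtains \<rho> where "\<rho> \<in> ring_hom B (ring_of_type_algebra :: complex poly ring)"
    "\<And>b. b \<in> carrier B \<Longrightarrow> resid (pcompose (j b) (fract_poly [:\<sigma>, \<tau>:])) (\<rho> b)"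
proof -
  have "\<exists>g. resid (pcompose (j b) (fract_poly [:\<sigma>, \<tau>:])) g"
    if "b \<in> carrier B" for b
    using chart[OF that] integral_imp_resid by blast
  then obtain \<rho> where \<rho>:
    "\<And>b. b \<in> carrier B \<Longrightarrow> resid (pcompose (j b) (fract_poly [:\<sigma>, \<tau>:])) (\<rho> b)" by metis
  have "\<rho> \<in> ring_hom B (ring_of_type_algebra :: complex poly ring)"
  proof (rule ring_hom_memI)
    fix x y assume "x \<in> carrier B" "y \<in> carrier B"
    then show "\<rho> (x \<otimes> y) = \<rho> x \<otimes>\<^bsub>Ch\<^esub> \<rho> y" "\<rho> (x \<oplus> y) = \<rho> x \<oplus>\<^bsub>Ch\<^esub> \<rho> y"
      using \<rho>[of x] \<rho>[of y] \<rho>[of "x \<otimes> y"] \<rho>[of "x \<oplus> y"] resid_unique resid_mult resid_add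
      by (auto simp: pcompose_mult pcompose_add)
  next
    show "\<rho> \<one> = \<one>\<^bsub>Ch\<^esub>" using \<rho>[of \<one>] resid_1 resid_unique
      by (simp add: pcompose_1)
  qed simp
  with \<rho> show ?thesis using that by blast
qed

text \<open>\<open>P1\<close> is the kernel of the residue map of the chart, which contains h.
  \<open>P2\<close> is the kernel of the residue map followed by evaluation at
  \<open>- d / c0\<close>, the zero of the nonconstant residue provided by
  \<open>chart_nonconst\<close>; that element separates the two.\<close>

lemma exists_prime_chain:
  obtains P1 P2
    where "primeideal P1 B" "primeideal P2 B" "P1 \<subset> P2" "\<phi> [:0, 1:] \<in> P1"
proof -
  obtain \<rho> where \<rho>: "\<rho> \<in> ring_hom B (ring_of_type_algebra :: complex poly ring)"
    and res: "\<And>b. b \<in> carrier B \<Longrightarrow> resid (pcompose (j b) (fract_poly [:\<sigma>, \<tau>:])) (\<rho> b)"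
    using chart_residue_hom by blast
  obtain b d c0 where b: "b \<in> carrier B" "c0 \<noteq> 0"
    "resid (pcompose (j b) (fract_poly [:\<sigma>, \<tau>:])) [:d, c0:]"
    using chart_nonconst by blast
  have \<rho>b: "\<rho> b = [:d, c0:]" using resid_unique res b by blast
  have hom: "(\<lambda>x. poly (\<rho> x) (- d / c0)) \<in> ring_hom B (ring_of_type_algebra :: complex ring)"
    using \<rho> by (auto simp: ring_hom_def)
  let ?P1 = "{x \<in> carrier B. \<rho> x = 0}" and ?P2 = "{x \<in> carrier B. poly (\<rho> x) (- d / c0) = 0}"
  have "b \<in> ?P2" "b \<notin> ?P1" using b \<rho>b by auto
  moreover have "?P1 \<subseteq> ?P2" by auto
  moreover have "\<rho> (\<phi> [:0, 1:]) = 0"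
    using res[of "\<phi> [:0, 1:]"] resid_const[of "[:0, 1:]"] resid_unique by fastforce
  ultimately show ?thesis
    using that[of ?P1 ?P2] ring_hom_kernel_prime[OF cring_axioms \<rho>]
      ring_hom_kernel_prime[OF cring_axioms hom] by auto
qed

lemma krull_dim_B: "krull_dim B = 2"
proof -
  obtain P1 P2 where P: "primeideal P1 B" "primeideal P2 B" "P1 \<subset> P2" "\<phi> [:0, 1:] \<in> P1"
    using exists_prime_chain .
  have z: "primeideal {\<zero>} B" using domain.zeroprimeideal[OF domain_B] .
  have "\<phi> [:0, 1:] \<noteq> \<zero>" using j_eq_iff[of "\<phi> [:0, 1:]" \<zero>] by simp
  moreover have "\<zero> \<in> P1"
    using P(1) by (simp add: additive_subgroup.zero_closed ideal.axioms(1) primeideal.axioms(1))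
  ultimately have "{\<zero>} \<subset> P1" using P(4) by auto
  then have chain: "\<exists>P. (\<forall>i\<le>2. primeideal (P i) B) \<and> (\<forall>i<2. P i \<subset> P (Suc i))"
    using P z by (intro exI[of _ "\<lambda>i::nat. if i = 0 then {\<zero>} else if i = 1 then P1 else P2"])
      (auto simp: less_2_cases_iff)
  have "n \<le> 2"
    if "\<exists>P. (\<forall>i\<le>n. primeideal (P i) B) \<and> (\<forall>i<n. P i \<subset> P (Suc i))" for n
    using that krull_dim_le_2[OF ring_axioms j_hom j_inj const_in_Bim denominators] by blast
  then have "krull_dim B \<le> enat 2"
    unfolding krull_dim_def by (intro Sup_least, elim CollectE exE conjE) (simp, blast)
  moreover have "enat 2 \<le> krull_dim B"
    unfolding krull_dim_def using chain by (intro Sup_upper) auto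
  ultimately show ?thesis by (simp add: numeral_eq_enat)
qed

subsection \<open>Normality\<close>

lemma common_denominator:
  assumes "finite I" "\<And>i. i \<in> I \<Longrightarrow> b i \<in> carrier B"
  shows "\<exists>N. \<forall>i\<in>I. \<exists>u. HX ^ N * j (b i) = fract_poly u"
  using assms
proof (induction I rule: finite_induct)
  case (insert i I)
  then obtain N where N: "\<forall>i\<in>I. \<exists>u. HX ^ N * j (b i) = fract_poly u" by auto
  obtain M u where M: "HX ^ M * j (b i) = fract_poly u" using denominators insert.prems by blast
  have "\<exists>u. HX ^ (N + M) * j (b k) = fract_poly u" if k: "k \<in> insert i I" for k
  proof (cases "k = i")
    case True
    have "HX ^ (N + M) * j (b i) = fract_poly (hp ^ N * u)"
      unfolding fract_poly_mult fract_poly_power fract_poly_hp M[symmetric]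
      by (simp only: power_add mult_ac)
    then show ?thesis using True by blast
  next
    case False
    then obtain v where v: "HX ^ N * j (b k) = fract_poly v" using k N by blast
    have "HX ^ (N + M) * j (b k) = fract_poly (hp ^ M * v)"
      unfolding fract_poly_mult fract_poly_power fract_poly_hp v[symmetric]
      by (simp only: power_add mult_ac)
    then show ?thesis by blast
  qed
  then show ?case by blast
qed simp

text \<open>Gauss: a fraction integral over \<open>B\<close> has a power of \<open>h\<close> as denominator, since \<open>\<complex>[h][x]\<close> is factorial.\<close>

lemma integrally_closed_aux:
  assumes f: "f \<in> carrier B" and g: "g \<in> carrier B" "j g \<noteq> 0"
    and c: "\<And>i. i < n \<Longrightarrow> c i \<in> carrier B"
    and eq: "j f ^ n + (\<Sum>i<n. j (c i) * j f ^ i * j g ^ (n - i)) = 0"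
  shows "\<exists>M. \<exists>y\<in>carrier B. HX ^ M * j f = j y * j g"
proof -
  obtain N where N: "\<forall>b\<in>{f, g}. \<exists>u. HX ^ N * j b = fract_poly u"
    using common_denominator[of "{f, g}" "\<lambda>b. b"] f g by blast
  then obtain u v where u: "HX ^ N * j f = fract_poly u" and v: "HX ^ N * j g = fract_poly v"
    by blast
  have v0: "v \<noteq> 0"
  proof
    assume "v = 0"
    then have "HX ^ N * j g = 0" using v by simp
    then show False using g(2) by simp
  qed
  \<comment> \<open>Dividing by the gcd writes f / g as the fraction \<open>u' / v'\<close> in
    lowest terms.\<close>
  define d where "d = gcd u v"
  obtain u' v' where uv: "u = u' * d" "v = v' * d" "coprime u' v'" and d: "d \<noteq> 0"
    using gcd_coprime_exists[of u v] v0 unfolding d_def by auto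
  have fg: "j f * fract_poly v' = j g * fract_poly u'"
  proof -
    have "HX ^ N * fract_poly d * (j f * fract_poly v') = HX ^ N * j f * fract_poly v"
      unfolding uv fract_poly_mult by (simp only: mult_ac)
    also have "\<dots> = HX ^ N * j g * fract_poly u" unfolding u v by (simp only: mult_ac)
    also have "\<dots> = HX ^ N * fract_poly d * (j g * fract_poly u')"
      unfolding uv fract_poly_mult by (simp only: mult_ac)
    finally show ?thesis using d by (subst (asm) mult_cancel_left) simp
  qed
  obtain M where "\<forall>i\<in>{..<n}. \<exists>w. HX ^ M * j (c i) = fract_poly w"
    using common_denominator[of "{..<n}" c] c by blast
  then obtain w where w: "\<And>i. i < n \<Longrightarrow> HX ^ M * j (c i) = fract_poly (w i)"
    by (metis lessThan_iff)
  \<comment> \<open>The integral equation with its coefficients cleared by \<open>HX ^ M\<close> and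
    with f / g replaced by \<open>u' / v'\<close>. The powers of \<open>j g\<close> and
    \<open>v'\<close> on the two sides take the place of division.\<close>
  have "j g ^ n * fract_poly (hp ^ M * u' ^ n + (\<Sum>i<n. w i * u' ^ i * v' ^ (n - i)))
     = HX ^ M * fract_poly v' ^ n * (j f ^ n + (\<Sum>i<n. j (c i) * j f ^ i * j g ^ (n - i)))"
  proof -
    have 1: "j g ^ n * fract_poly u' ^ n = fract_poly v' ^ n * j f ^ n"
      using fg by (metis mult.commute power_mult_distrib)
    have 2: "j g ^ n * fract_poly (w i * u' ^ i * v' ^ (n - i))
        = HX ^ M * fract_poly v' ^ n * (j (c i) * j f ^ i * j g ^ (n - i))" if "i < n" for i
    proof -
      have g_split: "j g ^ n = j g ^ i * j g ^ (n - i)"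
        and v_split: "fract_poly v' ^ n = fract_poly v' ^ i * fract_poly v' ^ (n - i)"
        using that by (simp_all flip: power_add)
      have swap: "j g ^ i * fract_poly u' ^ i = fract_poly v' ^ i * j f ^ i"
        using fg by (metis mult.commute power_mult_distrib)
      have "j g ^ n * fract_poly (w i * u' ^ i * v' ^ (n - i))
          = (j g ^ i * fract_poly u' ^ i) * (HX ^ M * j (c i) * j g ^ (n - i) * fract_poly v' ^ (n - i))"
        unfolding fract_poly_mult fract_poly_power w[OF that, symmetric] g_split
        by (simp only: mult_ac)
      also have "\<dots> = HX ^ M * fract_poly v' ^ n * (j (c i) * j f ^ i * j g ^ (n - i))"
        unfolding swap v_split by (simp only: mult_ac)
      finally show ?thesis .
    qed
    show ?thesis
      unfolding fract_poly_add fract_poly_sum distrib_left sum_distrib_left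
      using 1 2 by (simp add: fract_poly_hp mult_ac)
  qed
  also have "\<dots> = 0" using eq by simp
  finally have "fract_poly (hp ^ M * u' ^ n + (\<Sum>i<n. w i * u' ^ i * v' ^ (n - i))) = 0"
    using g(2) by simp
  then have rel: "hp ^ M * u' ^ n + (\<Sum>i<n. w i * u' ^ i * v' ^ (n - i)) = 0"
    by (simp only: fract_poly_eq_0_iff)
  \<comment> \<open>Each term with \<open>i < n\<close> contains a factor \<open>v'\<close>, so
    \<open>v'\<close> divides \<open>hp ^ M * u' ^ n\<close>. As \<open>v'\<close> is prime to
    \<open>u'\<close>, it divides a power of h, and that power clears the denominator.\<close>
  have "v' dvd (\<Sum>i<n. w i * u' ^ i * v' ^ (n - i))"
    by (intro dvd_sum) (auto intro: dvd_mult dvd_power)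
  moreover have "hp ^ M * u' ^ n = - (\<Sum>i<n. w i * u' ^ i * v' ^ (n - i))"
    using rel by (rule eq_neg_iff_add_eq_0[THEN iffD2])
  ultimately have "v' dvd hp ^ M * u' ^ n"
    by (simp only: dvd_minus_iff)
  moreover have "coprime v' (u' ^ n)" using uv(3) by (simp add: coprime_commute)
  ultimately have "v' dvd hp ^ M" using coprime_dvd_mult_left_iff by blast
  then obtain k where k: "hp ^ M = v' * k" by (elim dvdE)
  have "HX ^ M * j f = j g * fract_poly (u' * k)"
  proof -
    have "HX ^ M * j f = fract_poly (v' * k) * j f"
      unfolding k[symmetric] fract_poly_power fract_poly_hp by simp
    also have "\<dots> = (j f * fract_poly v') * fract_poly k" by (simp add: mult_ac)
    finally show ?thesis unfolding fg by (simp add: mult_ac)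
  qed
  moreover obtain y where "y \<in> carrier B" "fract_poly (u' * k) = j y"
    using integral_in_Bim[of "u' * k"] by blast
  ultimately show ?thesis by (metis mult.commute)
qed

text \<open>After \<open>integrally_closed_aux\<close> the fraction is y / h^M. If M is positive,
  the integral equation shows that a power of y is divisible by h in B; by \<open>radical\<close> so
  is y, and one power of h cancels.\<close>

lemma integrally_closed:
  assumes f: "f \<in> carrier B" and g: "g \<in> carrier B" "j g \<noteq> 0"
    and c: "\<And>i. i < n \<Longrightarrow> c i \<in> carrier B"
    and eq: "j f ^ n + (\<Sum>i<n. j (c i) * j f ^ i * j g ^ (n - i)) = 0"
  shows "\<exists>y\<in>carrier B. j f = j y * j g"
proof -
  have "\<exists>y\<in>carrier B. j f = j y * j g" if "y \<in> carrier B" "HX ^ M * j f = j y * j g"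
    for M y
    using that
  proof (induction M arbitrary: y)
    case (Suc M)
    have n: "n > 0" using eq by (cases n) auto
    \<comment> \<open>The integral equation for y, which is h^(M+1) times f / g. Its i-th
      coefficient acquires h^((M+1)(n-i)); since \<open>i < n\<close>, one factor h can be taken out
      of the whole sum. The factor \<open>j g ^ n\<close> again avoids division.\<close>
    have *: "j g ^ n * (j y ^ n + HX * (\<Sum>i<n. j (c i) * HX ^ (n - i - 1) * (HX ^ M) ^ (n - i) * j y ^ i))
        = (HX ^ Suc M) ^ n * (j f ^ n + (\<Sum>i<n. j (c i) * j f ^ i * j g ^ (n - i)))"
    proof -
      have 1: "j g ^ i * j y ^ i = (HX ^ Suc M) ^ i * j f ^ i" for i
        using Suc.prems(2) by (metis mult.commute power_mult_distrib)
      have 2: "j g ^ n * (HX * (j (c i) * HX ^ (n - i - 1) * (HX ^ M) ^ (n - i) * j y ^ i))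
          = (HX ^ Suc M) ^ n * (j (c i) * j f ^ i * j g ^ (n - i))" if "i < n" for i
      proof -
        have "j g ^ n = j g ^ i * j g ^ (n - i)" "(HX ^ Suc M) ^ n = (HX ^ Suc M) ^ i * (HX ^ Suc M) ^ (n - i)"
          using that by (simp_all flip: power_add del: power_Suc)
        moreover have "(HX ^ Suc M) ^ (n - i) = HX ^ (n - i) * (HX ^ M) ^ (n - i)"
          by (simp add: power_mult_distrib)
        moreover have "HX ^ (n - i) = HX * HX ^ (n - i - 1)"
          using that by (metis Suc_diff_Suc diff_Suc_1 diff_diff_left plus_1_eq_Suc add.commute power_Suc)
        ultimately have "j g ^ n * (HX * (j (c i) * HX ^ (n - i - 1) * (HX ^ M) ^ (n - i) * j y ^ i))
          = (j g ^ i * j y ^ i) * (j g ^ (n - i) * j (c i) * (HX ^ Suc M) ^ (n - i))"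
          by (simp only: mult_ac)
        also have "\<dots> = (HX ^ Suc M) ^ n * (j (c i) * j f ^ i * j g ^ (n - i))"
          unfolding 1 \<open>(HX ^ Suc M) ^ n = _\<close> by (simp only: mult_ac)
        finally show ?thesis .
      qed
      show ?thesis
        unfolding distrib_left sum_distrib_left using 1[of n] 2
          by (intro arg_cong2[where f = "(+)"] sum.cong) auto
    qed
    define q where
      "q = - (\<Sum>i<n. j (c i) * HX ^ (n - i - 1) * (HX ^ M) ^ (n - i) * j y ^ i)"
    have "j y ^ n = HX * q"
      using * eq g(2) unfolding q_def by (simp add: add_eq_0_iff2)
    moreover have "q \<in> Bim"
      unfolding q_def using c Suc.prems(1)
      by (intro Bim_closed(3) Bim_sum Bim_closed(2) Bim_power HX_in_Bim) auto
    then obtain e where "e \<in> carrier B" "q = j e" by blast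
    ultimately have "e \<in> carrier B" "j y ^ n = HX * j e" by simp_all
    then obtain y' where y': "y' \<in> carrier B" "j y = HX * j y'"
      using radical[of y e n] Suc.prems(1) by blast
    then have "HX * (HX ^ M * j f) = HX * (j y' * j g)"
      using Suc.prems(2) by (simp only: power_Suc mult_ac)
    then have "HX ^ M * j f = j y' * j g" by (subst (asm) mult_cancel_left) simp
    then show ?case using Suc.IH y'(1) by blast
  qed auto
  then show ?thesis using integrally_closed_aux[OF assms] by blast
qed

lemma normal_B: "normal_domain B"
proof -
  interpret L: embedded_localization B "\<lambda>b. to_fract (j b)" "nonzero_elements B"
    by (rule F.embedded_localization_nonzero)
  let ?\<iota> = "\<lambda>a. fraction B (nonzero_elements B) a \<one>"
  have \<iota>: "?\<iota> a \<in> carrier (fraction_field B)" "L.frac_val (?\<iota> a) = to_fract (j a)"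
    if "a \<in> carrier B" for a
    using that L.fraction_in_carrier[OF that L.S_one] L.frac_val_fraction[OF that L.S_one]
    unfolding fraction_field_def by simp_all
  have "x \<in> ?\<iota> ` carrier B"
    if x: "x \<in> carrier (fraction_field B)"
      and int: "integral_over B ?\<iota> (fraction_field B) x" for x
  proof -
    obtain f g where f: "f \<in> carrier B" and g: "g \<in> nonzero_elements B"
      and xfg: "x = fraction B (nonzero_elements B) f g"
      using x unfolding fraction_field_def localization_def by auto
    have gB: "g \<in> carrier B" "j g \<noteq> 0"
      using g j_eq_iff[of g \<zero>] by (auto simp: nonzero_elements_def)
    have val: "L.frac_val x = to_fract (j f) / to_fract (j g)"
      unfolding xfg by (rule L.frac_val_fraction[OF f g])
    obtain n c where c: "\<And>i. i < n \<Longrightarrow> c i \<in> carrier B"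
      and eq: "x [^]\<^bsub>fraction_field B\<^esub> (n::nat) \<oplus>\<^bsub>fraction_field B\<^esub>
        (\<Oplus>\<^bsub>fraction_field B\<^esub>i\<in>{..<n}. ?\<iota> (c i) \<otimes>\<^bsub>fraction_field B\<^esub> x [^]\<^bsub>fraction_field B\<^esub> i)
        = \<zero>\<^bsub>fraction_field B\<^esub>"
      using int unfolding integral_over_def by blast
    note FF = fraction_field_def[symmetric]
    have "0 = L.frac_val (x [^]\<^bsub>fraction_field B\<^esub> n \<oplus>\<^bsub>fraction_field B\<^esub>
        (\<Oplus>\<^bsub>fraction_field B\<^esub>i\<in>{..<n}. ?\<iota> (c i) \<otimes>\<^bsub>fraction_field B\<^esub> x [^]\<^bsub>fraction_field B\<^esub> i))"
      unfolding eq using L.loc.j_simps(4) unfolding FF by simp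
    also have "\<dots> = (to_fract (j f) / to_fract (j g)) ^ n +
        (\<Sum>i<n. to_fract (j (c i)) * (to_fract (j f) / to_fract (j g)) ^ i)"
    proof -
      have xn: "x [^]\<^bsub>fraction_field B\<^esub> (i::nat) \<in> carrier (fraction_field B)"
        for i
        using x unfolding fraction_field_def by (rule L.loc.nat_pow_closed)
      have xv: "L.frac_val (x [^]\<^bsub>fraction_field B\<^esub> i) = (to_fract (j f) / to_fract (j g)) ^ i" for i :: nat
        using x unfolding fraction_field_def by (simp only: L.loc.j_pow val)
      have t: "?\<iota> (c i) \<otimes>\<^bsub>fraction_field B\<^esub> x [^]\<^bsub>fraction_field B\<^esub> i \<in> carrier (fraction_field B)"
        "L.frac_val (?\<iota> (c i) \<otimes>\<^bsub>fraction_field B\<^esub> x [^]\<^bsub>fraction_field B\<^esub> i)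
          = to_fract (j (c i)) * (to_fract (j f) / to_fract (j g)) ^ i" if "i < n" for i
        using L.loc.m_closed[unfolded FF, OF \<iota>(1)[OF c[OF that]] xn]
          L.loc.j_simps(1)[unfolded FF, OF \<iota>(1)[OF c[OF that]] xn] \<iota>(2)[OF c[OF that]] xv
        by simp_all
      let ?t = "\<lambda>i. ?\<iota> (c i) \<otimes>\<^bsub>fraction_field B\<^esub> x [^]\<^bsub>fraction_field B\<^esub> i"
      have mem: "finsum (fraction_field B) ?t {..<n} \<in> carrier (fraction_field B)"
        by (rule L.loc.finsum_closed[unfolded FF]) (use t(1) in auto)
      have "L.frac_val (finsum (fraction_field B) ?t {..<n}) = (\<Sum>i<n. L.frac_val (?t i))"
        by (rule L.loc.j_finsum[unfolded FF]) (use t(1) in auto)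
      also have "\<dots> = (\<Sum>i<n. to_fract (j (c i)) * (to_fract (j f) / to_fract (j g)) ^ i)"
        by (intro sum.cong) (use t(2) in auto)
      finally show ?thesis
        unfolding L.loc.j_simps(2)[unfolded FF, OF xn mem] xv by simp
    qed
    finally have 0: "(to_fract (j f) / to_fract (j g)) ^ n +
        (\<Sum>i<n. to_fract (j (c i)) * (to_fract (j f) / to_fract (j g)) ^ i) = 0" by simp
    have pow: "to_fract (p ^ k) = to_fract p ^ k" for p :: KX and k by (induction k) simp_all
    have "to_fract (j f ^ n + (\<Sum>i<n. j (c i) * j f ^ i * j g ^ (n - i)))
      = to_fract (j g) ^ n * ((to_fract (j f) / to_fract (j g)) ^ n +
        (\<Sum>i<n. to_fract (j (c i)) * (to_fract (j f) / to_fract (j g)) ^ i))"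
    proof -
      have "to_fract (j (c i) * j f ^ i * j g ^ (n - i))
        = to_fract (j g) ^ n * (to_fract (j (c i)) * (to_fract (j f) / to_fract (j g)) ^ i)" if "i < n" for i
      proof -
        have "to_fract (j g) ^ n = to_fract (j g) ^ i * to_fract (j g) ^ (n - i)"
          using that by (simp flip: power_add)
        then show ?thesis using gB(2) by (simp add: pow power_divide)
      qed
      then show ?thesis using gB(2) by (simp add: distrib_left sum_distrib_left pow power_divide)
    qed
    then have "j f ^ n + (\<Sum>i<n. j (c i) * j f ^ i * j g ^ (n - i)) = 0"
      unfolding 0 by (simp only: mult_zero_right to_fract_eq_0_iff)
    then obtain y where y: "y \<in> carrier B" "j f = j y * j g"
      using integrally_closed[OF f gB, of n c] c by blast
    then have "L.frac_val x = L.frac_val (?\<iota> y)" using gB(2) \<iota>(2) by (simp add: val)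
    then have "x = ?\<iota> y"
      using L.frac_val_inj x \<iota>(1)[OF y(1)] unfolding FF by (auto dest: inj_onD)
    then show ?thesis using y(1) by blast
  qed
  then show ?thesis unfolding normal_domain_def Let_def using domain_B by blast
qed

end

section \<open>Prime and maximal ideals of C[h]\<close>

lemma Ch_idealD:
  assumes "ideal p Ch"
  shows "0 \<in> p" "x \<in> p \<Longrightarrow> y \<in> p \<Longrightarrow> x + y \<in> p" "x \<in> p \<Longrightarrow> r * x \<in> p"
proof -
  interpret ideal p Ch by (rule assms)
  show "0 \<in> p" "x \<in> p \<Longrightarrow> y \<in> p \<Longrightarrow> x + y \<in> p" "x \<in> p \<Longrightarrow> r * x \<in> p"
    using additive_subgroup.zero_closed[OF is_additive_subgroup] additive_subgroup.a_closed[OF is_additive_subgroup, of x y] I_l_closed[of x r]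
    by simp_all
qed

lemma Ch_prime_eval: "primeideal {q. poly q a = 0} Ch"
proof -
  have "(\<lambda>q. poly q a) \<in> ring_hom Ch (ring_of_type_algebra :: complex ring)"
    by (rule ring_hom_memI) simp_all
  from ring_hom_kernel_prime[OF cring_from_type_algebra this] show ?thesis by simp
qed

text \<open>Modulo h - a a polynomial equals its value at a. A member of the ideal with nonzero
  value there would put a unit into the ideal.\<close>

lemma Ch_ideal_contains_linear:
  assumes p: "ideal p Ch" "p \<noteq> UNIV" and lin: "[:-a, 1:] \<in> p"
  shows "p = {q. poly q a = 0}"
proof
  show "{q. poly q a = 0} \<subseteq> p"
    using Ch_idealD(3)[OF p(1) lin] by (auto simp: poly_eq_0_iff_dvd dvd_def mult.commute)
  show "p \<subseteq> {q. poly q a = 0}"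
  proof (rule ccontr)
    assume "\<not> p \<subseteq> {q. poly q a = 0}"
    then obtain q where q: "q \<in> p" "poly q a \<noteq> 0" by blast
    have "[:-a, 1:] dvd [:poly q a:] - q" using poly_eq_0_iff_dvd[of "[:poly q a:] - q" a] by simp
    then obtain k where "[:poly q a:] - q = [:-a, 1:] * k" by (elim dvdE)
    then have "[:poly q a:] = q + k * [:-a, 1:]"
      by (simp add: algebra_simps del: mult_pCons_left mult_pCons_right)
    then have "[:poly q a:] \<in> p" using Ch_idealD(2)[OF p(1) q(1) Ch_idealD(3)[OF p(1) lin]]
      by metis
    then have "r \<in> p" for r
      using Ch_idealD(3)[OF p(1), of "[:poly q a:]" "smult (inverse (poly q a)) r"] q(2) by simp
    then show False using p(2) by blast
  qed
qed

text \<open>A nonzero member of least degree is nonconstant because the ideal is proper, so it has a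
  root a. The cofactor of h - a has smaller degree and lies outside the ideal, and primality puts h
  - a inside.\<close>

lemma Ch_primeideal_cases:
  assumes p: "primeideal p Ch"
  obtains "p = {0}" | a where "p = {q. poly q a = 0}"
proof (cases "p = {0}")
  case False
  interpret p: primeideal p Ch by (rule p)
  have nU: "p \<noteq> UNIV" using p.I_notcarr by simp
  define d where "d = (LEAST d. \<exists>q\<in>p. q \<noteq> 0 \<and> degree q = d)"
  have ex: "\<exists>d. \<exists>q\<in>p. q \<noteq> 0 \<and> degree q = d"
    using False Ch_idealD(1)[OF p.is_ideal] by blast
  then obtain q where q: "q \<in> p" "q \<noteq> 0" "degree q = d"
    using LeastI_ex[OF ex] unfolding d_def by blast
  have least: "d \<le> degree r" if "r \<in> p" "r \<noteq> 0" for r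
    unfolding d_def using that by (intro Least_le) blast
  have "\<not> constant (poly q)"
  proof
    assume "constant (poly q)"
    then obtain c where c: "q = [:c:]" using constant_degree degree_eq_zeroE by blast
    then have "r \<in> p" for r
      using Ch_idealD(3)[OF p.is_ideal q(1), of "smult (inverse c) r"] q(2) by simp
    then show False using nU by blast
  qed
  then obtain a where "poly q a = 0" using fundamental_theorem_of_algebra by blast
  then obtain r where r: "q = [:-a, 1:] * r" by (auto simp: poly_eq_0_iff_dvd elim: dvdE)
  have "r \<noteq> 0" using q(2) r by auto
  then have "degree q = Suc (degree r)" unfolding r by (subst degree_mult_eq) auto
  then have "r \<notin> p" using least[of r] \<open>r \<noteq> 0\<close> q(3) by auto
  then have "[:-a, 1:] \<in> p" using p.I_prime[of "[:-a, 1:]" r] q(1) r by auto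
  then show ?thesis using Ch_ideal_contains_linear[OF p.is_ideal nU] that by blast
qed (use that in blast)

lemma Ch_maximalideal_eval:
  assumes "maximalideal m Ch"
  obtains a where "m = {q. poly q a = 0}"
proof -
  interpret m: maximalideal m Ch by (rule assms)
  have "primeideal m Ch" by (rule cring.maximalideal_prime[OF cring_from_type_algebra assms])
  then show ?thesis
  proof (cases rule: Ch_primeideal_cases)
    case 1
    \<comment> \<open>The zero ideal is not maximal: the polynomials vanishing at 0 form an ideal
      strictly between it and the whole ring.\<close>
    have "primeideal {q :: complex poly. poly q 0 = 0} Ch" by (rule Ch_prime_eval)
    then have "ideal {q :: complex poly. poly q 0 = 0} Ch" by (rule primeideal.axioms(1))
    then have "{q :: complex poly. poly q 0 = 0} = m \<or> {q :: complex poly. poly q 0 = 0} = carrier Ch"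
      using m.I_maximal[of "{q :: complex poly. poly q 0 = 0}"] 1 by auto
    then have "{q :: complex poly. poly q 0 = 0} = {0} \<or> {q :: complex poly. poly q 0 = 0} = UNIV" using 1 by auto
    moreover have "[:0, 1:] \<in> {q :: complex poly. poly q 0 = 0}" "1 \<notin> {q :: complex poly. poly q 0 = 0}"
      by auto
    moreover have "[:0, 1:] \<noteq> (0 :: complex poly)" by simp
    ultimately show ?thesis by blast
  qed (use that in blast)
qed

section \<open>The primes h - a of C[h][x]\<close>

abbreviation lin_poly :: "complex \<Rightarrow> complex poly poly"
  where "lin_poly a \<equiv> [:[:-a, 1:]:]"

definition LX :: "complex \<Rightarrow> KX" where "LX a = [:to_fract [:-a, 1:]:]"

lemma fract_poly_lin: "fract_poly (lin_poly a) = LX a"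
  by (simp add: LX_def map_poly_pCons)

lemma prime_lin_poly: "prime_elem (lin_poly a)"
  by (intro lift_prime_elem_poly prime_elem_linear_field_poly) simp

lemma lin_poly_not_dvd_hp: "a \<noteq> 0 \<Longrightarrow> \<not> lin_poly a dvd hp ^ N"
proof
  assume a: "a \<noteq> 0" and "lin_poly a dvd hp ^ N"
  then have "lin_poly a dvd hp" using prime_lin_poly prime_elem_dvd_power by blast
  then have "[:-a, 1:] dvd [:0, 1 :: complex:]" by simp
  then show False using a poly_eq_0_iff_dvd[of "[:0, 1:]" a] by simp
qed

context danielewski_model
begin

lemma Bim_diff: "x \<in> Bim \<Longrightarrow> y \<in> Bim \<Longrightarrow> x - y \<in> Bim"
  using Bim_closed(1)[of x "- y"] Bim_closed(3)[of y] by simp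

subsection \<open>Closed fibers\<close>

lemma fiber_ideal: "ideal (Idl (\<phi> ` {q. poly q a = 0})) B"
  by (rule genideal_ideal) auto

text \<open>The maximal ideal of the point a is generated by h - a, so its extension to B is
  principal, and membership turns into a divisibility that can be tested in K[x] with quotient in
  the image of B.\<close>

lemma fiber_ideal_iff:
  "b \<in> Idl (\<phi> ` {q. poly q a = 0}) \<longleftrightarrow> b \<in> carrier B \<and> (\<exists>c\<in>carrier B. j b = LX a * j c)"
proof -
  have "Idl (\<phi> ` {q. poly q a = 0}) = PIdl (\<phi> [:-a, 1:])"
  proof
    show "Idl (\<phi> ` {q. poly q a = 0}) \<subseteq> PIdl (\<phi> [:-a, 1:])"
    proof (rule genideal_minimal[OF cgenideal_ideal[OF \<phi>_closed]], clarify)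
      fix q assume "poly q a = 0"
      then obtain r where "q = [:-a, 1:] * r" by (auto simp: poly_eq_0_iff_dvd elim: dvdE)
      then have "\<phi> q = \<phi> r \<otimes> \<phi> [:-a, 1:]"
        by (simp only: \<phi>_simps m_comm[OF \<phi>_closed \<phi>_closed])
      then show "\<phi> q \<in> PIdl (\<phi> [:-a, 1:])" unfolding cgenideal_def by auto
    qed
    have "\<phi> [:-a, 1:] \<in> Idl (\<phi> ` {q. poly q a = 0})"
      by (rule subsetD[OF genideal_self]) auto
    then show "PIdl (\<phi> [:-a, 1:]) \<subseteq> Idl (\<phi> ` {q. poly q a = 0})"
      by (rule cgenideal_minimal[OF fiber_ideal])
  qed
  moreover have "b = c \<otimes> \<phi> [:-a, 1:] \<longleftrightarrow> j b = LX a * j c"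
    if "b \<in> carrier B" "c \<in> carrier B" for b c
    using j_eq_iff[of b "c \<otimes> \<phi> [:-a, 1:]"] that unfolding LX_def
      by (simp add: mult.commute)
  then have "b \<in> PIdl (\<phi> [:-a, 1:]) \<longleftrightarrow> b \<in> carrier B \<and> (\<exists>c\<in>carrier B. j b = LX a * j c)"
    unfolding cgenideal_def using m_closed[OF _ \<phi>_closed] by blast
  ultimately show ?thesis by simp
qed

text \<open>Modulo \<open>h - a\<close> with \<open>a \<noteq> 0\<close>, the denominators \<open>h\<^sup>N\<close> are units.\<close>

lemma LX_dvd_of_integral:
  assumes a: "a \<noteq> 0" and b: "b \<in> carrier B"
    and eq: "HX ^ N * j b = fract_poly (lin_poly a * p)"
  shows "\<exists>c\<in>carrier B. j b = LX a * j c"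
proof -
  \<comment> \<open>Since h - a divides h^N - a^N, the power of h can be exchanged modulo h - a for
    the nonzero constant a^N, which is then inverted.\<close>
  have "[:-a, 1:] dvd [:0, 1:] ^ N - [:a ^ N:]"
    using poly_eq_0_iff_dvd[of "[:0, 1:] ^ N - [:a ^ N:]" a] by simp
  then obtain w where "[:0, 1:] ^ N - [:a ^ N:] = [:-a, 1:] * w" by (elim dvdE)
  then have "[:[:0, 1:] ^ N - [:a ^ N:]:] = lin_poly a * [:w:]" by simp
  moreover have "[:q ^ N:] = [:q :: complex poly:] ^ N" for q by (rule poly_const_pow[symmetric])
  ultimately have "hp ^ N = lin_poly a * [:w:] + [:[:a ^ N:]:]"
    by (metis diff_add_cancel diff_pCons diff_zero)
  then have "fract_poly (hp ^ N) = fract_poly (lin_poly a * [:w:] + [:[:a ^ N:]:])"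
    by (rule arg_cong)
  then have H: "HX ^ N = LX a * [:to_fract w:] + cc (a ^ N)"
    unfolding fract_poly_add fract_poly_mult fract_poly_power fract_poly_hp fract_poly_lin
    by (simp add: map_poly_pCons)
  have "cc (a ^ N) * j b = HX ^ N * j b - LX a * [:to_fract w:] * j b"
    unfolding H by (simp only: distrib_right add_diff_cancel_left')
  also have "\<dots> = LX a * (fract_poly p - [:to_fract w:] * j b)"
    unfolding eq fract_poly_mult fract_poly_lin by (simp only: right_diff_distrib mult.assoc)
  finally have "cc (inverse (a ^ N)) * (cc (a ^ N) * j b)
    = LX a * (cc (inverse (a ^ N)) * (fract_poly p - [:to_fract w:] * j b))" by (simp only: mult_ac)
  moreover have "cc (inverse (a ^ N)) * cc (a ^ N) = 1"
    using a by (simp flip: to_fract_mult add: one_pCons[symmetric])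
  ultimately have "j b = LX a * (cc (inverse (a ^ N)) * (fract_poly p - [:to_fract w:] * j b))"
    by (simp only: mult.assoc[symmetric] mult_1_left)
  moreover have "cc (inverse (a ^ N)) * (fract_poly p - [:to_fract w:] * j b) \<in> Bim"
    using b by (intro Bim_closed(2) Bim_diff const_in_Bim integral_in_Bim imageI)
  ultimately show ?thesis by (metis imageE)
qed

text \<open>Clearing powers of h moves a product into C[h][x], where h - a is prime;
  \<open>LX_dvd_of_integral\<close> brings the divisibility of a factor back to B. The ideal is
  proper because h - a divides no power of h when a is nonzero.\<close>

lemma fiber_prime:
  assumes a: "a \<noteq> 0"
  shows "primeideal (Idl (\<phi> ` {q. poly q a = 0})) B"
proof (rule primeidealI[OF fiber_ideal cring_axioms])
  show "carrier B \<noteq> Idl (\<phi> ` {q. poly q a = 0})"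
  proof
    assume "carrier B = Idl (\<phi> ` {q. poly q a = 0})"
    then have "\<one> \<in> Idl (\<phi> ` {q. poly q a = 0})" using one_closed by blast
    then obtain c where c: "c \<in> carrier B" "1 = LX a * j c"
      unfolding fiber_ideal_iff j_simps by blast
    obtain N u where "HX ^ N * j c = fract_poly u" using denominators c(1) by blast
    then have "fract_poly (lin_poly a * u) = HX ^ N * (LX a * j c)"
      unfolding fract_poly_mult fract_poly_lin by (metis mult.left_commute)
    then have "fract_poly (hp ^ N) = fract_poly (lin_poly a * u)"
      unfolding c(2)[symmetric] fract_poly_power fract_poly_hp by simp
    then have "hp ^ N = lin_poly a * u" by (simp only: fract_poly_eq_iff)
    then show False using lin_poly_not_dvd_hp[OF a, of N] dvdI by blast
  qed
next
  fix b c assume b: "b \<in> carrier B" and c: "c \<in> carrier B"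
    and "b \<otimes> c \<in> Idl (\<phi> ` {q. poly q a = 0})"
  then obtain d where d: "d \<in> carrier B" "j b * j c = LX a * j d"
    unfolding fiber_ideal_iff j_simps(1)[OF b c] by blast
  obtain N where N: "\<forall>z\<in>{b, c, d}. \<exists>u. HX ^ N * j z = fract_poly u"
    using common_denominator[of "{b, c, d}" "\<lambda>z. z"] b c d(1) by blast
  then obtain u v w where u: "HX ^ N * j b = fract_poly u" and v: "HX ^ N * j c = fract_poly v"
    and w: "HX ^ N * j d = fract_poly w" by blast
  have "fract_poly (hp ^ N * (lin_poly a * w)) = HX ^ N * (LX a * (HX ^ N * j d))"
    unfolding w fract_poly_mult fract_poly_power fract_poly_hp fract_poly_lin ..
  also have "\<dots> = HX ^ N * HX ^ N * (j b * j c)" unfolding d(2) by (simp only: mult_ac)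
  also have "\<dots> = fract_poly (u * v)"
    unfolding fract_poly_mult u[symmetric] v[symmetric] by (simp only: mult_ac)
  finally have "u * v = lin_poly a * (hp ^ N * w)"
    by (simp only: fract_poly_eq_iff mult_ac)
  then have "lin_poly a dvd u * v" by (rule dvdI)
  then have "lin_poly a dvd u \<or> lin_poly a dvd v"
    using prime_lin_poly prime_elem_dvd_mult_iff by blast
  then have "(\<exists>e\<in>carrier B. j b = LX a * j e) \<or> (\<exists>e\<in>carrier B. j c = LX a * j e)"
    using LX_dvd_of_integral[OF a b, of N] LX_dvd_of_integral[OF a c, of N] u v
    by (elim disjE dvdE) metis+
  then show "b \<in> Idl (\<phi> ` {q. poly q a = 0}) \<or> c \<in> Idl (\<phi> ` {q. poly q a = 0})"
    unfolding fiber_ideal_iff using b c by blast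
qed

lemma closed_fiber_domain:
  assumes "a \<noteq> 0" shows "domain (closed_fiber B \<phi> {q. poly q a = 0})"
  unfolding closed_fiber_def by (rule primeideal.quotient_is_domain[OF fiber_prime[OF assms]])

lemma closed_fiber_reduced: "reduced_ring (closed_fiber B \<phi> {q. poly q a = 0})"
  unfolding closed_fiber_def
proof (rule reduced_quotientI[OF cring_axioms fiber_ideal])
  fix x n assume x: "x \<in> carrier B" "x [^] (n::nat) \<in> Idl (\<phi> ` {q. poly q a = 0})"
  show "x \<in> Idl (\<phi> ` {q. poly q a = 0})"
  proof (cases "a = 0")
    case True
    have L0: "LX 0 = HX" by (simp add: LX_def HX_def)
    show ?thesis
      using x radical[of x _ n] unfolding True fiber_ideal_iff L0 j_simps(6)[OF x(1)] by blast
  next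
    case False
    interpret P: primeideal "Idl (\<phi> ` {q. poly q a = 0})" B by (rule fiber_prime[OF False])
    from x(2) show ?thesis
    proof (induction n)
      case 0
      then show ?case using P.one_imp_carrier x(1) by simp
    next
      case (Suc n)
      then show ?case using P.I_prime[of "x [^] n" x] x(1) by auto
    qed
  qed
qed

subsection \<open>Surjectivity on spectra\<close>

lemma contraction_eq:
  assumes P: "primeideal P B" and a: "\<phi> [:-a, 1:] \<in> P"
  shows "{q \<in> carrier Ch. \<phi> q \<in> P} = {q. poly q a = 0}"
proof -
  interpret P: primeideal P B by (rule P)
  interpret h: ring_hom_ring Ch B \<phi>
    using \<phi>_hom ring_from_type_algebra ring_axioms by (auto intro!: ring_hom_ringI2)
  have "ideal {q \<in> carrier Ch. \<phi> q \<in> P} Ch" by (rule h.ideal_vimage[OF P.is_ideal])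
  moreover have "1 \<notin> {q \<in> carrier Ch. \<phi> q \<in> P}"
    using P.I_notcarr P.one_imp_carrier by (auto simp: \<phi>_simps)
  ultimately show ?thesis using a by (intro Ch_ideal_contains_linear) auto
qed

text \<open>Over the generic point lies the zero ideal, over h = 0 the kernel of the residue map of
  the chart, and over any other closed point the ideal of the fiber itself, which is prime. In the
  closed cases the contraction is identified from h - a alone.\<close>

lemma spec_surjective_B: "spec_surjective Ch B \<phi>"
  unfolding spec_surjective_def
proof (intro allI impI)
  fix p assume "primeideal p Ch"
  then show "\<exists>P. primeideal P B \<and> {a \<in> carrier Ch. \<phi> a \<in> P} = p"
  proof (cases rule: Ch_primeideal_cases)
    case 1
    have "\<phi> a = \<zero> \<longleftrightarrow> a = 0" for a
      using j_eq_iff[of "\<phi> a" \<zero>] by simp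
    then have "{a \<in> carrier Ch. \<phi> a \<in> {\<zero>}} = p" using 1 by auto
    then show ?thesis using domain.zeroprimeideal[OF domain_B] by blast
  next
    case (2 a)
    have "\<exists>P. primeideal P B \<and> \<phi> [:-a, 1:] \<in> P"
    proof (cases "a = 0")
      case True
      obtain P1 P2 where "primeideal P1 B" "\<phi> [:0, 1:] \<in> P1" using exists_prime_chain
        by blast
      then show ?thesis using True by auto
    next
      case False
      have "\<phi> [:-a, 1:] \<in> Idl (\<phi> ` {q. poly q a = 0})"
        by (rule subsetD[OF genideal_self]) auto
      then show ?thesis using fiber_prime[OF False] by blast
    qed
    then show ?thesis using contraction_eq 2 by blast
  qed
qed

end

section \<open>The field K and the ring K[x] in terms of classes of fractions\<close>

lemma common_denominator_KX:
  fixes p :: KX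
  shows "\<exists>a u. a \<noteq> 0 \<and> [:to_fract a:] * p = fract_poly u"
proof (induction p)
  case 0
  then show ?case by (intro exI[of _ 1] exI[of _ 0]) simp
next
  case (pCons c p)
  then obtain a u where a: "a \<noteq> 0" "[:to_fract a:] * p = fract_poly u" by blast
  obtain x y where c: "c = to_fract x / to_fract y" "y \<noteq> 0"
    by (metis Fract_conv_to_fract Fract_quot_of_fract snd_quot_of_fract_nonzero)
  have "[:to_fract (y * a):] * pCons c p = pCons (to_fract (x * a)) ([:to_fract y:] * ([:to_fract a:] * p))"
    using c by (simp add: mult.commute)
  also have "\<dots> = fract_poly (pCons (x * a) ([:y:] * u))"
    unfolding a(2) by (simp add: map_poly_pCons)
  finally show ?case using a(1) c(2) by (intro exI[of _ "y * a"]) auto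
qed

lemma Ch_embedded: "embedded_ring Ch (to_fract :: complex poly \<Rightarrow> _)"
proof -
  interpret cring Ch by (rule cring_from_type_algebra)
  show ?thesis
    by unfold_locales (auto simp: inj_on_def intro!: ring_hom_memI)
qed

interpretation K: embedded_localization Ch "to_fract :: complex poly \<Rightarrow> _" "nonzero_elements Ch"
  by (rule embedded_ring.embedded_localization_nonzero[OF Ch_embedded])

lemma K_fracs: "K.fracs = UNIV"
proof -
  have "v \<in> K.fracs" for v
    using K.fracsI[of "fst (quot_of_fract v)" "snd (quot_of_fract v)" v]
    by (simp add: nonzero_elements_def flip: Fract_conv_to_fract)
  then show ?thesis by blast
qed

abbreviation KK where "KK \<equiv> fraction_field Ch"

lemma carrier_KK: "carrier KK = range K.fractions_of"
  unfolding fraction_field_def K.carrier_localization K_fracs ..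

lemma fractions_of_inject: "K.fractions_of v = K.fractions_of w \<longleftrightarrow> v = w"
  using K.frac_val_fractions_of K_fracs by (metis UNIV_I)

lemma KK_simps:
  "K.fractions_of v \<otimes>\<^bsub>KK\<^esub> K.fractions_of w = K.fractions_of (v * w)"
  "K.fractions_of v \<oplus>\<^bsub>KK\<^esub> K.fractions_of w = K.fractions_of (v + w)"
  "\<one>\<^bsub>KK\<^esub> = K.fractions_of 1" "\<zero>\<^bsub>KK\<^esub> = K.fractions_of 0"
  unfolding fraction_field_def
  by (simp_all add: K.localization_mult K.localization_add K.one_localization K.zero_localization K_fracs)

lemma KK_finsum:
  assumes "finite I"
  shows "finsum KK (\<lambda>i. K.fractions_of (f i)) I = K.fractions_of (sum f I)"
proof -
  interpret KK: cring KK unfolding fraction_field_def by (rule K.localization_cring)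
  have c: "K.fractions_of v \<in> carrier KK" for v by (simp add: carrier_KK)
  show ?thesis
    using assms by (induction I rule: finite_induct) (simp_all add: c KK_simps)
qed

text \<open>Elements of \<open>UP\<close> are coefficient functions of bounded support, and the
  scalars of \<open>KK\<close> are classes indexed by K through \<open>K.fractions_of\<close>; so
  the identification is made coefficient by coefficient.\<close>

lemma UP_KK_iso: "(\<lambda>p n. K.fractions_of (coeff p n)) \<in> ring_iso (ring_of_type_algebra :: KX ring) (UP KK)"
  (is "?\<Psi> \<in> _")
proof -
  have carr: "carrier (UP KK) = range ?\<Psi>"
  proof
    show "range ?\<Psi> \<subseteq> carrier (UP KK)"
    proof clarify
      fix p :: KX
      have "bound \<zero>\<^bsub>KK\<^esub> (degree p) (\<lambda>n. K.fractions_of (coeff p n))"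
        by (rule bound.intro) (simp add: coeff_eq_0 KK_simps)
      then show "(\<lambda>n. K.fractions_of (coeff p n)) \<in> carrier (UP KK)"
        unfolding UP_def up_def by (auto simp: carrier_KK)
    qed
    show "carrier (UP KK) \<subseteq> range ?\<Psi>"
    proof
      fix f assume "f \<in> carrier (UP KK)"
      then have f: "\<And>n. f n \<in> range K.fractions_of"
        and "\<exists>n. bound \<zero>\<^bsub>KK\<^esub> n f"
        unfolding UP_def up_def carrier_KK by auto
      then obtain N where N: "\<And>n. N < n \<Longrightarrow> f n = K.fractions_of 0"
        unfolding bound_def KK_simps by blast
      have "\<forall>n. \<exists>v. f n = K.fractions_of v" using f by blast
      then obtain v where v: "\<And>n. f n = K.fractions_of (v n)" by metis
      have "\<forall>\<^sub>\<infinity>n. v n = 0"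
        unfolding MOST_nat using N v fractions_of_inject by auto
      then have "coeff (Abs_poly v) = v" by (rule Abs_poly_inverse[OF CollectI])
      then have "f = ?\<Psi> (Abs_poly v)" using v by auto
      then show "f \<in> range ?\<Psi>" by blast
    qed
  qed
  have up: "?\<Psi> p \<in> up KK" for p using carr unfolding UP_def by auto
  have "?\<Psi> \<in> ring_hom (ring_of_type_algebra :: KX ring) (UP KK)"
  proof (rule ring_hom_memI)
    fix p q :: KX
    show "?\<Psi> p \<in> carrier (UP KK)" using carr by blast
    show "?\<Psi> (p \<otimes>\<^bsub>ring_of_type_algebra\<^esub> q) = ?\<Psi> p \<otimes>\<^bsub>UP KK\<^esub> ?\<Psi> q"
      using up[of p] up[of q]
      by (simp add: UP_def KK_simps KK_finsum coeff_mult)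
    show "?\<Psi> (p \<oplus>\<^bsub>ring_of_type_algebra\<^esub> q) = ?\<Psi> p \<oplus>\<^bsub>UP KK\<^esub> ?\<Psi> q"
      using up[of p] up[of q] by (simp add: UP_def KK_simps)
  next
    show "?\<Psi> \<one>\<^bsub>ring_of_type_algebra\<^esub> = \<one>\<^bsub>UP KK\<^esub>"
      by (auto simp: UP_def KK_simps coeff_1 fun_eq_iff)
  qed
  moreover have "inj ?\<Psi>"
  proof (rule injI, rule poly_eqI)
    fix p q :: KX and n assume "?\<Psi> p = ?\<Psi> q"
    from fun_cong[OF this, of n] show "coeff p n = coeff q n" by (simp only: fractions_of_inject)
  qed
  ultimately show ?thesis
    unfolding ring_iso_def bij_betw_def carr by simp
qed

context danielewski_model
begin

subsection \<open>Generic fiber\<close>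

lemma generic_localization:
  "embedded_localization B (\<lambda>b. to_fract (j b)) (\<phi> ` nonzero_elements Ch)"
proof
  show "\<phi> ` nonzero_elements Ch \<subseteq> carrier B - {\<zero>}"
  proof clarify
    fix a assume a: "a \<in> nonzero_elements Ch"
    have "\<phi> a \<noteq> \<zero>"
    proof
      assume "\<phi> a = \<zero>"
      then have "j (\<phi> a) = 0" by simp
      then show False using a by (simp add: nonzero_elements_def)
    qed
    then show "\<phi> a \<in> carrier B - {\<zero>}" by simp
  qed
  show "\<one> \<in> \<phi> ` nonzero_elements Ch"
    by (intro image_eqI[of _ _ 1]) (simp_all add: \<phi>_simps nonzero_elements_def)
  fix s t assume "s \<in> \<phi> ` nonzero_elements Ch" "t \<in> \<phi> ` nonzero_elements Ch"
  then obtain a b where "s = \<phi> a" "t = \<phi> b" "a \<noteq> 0" "b \<noteq> 0"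
    by (auto simp: nonzero_elements_def)
  then show "s \<otimes> t \<in> \<phi> ` nonzero_elements Ch"
    by (intro image_eqI[of _ _ "a * b"]) (simp_all add: \<phi>_simps nonzero_elements_def)
qed

sublocale G: embedded_localization B "\<lambda>b. to_fract (j b)" "\<phi> ` nonzero_elements Ch"
  by (rule generic_localization)

text \<open>A denominator from C[h] is a unit of K[x], which gives one inclusion. Conversely a
  polynomial over K has a common denominator in C[h], and C[h][x] lies in the image of B.\<close>

lemma generic_fracs: "G.fracs = range (to_fract :: KX \<Rightarrow> _)"
proof
  show "G.fracs \<subseteq> range to_fract"
  proof
    fix v assume "v \<in> G.fracs"
    then obtain b s where b: "b \<in> carrier B" "s \<in> \<phi> ` nonzero_elements Ch" "v = to_fract (j b) / to_fract (j s)"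
      unfolding G.fracs_def by blast
    then obtain a where "s = \<phi> a" "a \<in> nonzero_elements Ch" by blast
    then have ba: "b \<in> carrier B" "a \<noteq> 0" "v = to_fract (j b) / to_fract [:to_fract a:]"
      using b by (simp_all add: nonzero_elements_def)
    have "[:to_fract a:] * [:inverse (to_fract a):] = (1 :: KX)"
      using ba(2) by (simp add: one_pCons)
    then have "to_fract [:to_fract a:] * to_fract [:inverse (to_fract a):] = (1 :: KX fract)"
      by (metis to_fract_1 to_fract_mult)
    then have "v = to_fract (j b * [:inverse (to_fract a):])"
      unfolding ba(3) to_fract_mult using ba(2)
      by (subst divide_eq_eq) (simp only: mult.assoc mult.commute[of "to_fract [:inverse (to_fract a):]"], simp)
    then show "v \<in> range to_fract" by blast
  qed
  show "range to_fract \<subseteq> G.fracs"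
  proof clarify
    fix p :: KX
    obtain a u where a: "a \<noteq> 0" "[:to_fract a:] * p = fract_poly u"
      using common_denominator_KX by blast
    obtain b where b: "b \<in> carrier B" "fract_poly u = j b" using integral_in_Bim by blast
    have "to_fract [:to_fract a:] * to_fract p = to_fract (j b)"
      using a(2) b(2) by (metis to_fract_mult)
    moreover have "to_fract [:to_fract a:] \<noteq> (0 :: KX fract)" using a(1) by simp
    ultimately have "to_fract p = to_fract (j b) / to_fract (j (\<phi> a))"
      by (simp add: field_simps)
    then show "to_fract p \<in> G.fracs"
      using b(1) a(1) by (intro G.fracsI[of b "\<phi> a"]) (auto simp: nonzero_elements_def)
  qed
qed

lemma generic_fiber_reduced: "reduced_ring (generic_fiber Ch B \<phi>)"
  unfolding reduced_ring_def generic_fiber_def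
proof (intro ballI allI impI)
  fix x and n :: nat
  assume x: "x \<in> carrier (localization B (\<phi> ` nonzero_elements Ch))"
    and 0: "x [^]\<^bsub>localization B (\<phi> ` nonzero_elements Ch)\<^esub> n = \<zero>\<^bsub>localization B (\<phi> ` nonzero_elements Ch)\<^esub>"
  have "G.frac_val x ^ n = 0"
    using G.loc.j_pow[OF x, of n] unfolding 0 G.loc.j_simps(4) by simp
  then have "G.frac_val x = 0" by (cases "n = 0") simp_all
  then show "x = \<zero>\<^bsub>localization B (\<phi> ` nonzero_elements Ch)\<^esub>"
    using G.loc.j_eq_0_iff[OF x] by blast
qed

lemma generic_fiber_affine_line: "generic_fiber_is_affine_line Ch B \<phi>"
proof -
  let ?GF = "localization B (\<phi> ` nonzero_elements Ch)"
  \<comment> \<open>\<open>G.frac_val\<close> takes values in the field of fractions of K[x]; by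
    \<open>generic_fracs\<close> they are polynomials, and \<open>\<gamma>\<close> reads them as
    such.\<close>
  define \<gamma> where "\<gamma> U = inv_into UNIV to_fract (G.frac_val U)" for U
  have inj: "inj (to_fract :: KX \<Rightarrow> _)" by (rule injI) simp
  have \<gamma>: "to_fract (\<gamma> U) = G.frac_val U" if "U \<in> carrier ?GF" for U
  proof -
    have "G.frac_val U \<in> range to_fract"
      using that G.frac_val_image generic_fracs by blast
    then show ?thesis unfolding \<gamma>_def by (rule f_inv_into_f)
  qed
  have "\<gamma> \<in> ring_hom ?GF (ring_of_type_algebra :: KX ring)"
  proof (rule ring_hom_memI)
    fix U V assume UV: "U \<in> carrier ?GF" "V \<in> carrier ?GF"
    have "to_fract (\<gamma> (U \<otimes>\<^bsub>?GF\<^esub> V)) = to_fract (\<gamma> U * \<gamma> V)"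
      unfolding \<gamma>[OF G.loc.m_closed[OF UV]] to_fract_mult \<gamma>[OF UV(1)] \<gamma>[OF UV(2)]
      by (rule G.loc.j_simps(1)[OF UV])
    then show "\<gamma> (U \<otimes>\<^bsub>?GF\<^esub> V) = \<gamma> U \<otimes>\<^bsub>ring_of_type_algebra\<^esub> \<gamma> V"
      unfolding ring_of_type_algebra_simps by (simp only: to_fract_eq_iff)
    have "to_fract (\<gamma> (U \<oplus>\<^bsub>?GF\<^esub> V)) = to_fract (\<gamma> U + \<gamma> V)"
      unfolding \<gamma>[OF G.loc.a_closed[OF UV]] to_fract_add \<gamma>[OF UV(1)] \<gamma>[OF UV(2)]
      by (rule G.loc.j_simps(2)[OF UV])
    then show "\<gamma> (U \<oplus>\<^bsub>?GF\<^esub> V) = \<gamma> U \<oplus>\<^bsub>ring_of_type_algebra\<^esub> \<gamma> V"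
      unfolding ring_of_type_algebra_simps by (simp only: to_fract_eq_iff)
  next
    have "to_fract (\<gamma> \<one>\<^bsub>?GF\<^esub>) = to_fract 1"
      unfolding \<gamma>[OF G.loc.one_closed] G.loc.j_simps(3) by simp
    then show "\<gamma> \<one>\<^bsub>?GF\<^esub> = \<one>\<^bsub>ring_of_type_algebra\<^esub>"
      unfolding ring_of_type_algebra_simps by (simp only: to_fract_eq_iff)
  qed simp
  moreover have "bij_betw \<gamma> (carrier ?GF) UNIV"
    unfolding bij_betw_def
  proof
    show "inj_on \<gamma> (carrier ?GF)"
      using G.frac_val_inj \<gamma> by (metis (no_types, lifting) inj_on_def)
    show "\<gamma> ` carrier ?GF = UNIV"
    proof -
      have "p \<in> \<gamma> ` carrier ?GF" for p
      proof -
        have "to_fract p \<in> G.frac_val ` carrier ?GF"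
          unfolding G.frac_val_image generic_fracs by blast
        then obtain U where "U \<in> carrier ?GF" "to_fract p = G.frac_val U" by blast
        then have "U \<in> carrier ?GF" "to_fract (\<gamma> U) = to_fract p" using \<gamma>[of U]
          by simp_all
        then have "U \<in> carrier ?GF" "\<gamma> U = p" by (simp_all only: to_fract_eq_iff)
        then show ?thesis by blast
      qed
      then show ?thesis by blast
    qed
  qed
  ultimately have "\<gamma> \<in> ring_iso ?GF (ring_of_type_algebra :: KX ring)"
    unfolding ring_iso_def by simp
  from ring_iso_set_trans[OF this UP_KK_iso]
  have iso: "(\<lambda>p n. K.fractions_of (poly.coeff p n)) \<circ> \<gamma> \<in> ring_iso (generic_fiber Ch B \<phi>) (UP KK)"
    unfolding generic_fiber_def .
  have "((\<lambda>p n. K.fractions_of (poly.coeff p n)) \<circ> \<gamma>) (fraction B (\<phi> ` nonzero_elements Ch) (\<phi> a) (\<phi> s))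
      = up_ring.monom (UP KK) (fraction Ch (nonzero_elements Ch) a s) 0"
    if s: "s \<in> nonzero_elements Ch" for a s
  proof -
    have s0: "s \<noteq> 0" using s by (simp add: nonzero_elements_def)
    have S: "\<phi> s \<in> \<phi> ` nonzero_elements Ch" using s by blast
    let ?U = "fraction B (\<phi> ` nonzero_elements Ch) (\<phi> a) (\<phi> s)"
    have "to_fract (\<gamma> ?U) = to_fract (j (\<phi> a)) / to_fract (j (\<phi> s))"
      unfolding \<gamma>[OF G.fraction_in_carrier[OF \<phi>_closed S]]
        by (rule G.frac_val_fraction[OF \<phi>_closed S])
    moreover have "to_fract [:to_fract a / to_fract s:] * to_fract (j (\<phi> s)) = to_fract (j (\<phi> a))"
      unfolding to_fract_mult[symmetric] j_\<phi> using s0 by simp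
    moreover have "to_fract (j (\<phi> s)) \<noteq> (0 :: KX fract)" using s0 by simp
    ultimately have "to_fract (\<gamma> ?U) = to_fract [:to_fract a / to_fract s:]"
      by (metis nonzero_mult_div_cancel_right)
    then have \<gamma>U: "\<gamma> ?U = [:to_fract a / to_fract s:]" by simp
    have fr: "fraction Ch (nonzero_elements Ch) a s = K.fractions_of (to_fract a / to_fract s)"
      using K.fraction_eq[of a s] s by simp
    have "fraction Ch (nonzero_elements Ch) a s \<in> carrier KK" unfolding fr carrier_KK by blast
    then show ?thesis
      unfolding o_def \<gamma>U
      by (auto simp: UP_def fr KK_simps coeff_pCons fun_eq_iff split: nat.splits)
  qed
  then show ?thesis
    unfolding generic_fiber_is_affine_line_def using iso by blast
qed

end

section \<open>Leading coefficients and ideals of C[h]\<close>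

lemma coeff_pcompose_affine:
  fixes c :: "'a::field"
  assumes "degree p \<le> n" "c \<noteq> 0"
  shows "coeff (pcompose p [:a, c:]) n = coeff p n * c ^ n"
proof (cases "degree p = n")
  case True
  have "lead_coeff (pcompose p [:a, c:]) = lead_coeff p * lead_coeff [:a, c:] ^ degree p"
    using assms(2) by (intro lead_coeff_comp) simp
  then show ?thesis using True assms(2) by (simp add: degree_pcompose)
next
  case False
  then show ?thesis using assms by (simp add: coeff_eq_0 degree_pcompose)
qed

lemma poly_ideal_principal:
  fixes D :: "complex poly set"
  assumes add: "\<And>x y. x \<in> D \<Longrightarrow> y \<in> D \<Longrightarrow> x + y \<in> D"
    and mult: "\<And>x r. x \<in> D \<Longrightarrow> r * x \<in> D"
    and nz: "x \<in> D" "x \<noteq> 0"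
  shows "\<exists>g\<in>D. g \<noteq> 0 \<and> (\<forall>q\<in>D. g dvd q)"
proof -
  define d where "d = (LEAST d. \<exists>q\<in>D. q \<noteq> 0 \<and> degree q = d)"
  have ex: "\<exists>d. \<exists>q\<in>D. q \<noteq> 0 \<and> degree q = d" using nz by blast
  obtain g where g: "g \<in> D" "g \<noteq> 0" "degree g = d"
    using LeastI_ex[OF ex] unfolding d_def by blast
  have least: "d \<le> degree r" if "r \<in> D" "r \<noteq> 0" for r
    unfolding d_def using that by (intro Least_le) blast
  have "g dvd q" if q: "q \<in> D" for q
  proof (rule ccontr)
    assume "\<not> g dvd q"
    then have "q mod g \<noteq> 0" by (simp add: dvd_eq_mod_eq_0)
    then have "degree (q mod g) < degree g" using degree_mod_less[OF g(2), of q] by blast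
    moreover have "q mod g = q + - (q div g) * g"
      by (simp add: minus_div_mult_eq_mod[symmetric])
    then have "q mod g \<in> D" using add[OF q mult[OF g(1)]] by metis
    ultimately show False using least[of "q mod g"] \<open>q mod g \<noteq> 0\<close> g(3) by simp
  qed
  then show ?thesis using g by blast
qed

context danielewski_model
begin

subsection \<open>A basis over the polynomial ring, and flatness\<close>

text \<open>The chart substitution multiplies the coefficient in degree \<open>n\<close> by
  \<open>\<tau> ^ n\<close> and its result has coefficients in C[h]. So \<open>\<tau> ^ n\<close> is
  a denominator common to all these coefficients.\<close>

lemma leading_coeff_bound:
  assumes "b \<in> carrier B" "Polynomial.degree (j b) \<le> n"
  shows "\<exists>q. to_fract (\<tau> ^ n) * poly.coeff (j b) n = to_fract q"
proof -
  obtain u where u: "pcompose (j b) (fract_poly [:\<sigma>, \<tau>:]) = fract_poly u"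
    using chart[OF assms(1)] by blast
  have pow: "to_fract (\<tau> ^ n) = to_fract \<tau> ^ n" by (induction n) simp_all
  have "fract_poly [:\<sigma>, \<tau>:] = [:to_fract \<sigma>, to_fract \<tau>:]"
    using \<tau>_nonzero by (simp add: map_poly_pCons)
  then have "poly.coeff (pcompose (j b) (fract_poly [:\<sigma>, \<tau>:])) n = poly.coeff (j b) n * to_fract \<tau> ^ n"
    using coeff_pcompose_affine[OF assms(2)] \<tau>_nonzero by simp
  then have "to_fract (\<tau> ^ n) * poly.coeff (j b) n = to_fract (poly.coeff u n)"
    unfolding u pow by (simp add: coeff_map_poly mult.commute)
  then show ?thesis by blast
qed

text \<open>After multiplication by \<open>\<tau> ^ n\<close> the possible coefficients in degree
  \<open>n\<close> form an ideal of C[h], nonzero because x^n contributes \<open>\<tau> ^ n\<close>.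
  An element of B that realizes a generator is taken for \<open>\<beta>\<close>.\<close>

lemma exists_basis_element:
  "\<exists>\<beta>\<in>carrier B. Polynomial.degree (j \<beta>) = n \<and>
    (\<forall>b\<in>carrier B. Polynomial.degree (j b) \<le> n \<longrightarrow> (\<exists>a. poly.coeff (j b) n = to_fract a * poly.coeff (j \<beta>) n))"
proof -
  define D where "D = {q. \<exists>b\<in>carrier B. Polynomial.degree (j b) \<le> n \<and> to_fract (\<tau> ^ n) * poly.coeff (j b) n = to_fract q}"
  have "\<exists>g\<in>D. g \<noteq> 0 \<and> (\<forall>q\<in>D. g dvd q)"
  proof (rule poly_ideal_principal)
    fix x y assume "x \<in> D" "y \<in> D"
    then obtain b c where b: "b \<in> carrier B" "Polynomial.degree (j b) \<le> n" "to_fract (\<tau> ^ n) * poly.coeff (j b) n = to_fract x"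
      and c: "c \<in> carrier B" "Polynomial.degree (j c) \<le> n" "to_fract (\<tau> ^ n) * poly.coeff (j c) n = to_fract y"
      unfolding D_def by blast
    have "to_fract (\<tau> ^ n) * poly.coeff (j (b \<oplus> c)) n = to_fract (x + y)"
      unfolding j_simps(2)[OF b(1) c(1)] coeff_add distrib_left b(3) c(3)
        by (rule to_fract_add[symmetric])
    moreover have "Polynomial.degree (j (b \<oplus> c)) \<le> n"
      unfolding j_simps(2)[OF b(1) c(1)] by (rule degree_add_le[OF b(2) c(2)])
    ultimately show "x + y \<in> D" unfolding D_def using a_closed[OF b(1) c(1)] by blast
  next
    fix x r assume "x \<in> D"
    then obtain b where b: "b \<in> carrier B" "Polynomial.degree (j b) \<le> n" "to_fract (\<tau> ^ n) * poly.coeff (j b) n = to_fract x"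
      unfolding D_def by blast
    have jr: "j (\<phi> r \<otimes> b) = Polynomial.smult (to_fract r) (j b)"
      using b(1) by simp
    have "to_fract (\<tau> ^ n) * poly.coeff (j (\<phi> r \<otimes> b)) n = to_fract (r * x)"
      unfolding jr coeff_smult to_fract_mult b(3)[symmetric] by (simp only: mult_ac)
    moreover have "Polynomial.degree (j (\<phi> r \<otimes> b)) \<le> n"
      unfolding jr using degree_smult_le b(2) by (rule order_trans)
    ultimately show "r * x \<in> D" unfolding D_def using m_closed[OF \<phi>_closed b(1), of r]
      by blast
  next
    obtain b where b: "b \<in> carrier B" "j b = [:0, 1:] ^ n"
      using Bim_power[OF x_in, of n] by (metis imageE)
    have "j b = Polynomial.monom 1 n" unfolding b(2) by (simp add: monom_altdef)
    then have "Polynomial.degree (j b) \<le> n" "to_fract (\<tau> ^ n) * poly.coeff (j b) n = to_fract (\<tau> ^ n)"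
      by (simp_all add: degree_monom_eq)
    then show "\<tau> ^ n \<in> D" unfolding D_def using b(1) by blast
    show "\<tau> ^ n \<noteq> 0" using \<tau>_nonzero by simp
  qed
  then obtain g where g: "g \<in> D" "g \<noteq> 0" "\<And>q. q \<in> D \<Longrightarrow> g dvd q"
    by blast
  then obtain \<beta> where \<beta>: "\<beta> \<in> carrier B" "Polynomial.degree (j \<beta>) \<le> n" "to_fract (\<tau> ^ n) * poly.coeff (j \<beta>) n = to_fract g"
    unfolding D_def by blast
  have "poly.coeff (j \<beta>) n \<noteq> 0"
  proof
    assume "poly.coeff (j \<beta>) n = 0"
    then have "to_fract g = 0" using \<beta>(3) by simp
    then show False using g(2) by simp
  qed
  then have "Polynomial.degree (j \<beta>) = n" using \<beta>(2) le_degree[of "j \<beta>" n]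
    by linarith
  moreover have "\<exists>a. poly.coeff (j b) n = to_fract a * poly.coeff (j \<beta>) n" if b: "b \<in> carrier B" "Polynomial.degree (j b) \<le> n" for b
  proof -
    obtain q where q: "to_fract (\<tau> ^ n) * poly.coeff (j b) n = to_fract q"
      using leading_coeff_bound[OF b] by blast
    then have "g dvd q" using g(3) b unfolding D_def by blast
    then obtain a where "q = g * a" by (elim dvdE)
    then have "to_fract (\<tau> ^ n) * poly.coeff (j b) n = to_fract (\<tau> ^ n) * (to_fract a * poly.coeff (j \<beta>) n)"
      unfolding q by (simp only: to_fract_mult \<beta>(3)[symmetric] mult_ac)
    then have "poly.coeff (j b) n = to_fract a * poly.coeff (j \<beta>) n"
      using \<tau>_nonzero by (subst (asm) mult_cancel_left) simp
    then show ?thesis by blast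
  qed
  ultimately show ?thesis using \<beta>(1) by blast
qed

lemma flat_B: "flat TYPE('m) Ch (restrict_scalars \<phi> B)"
proof -
  obtain \<beta> where \<beta>: "\<And>n. \<beta> n \<in> carrier B" "\<And>n. Polynomial.degree (j (\<beta> n)) = n"
    and lead: "\<And>n b. b \<in> carrier B \<Longrightarrow> Polynomial.degree (j b) \<le> n \<Longrightarrow> \<exists>a. poly.coeff (j b) n = to_fract a * poly.coeff (j (\<beta> n)) n"
    using exists_basis_element by metis
  define comb where "comb c k = (\<Sum>i<k. [:to_fract (c i):] * j (\<beta> i))"
    for c :: "nat \<Rightarrow> complex poly" and k
  have comb_add: "comb (\<lambda>i. c i + c' i) k = comb c k + comb c' k" for c c' k
    unfolding comb_def sum.distrib[symmetric] by (intro sum.cong) (simp_all add: smult_add_left)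
  have comb_mult: "comb (\<lambda>i. a * c i) k = [:to_fract a:] * comb c k" for a c k
    unfolding comb_def sum_distrib_left by (intro sum.cong) (simp_all add: mult.commute)
  \<comment> \<open>For \<open>n = 0\<close> the condition on the degree does not exclude
    \<open>j (\<beta> 0) = 0\<close>. That case is ruled out next, since the coefficient 1 of the
    unit of B is a multiple of that of \<open>\<beta> 0\<close>.\<close>
  have lc: "poly.coeff (j (\<beta> n)) n \<noteq> 0 \<or> n = 0 \<and> j (\<beta> 0) = 0" for n
    using \<beta>(2)[of n] leading_coeff_0_iff[of "j (\<beta> n)"]
      by (cases "j (\<beta> n) = 0") auto
  have \<beta>0: "j (\<beta> 0) \<noteq> 0"
    using lead[OF one_closed, of 0] by auto
  have lc: "poly.coeff (j (\<beta> n)) n \<noteq> 0" for n using lc[of n] \<beta>0 by blast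
  \<comment> \<open>Division by leading terms: a multiple of \<open>\<beta> k\<close> removes the
    coefficient in degree \<open>k\<close>, and the remainder has smaller degree and stays in
    B.\<close>
  have exists: "\<exists>c. (\<forall>i\<ge>k. c i = 0) \<and> j b = comb c k"
    if "b \<in> carrier B" "\<And>i. k \<le> i \<Longrightarrow> poly.coeff (j b) i = 0" for b k
    using that
  proof (induction k arbitrary: b)
    case 0
    then have "j b = 0" by (intro poly_eqI) simp
    then show ?case by (intro exI[of _ "\<lambda>_. 0"]) (simp add: comb_def)
  next
    case (Suc k)
    have "Polynomial.degree (j b) \<le> k" using Suc.prems(2) by (intro degree_le) auto
    then obtain a where a: "poly.coeff (j b) k = to_fract a * poly.coeff (j (\<beta> k)) k"
      using lead[OF Suc.prems(1)] by blast
    define b' where "b' = b \<ominus> \<phi> a \<otimes> \<beta> k"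
    have b': "b' \<in> carrier B" unfolding b'_def using Suc.prems(1) \<beta>(1)
      by (intro minus_closed m_closed \<phi>_closed)
    have jb': "j b' = j b - [:to_fract a:] * j (\<beta> k)"
      unfolding b'_def using Suc.prems(1) \<beta>(1)
      by (simp only: j_minus j_simps(1) j_\<phi> \<phi>_closed m_closed)
    have "poly.coeff (j b') i = 0" if "k \<le> i" for i
    proof (cases "i = k")
      case True
      then show ?thesis unfolding jb' using a by simp
    next
      case False
      then have "poly.coeff (j b) i = 0" "poly.coeff (j (\<beta> k)) i = 0"
        using that Suc.prems(2)[of i] \<beta>(2)[of k] by (auto intro: coeff_eq_0)
      then show ?thesis unfolding jb' by simp
    qed
    then obtain c where c: "\<forall>i\<ge>k. c i = 0" "j b' = comb c k" using Suc.IH[OF b']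
      by blast
    have "comb (c(k := a)) (Suc k) = [:to_fract a:] * j (\<beta> k) + comb c k"
      unfolding comb_def by simp
    also have "\<dots> = j b" unfolding c(2)[symmetric] jb' by simp
    finally have "j b = comb (c(k := a)) (Suc k)" ..
    moreover have "\<forall>i\<ge>Suc k. (c(k := a)) i = 0" using c(1) by simp
    ultimately show ?case by blast
  qed
  \<comment> \<open>The last summand alone reaches the top degree, so its coefficient must vanish,
    and so on downwards.\<close>
  have unique: "d i = 0" if "comb d k = 0" "i < k" for d i k
    using that
  proof (induction k)
    case (Suc k)
    have "poly.coeff (comb d (Suc k)) k = to_fract (d k) * poly.coeff (j (\<beta> k)) k"
    proof -
      have "poly.coeff ([:to_fract (d i):] * j (\<beta> i)) k = 0" if "i < k" for i
        using that \<beta>(2)[of i] by (simp add: coeff_eq_0)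
      then have "(\<Sum>i<k. poly.coeff ([:to_fract (d i):] * j (\<beta> i)) k) = 0"
        by (intro sum.neutral) auto
      then show ?thesis
        unfolding comb_def sum.lessThan_Suc coeff_add coeff_sum by simp
    qed
    then have "to_fract (d k) * poly.coeff (j (\<beta> k)) k = 0" using Suc.prems(1) by simp
    then have dk: "d k = 0" using lc[of k] by simp
    then have "comb d k = 0" using Suc.prems(1) unfolding comb_def by simp
    then show ?case using Suc dk by (cases "i = k") auto
  qed simp
  \<comment> \<open>Asking for agreement at all large \<open>k\<close> allows two expansions to be
    compared at a common length, so uniqueness and linearity of the coordinates involve no bound on
    degrees.\<close>
  define rep where "rep b c \<longleftrightarrow> (\<exists>k0. \<forall>k\<ge>k0. j b = comb c k)"
    for b c
  have rep_unique: "c = c'" if "rep b c" "rep b c'" for b c c'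
  proof
    fix i
    obtain k0 k1 where "\<forall>k\<ge>k0. j b = comb c k" "\<forall>k\<ge>k1. j b = comb c' k"
      using \<open>rep b c\<close> \<open>rep b c'\<close> unfolding rep_def by blast
    then have "comb c (max (Suc i) (max k0 k1)) = comb c' (max (Suc i) (max k0 k1))"
      by (metis max.cobounded1 max.cobounded2 order_trans)
    moreover have "comb (\<lambda>i. c i - c' i) k = comb c k - comb c' k" for k
      using comb_add[of "\<lambda>i. c i - c' i" c' k] by simp
    ultimately have "comb (\<lambda>i. c i - c' i) (max (Suc i) (max k0 k1)) = 0" by simp
    from unique[OF this, of i] show "c i = c' i" by simp
  qed
  have rep_exists: "\<exists>c. rep b c" if b: "b \<in> carrier B" for b
  proof -
    obtain c where c: "\<forall>i\<ge>Suc (Polynomial.degree (j b)). c i = 0" "j b = comb c (Suc (Polynomial.degree (j b)))"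
      using exists[OF b, of "Suc (Polynomial.degree (j b))"] coeff_eq_0[of "j b"]
        by (metis Suc_le_lessD)
    have "comb c k = comb c (Suc (Polynomial.degree (j b)))"
      if "k \<ge> Suc (Polynomial.degree (j b))" for k
      unfolding comb_def using that c(1) by (intro sum.mono_neutral_right) auto
    then show ?thesis unfolding rep_def using c(2) by metis
  qed
  define cf where "cf b = (SOME c. rep b c)" for b
  have cf: "rep b (cf b)" if "b \<in> carrier B" for b
    unfolding cf_def by (rule someI_ex[OF rep_exists[OF that]])
  let ?N = "restrict_scalars \<phi> B"
  have N: "carrier ?N = carrier B" "monoid.mult ?N = monoid.mult B" "one ?N = one B"
    "ring.zero ?N = ring.zero B" "add ?N = add B" "module.smult ?N = (\<lambda>a b. \<phi> a \<otimes> b)"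
    by (simp_all only: restrict_scalars_def partial_object.simps monoid.simps ring.simps module.simps)
  have cringN: "cring ?N" and jN: "j \<in> ring_hom ?N ring_of_type_algebra"
  proof -
    have neg: "\<exists>y\<in>carrier B. j y = - j x" if "x \<in> carrier B" for x
      using that j_simps(5)[OF that] a_inv_closed[OF that] by blast
    have "cring ?N \<and> j \<in> ring_hom ?N ring_of_type_algebra"
      by (intro conjI cring_of_embedding[of j ?N]; unfold N)
        (use j_inj j_simps neg m_closed a_closed one_closed zero_closed in blast)+
    then show "cring ?N" "j \<in> ring_hom ?N ring_of_type_algebra" by blast+
  qed
  interpret N: cring ?N by (rule cringN)
  have embN: "embedded_ring ?N (\<lambda>b. to_fract (j b))"
  proof
    show "(\<lambda>b. to_fract (j b)) \<in> ring_hom ?N ring_of_type_algebra"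
      using jN by (auto simp: ring_hom_def)
    show "inj_on (\<lambda>b. to_fract (j b)) (carrier ?N)"
      using j_inj unfolding N by (auto simp: inj_on_def)
  qed
  have j_finsum_N: "j (finsum ?N f I) = (\<Sum>i\<in>I. j (f i))"
    if "finite I" "\<And>i. f i \<in> carrier B" for f and I :: "nat set"
  proof -
    have "to_fract (j (finsum ?N f I)) = to_fract (\<Sum>i\<in>I. j (f i))"
      unfolding to_fract_sum
        by (rule embedded_ring.j_finsum[OF embN that(1)]) (simp only: N that(2))
    then show ?thesis by (simp only: to_fract_eq_iff)
  qed
  have modN: "module Ch ?N"
  proof (rule moduleI)
    show "cring Ch" by (rule cring_from_type_algebra)
    show "abelian_group ?N" ..
  next
    fix a x assume "x \<in> carrier ?N"
    then show "a \<odot>\<^bsub>?N\<^esub> x \<in> carrier ?N" unfolding N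
      by (intro m_closed \<phi>_closed)
  next
    fix a b x assume "x \<in> carrier ?N"
    then show "(a \<oplus>\<^bsub>Ch\<^esub> b) \<odot>\<^bsub>?N\<^esub> x = a \<odot>\<^bsub>?N\<^esub> x \<oplus>\<^bsub>?N\<^esub> b \<odot>\<^bsub>?N\<^esub> x"
      unfolding N ring_of_type_algebra_simps \<phi>_simps by (intro l_distr \<phi>_closed)
  next
    fix a x y assume "x \<in> carrier ?N" "y \<in> carrier ?N"
    then show "a \<odot>\<^bsub>?N\<^esub> (x \<oplus>\<^bsub>?N\<^esub> y) = a \<odot>\<^bsub>?N\<^esub> x \<oplus>\<^bsub>?N\<^esub> a \<odot>\<^bsub>?N\<^esub> y"
      unfolding N by (intro r_distr \<phi>_closed)
  next
    fix a b x assume "x \<in> carrier ?N"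
    then show "(a \<otimes>\<^bsub>Ch\<^esub> b) \<odot>\<^bsub>?N\<^esub> x = a \<odot>\<^bsub>?N\<^esub> (b \<odot>\<^bsub>?N\<^esub> x)"
      unfolding N ring_of_type_algebra_simps \<phi>_simps by (intro m_assoc \<phi>_closed)
  next
    fix x assume "x \<in> carrier ?N"
    then show "\<one>\<^bsub>Ch\<^esub> \<odot>\<^bsub>?N\<^esub> x = x"
      unfolding N ring_of_type_algebra_simps \<phi>_simps by (rule l_one)
  qed
  interpret M: module Ch ?N by (rule modN)
  have "module_coordinates Ch ?N (\<lambda>i b. cf b i) \<beta>"
  proof
    fix i show "\<beta> i \<in> carrier ?N" unfolding N by (rule \<beta>(1))
  next
    fix n i show "cf n i \<in> carrier Ch" by simp
  next
    fix b b' i assume "b \<in> carrier ?N" "b' \<in> carrier ?N"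
    then have b: "b \<in> carrier B" "b' \<in> carrier B" unfolding N .
    obtain k0 k1 where k: "\<And>k. k \<ge> k0 \<Longrightarrow> j b = comb (cf b) k" "\<And>k. k \<ge> k1 \<Longrightarrow> j b' = comb (cf b') k"
      using cf b unfolding rep_def by blast
    have "j (b \<oplus> b') = comb (\<lambda>i. cf b i + cf b' i) k" if "max k0 k1 \<le> k" for k
      using k[of k] that unfolding comb_add j_simps(2)[OF b] by simp
    then have "rep (b \<oplus> b') (\<lambda>i. cf b i + cf b' i)" unfolding rep_def by blast
    then have "cf (b \<oplus> b') = (\<lambda>i. cf b i + cf b' i)"
      using rep_unique cf a_closed[OF b] by blast
    then show "cf (b \<oplus>\<^bsub>?N\<^esub> b') i = cf b i \<oplus>\<^bsub>Ch\<^esub> cf b' i"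
      unfolding N by simp
  next
    fix a b i assume "b \<in> carrier ?N"
    then have b: "b \<in> carrier B" unfolding N .
    obtain k0 where k: "\<And>k. k \<ge> k0 \<Longrightarrow> j b = comb (cf b) k"
      using cf b unfolding rep_def by blast
    have "j (\<phi> a \<otimes> b) = comb (\<lambda>i. a * cf b i) k" if "k0 \<le> k" for k
      using k[OF that] unfolding comb_mult j_simps(1)[OF \<phi>_closed b] j_\<phi> by (simp only:)
    then have "rep (\<phi> a \<otimes> b) (\<lambda>i. a * cf b i)" unfolding rep_def by blast
    then have "cf (\<phi> a \<otimes> b) = (\<lambda>i. a * cf b i)"
      using rep_unique cf m_closed[OF \<phi>_closed b] by blast
    then show "cf (a \<odot>\<^bsub>?N\<^esub> b) i = a \<otimes>\<^bsub>Ch\<^esub> cf b i"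
      unfolding N by simp
  next
    fix b assume "b \<in> carrier ?N"
    then have b: "b \<in> carrier B" unfolding N .
    obtain k0 where k0: "\<And>k. k \<ge> k0 \<Longrightarrow> j b = comb (cf b) k"
      using cf b unfolding rep_def by blast
    have "b = (\<Oplus>\<^bsub>?N\<^esub>i\<in>{..<k}. cf b i \<odot>\<^bsub>?N\<^esub> \<beta> i)"
      if "k \<ge> k0" for k
    proof -
      have c: "\<phi> (cf b i) \<otimes> \<beta> i \<in> carrier B" for i using \<beta>(1)
        by (intro m_closed \<phi>_closed)
      have "j (\<Oplus>\<^bsub>?N\<^esub>i\<in>{..<k}. \<phi> (cf b i) \<otimes> \<beta> i) = (\<Sum>i<k. j (\<phi> (cf b i) \<otimes> \<beta> i))"
        by (rule j_finsum_N[OF _ c]) simp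
      also have "\<dots> = comb (cf b) k"
        unfolding comb_def
          by (intro sum.cong refl) (simp only: j_simps(1)[OF \<phi>_closed \<beta>(1)] j_\<phi>)
      also have "\<dots> = j b" using k0[OF that] by simp
      finally have "j (\<Oplus>\<^bsub>?N\<^esub>i\<in>{..<k}. \<phi> (cf b i) \<otimes> \<beta> i) = j b" .
      moreover have "(\<Oplus>\<^bsub>?N\<^esub>i\<in>{..<k}. \<phi> (cf b i) \<otimes> \<beta> i) \<in> carrier B"
        using N.finsum_closed[of "\<lambda>i. \<phi> (cf b i) \<otimes> \<beta> i" "{..<k}"] c
          unfolding N by blast
      ultimately show ?thesis unfolding N using j_eq_iff b by metis
    qed
    then show "\<exists>k0. \<forall>k\<ge>k0. b = (\<Oplus>\<^bsub>?N\<^esub>i\<in>{..<k}. cf b i \<odot>\<^bsub>?N\<^esub> \<beta> i)" by blast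
  qed
  then show ?thesis by (rule module_coordinates.flat)
qed

theorem is_generalized_danielewski_surface: "generalized_danielewski_surface TYPE('m) B \<phi>"
  unfolding generalized_danielewski_surface_def affine_complex_surface_def finitely_generated_over_def
    faithfully_flat_def
proof (intro conjI allI impI)
  fix m assume "maximalideal m Ch"
  then show "reduced_ring (closed_fiber B \<phi> m)"
    using closed_fiber_reduced Ch_maximalideal_eval by metis
next
  fix m m' assume "maximalideal m Ch \<and> maximalideal m' Ch \<and>
    \<not> domain (closed_fiber B \<phi> m) \<and> \<not> domain (closed_fiber B \<phi> m')"
  moreover have "m = {q. poly q 0 = 0}"
    if "maximalideal m Ch" "\<not> domain (closed_fiber B \<phi> m)" for m
    using Ch_maximalideal_eval[OF that(1)] that(2) closed_fiber_domain by metis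
  ultimately show "m = m'" by metis
qed (rule \<phi>_hom domain_B finite_generation krull_dim_B normal_B flat_B spec_surjective_B
    generic_fiber_reduced generic_fiber_affine_line)+

end

section \<open>Rooted trees\<close>

context rooted_tree
begin

section \<open>Order and combinatorics of rooted trees\<close>

lemma le_facts:
  shows le_refl: "e \<in> N \<Longrightarrow> (e, e) \<in> le"
    and le_trans: "(a, b) \<in> le \<Longrightarrow> (b, c) \<in> le \<Longrightarrow> (a, c) \<in> le"
    and le_antisym: "(a, b) \<in> le \<Longrightarrow> (b, a) \<in> le \<Longrightarrow> a = b"
    and le_in_N: "(a, b) \<in> le \<Longrightarrow> a \<in> N \<and> b \<in> N"
proof -
  have po: "refl_on N le" "trans le" "antisym le" "le \<subseteq> N \<times> N"
    using partial_order_onD[OF order] by auto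
  show "e \<in> N \<Longrightarrow> (e, e) \<in> le" using po(1) by (auto dest: refl_onD)
  show "(a, b) \<in> le \<Longrightarrow> (b, c) \<in> le \<Longrightarrow> (a, c) \<in> le"
    using po(2) by (auto dest: transD)
  show "(a, b) \<in> le \<Longrightarrow> (b, a) \<in> le \<Longrightarrow> a = b" using po(3)
    by (auto dest: antisymD)
  show "(a, b) \<in> le \<Longrightarrow> a \<in> N \<and> b \<in> N" using po(4) by auto
qed

lemma Anc_iff: "x \<in> Anc e \<longleftrightarrow> (x, e) \<in> le \<and> x \<noteq> e"
  using le_in_N by (auto simp: Anc_def down_def)

lemma down_iff: "x \<in> down e \<longleftrightarrow> (x, e) \<in> le"
  using le_in_N by (auto simp: down_def)

lemma finite_Anc: "finite (Anc e)"
  using finite_nodes by (auto simp: Anc_def down_def)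

lemma root_in: "root \<in> N" and Anc_root: "Anc root = {}"
proof -
  have "root \<in> {e \<in> N. \<forall>x\<in>N. (x, e) \<in> le \<longrightarrow> x = e}"
    using unique_minimal by simp
  then show "root \<in> N" "Anc root = {}" using le_in_N by (auto simp: Anc_iff set_eq_iff)
qed

lemma Par_in_N: "e \<in> N \<Longrightarrow> e \<noteq> root \<Longrightarrow> Par e \<in> N"
  using Par_in_Anc[of e] le_in_N by (auto simp: Anc_iff)

lemma tree_induct [consumes 1, case_names root step]:
  assumes "e \<in> N" and "P root"
    and step: "\<And>e. e \<in> N \<Longrightarrow> e \<noteq> root \<Longrightarrow> P (Par e) \<Longrightarrow> P e"
  shows "P e"
  using assms(1)
proof (induction "card (Anc e)" arbitrary: e rule: less_induct)
  case less
  show ?case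
  proof (cases "e = root")
    case False
    then show ?thesis
      using less step card_Anc_Par[of e] Par_in_N[of e] by blast
  qed (use assms(2) in simp)
qed

lemma root_le: "e \<in> N \<Longrightarrow> (root, e) \<in> le"
proof (induction rule: tree_induct)
  case (step e)
  then show ?case using Par_in_Anc[of e] le_trans by (auto simp: Anc_iff)
qed (simp add: root_in le_refl)

lemma chain: "(a, e) \<in> le \<Longrightarrow> (b, e) \<in> le \<Longrightarrow> (a, b) \<in> le \<or> (b, a) \<in> le"
  using down_chain[of e] le_in_N[of a e] le_in_N[of b e] le_refl[of a]
  by (cases "a = b") (auto simp: total_on_def)

text \<open>The ancestors of \<open>e\<close> form a finite chain. Its member with the most
  ancestors is the greatest one, and it satisfies the description that defines
  \<open>Par e\<close>.\<close>

lemma le_Par: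
  assumes "(x, e) \<in> le" "x \<noteq> e"
  shows "(x, Par e) \<in> le"
proof -
  have e: "e \<in> N" using le_in_N[OF assms(1)] by simp
  have "Anc e \<noteq> {}" using assms by (auto simp: Anc_iff)
  then have "Max ((\<lambda>y. card (Anc y)) ` Anc e) \<in> (\<lambda>y. card (Anc y)) ` Anc e"
    using finite_Anc by (intro Max_in) auto
  then obtain p where p: "p \<in> Anc e" "Max ((\<lambda>y. card (Anc y)) ` Anc e) = card (Anc p)"
    by blast
  have max: "(y, p) \<in> le" if "y \<in> Anc e" for y
  proof (rule ccontr)
    assume n: "(y, p) \<notin> le"
    then have py: "(p, y) \<in> le" "p \<noteq> y"
      using chain[of y e p] that p(1) le_refl le_in_N by (auto simp: Anc_iff)
    have "Anc p \<subseteq> Anc y" using py le_trans le_antisym by (auto simp: Anc_iff)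
    moreover have "p \<in> Anc y" "p \<notin> Anc p" using py by (auto simp: Anc_iff)
    ultimately have "card (Anc p) < card (Anc y)"
      by (intro psubset_card_mono finite_Anc) auto
    moreover have "card (Anc y) \<le> Max ((\<lambda>y. card (Anc y)) ` Anc e)"
      using that finite_Anc by (intro Max_ge) auto
    ultimately show False using p(2) by simp
  qed
  have "Par e = p"
    unfolding Par_def
  proof (rule the_equality)
    show "p \<in> Anc e \<and> (\<forall>x\<in>Anc e. (p, x) \<in> le \<longrightarrow> x = p)"
      using p(1) max le_antisym by blast
  next
    fix q assume "q \<in> Anc e \<and> (\<forall>x\<in>Anc e. (q, x) \<in> le \<longrightarrow> x = q)"
    then show "q = p" using max p(1) by blast
  qed
  then show ?thesis using max assms by (simp add: Anc_iff)
qed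

lemma Par_le: "e \<in> N \<Longrightarrow> e \<noteq> root \<Longrightarrow> (Par e, e) \<in> le \<and> Par e \<noteq> e"
  using Par_in_Anc[of e] by (simp add: Anc_iff)

lemma Anc_eq_down_Par:
  assumes "e \<in> N" "e \<noteq> root" shows "Anc e = insert (Par e) (Anc (Par e))"
proof
  show "Anc e \<subseteq> insert (Par e) (Anc (Par e))" using le_Par by (auto simp: Anc_iff)
  show "insert (Par e) (Anc (Par e)) \<subseteq> Anc e"
    using Par_le[OF assms] le_trans le_antisym by (fastforce simp: Anc_iff)
qed

lemma Child_iff:
  assumes "e \<in> N"
  shows "c \<in> Child e \<longleftrightarrow> c \<in> N \<and> c \<noteq> root \<and> Par c = e"
proof
  assume c: "c \<in> Child e"
  then have cN: "c \<in> N" and ec: "(e, c) \<in> le" "c \<noteq> e"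
    and min: "\<And>x. x \<in> N \<Longrightarrow> (e, x) \<in> le \<Longrightarrow> x \<noteq> e \<Longrightarrow> (x, c) \<in> le \<Longrightarrow> x = c"
    unfolding Child_def by auto
  have "e \<in> Anc c" using ec by (auto simp: Anc_iff)
  then have r: "c \<noteq> root" using Anc_root by auto
  have "(e, Par c) \<in> le" using le_Par ec by blast
  then have "Par c = e"
    using min[of "Par c"] Par_le[OF cN r] Par_in_N[OF cN r] by blast
  then show "c \<in> N \<and> c \<noteq> root \<and> Par c = e" using cN r by blast
next
  assume c: "c \<in> N \<and> c \<noteq> root \<and> Par c = e"
  then have ec: "(e, c) \<in> le" "c \<noteq> e" using Par_le[of c] by auto
  have "x = c" if "(e, x) \<in> le" "x \<noteq> e" "(x, c) \<in> le" for x
  proof (rule ccontr)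
    assume "x \<noteq> c"
    then have "(x, e) \<in> le" using le_Par[OF that(3)] c by blast
    then show False using le_antisym that by blast
  qed
  then show "c \<in> Child e" unfolding Child_def using c ec by blast
qed

lemma finite_Child [simp]: "finite (Child e)"
  using finite_nodes by (auto simp: Child_def)

lemma Parents_in_N: "e \<in> Parents \<Longrightarrow> e \<in> N"
  by (simp add: Parents_def)

lemma Anc_Parents: "x \<in> Anc e \<Longrightarrow> x \<in> Parents"
  using le_in_N by (auto simp: Anc_iff Parents_def Leaves_def)

lemma child_below_exists:
  assumes "e' \<in> Anc e" shows "\<exists>c. c \<in> Child e' \<and> (c, e) \<in> le"
proof -
  have "e \<in> N" using assms le_in_N by (auto simp: Anc_iff)
  then show ?thesis
    using assms
  proof (induction rule: tree_induct)
    case root then show ?case using Anc_root by simp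
  next
    case (step e)
    show ?case
    proof (cases "e' = Par e")
      case True
      then have "e \<in> Child e'" using step Par_in_N Child_iff by simp
      then show ?thesis using step le_refl by blast
    next
      case False
      then have "e' \<in> Anc (Par e)" using step Anc_eq_down_Par by blast
      then obtain c where "c \<in> Child e'" "(c, Par e) \<in> le" using step by blast
      then show ?thesis using Par_le[OF step(1,2)] le_trans by blast
    qed
  qed
qed

lemma child_below_unique:
  assumes "c \<in> Child e'" "(c, e) \<in> le" "c' \<in> Child e'" "(c', e) \<in> le"
  shows "c = c'"
proof -
  have e': "e' \<in> N" using assms(1) le_in_N by (auto simp: Child_def)
  have *: "a = b" if "a \<in> Child e'" "b \<in> Child e'" "(a, b) \<in> le" for a b
  proof (rule ccontr)
    assume "a \<noteq> b"
    then have "(a, Par b) \<in> le" by (rule le_Par[OF that(3)])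
    moreover have "Par b = e'" using that(2) by (simp add: Child_iff[OF e'])
    ultimately have "(a, e') \<in> le" by simp
    moreover have "(e', a) \<in> le" "a \<noteq> e'" using that(1) by (auto simp: Child_def)
    ultimately show False using le_antisym by blast
  qed
  then show ?thesis using chain[OF assms(2,4)] assms by blast
qed

text \<open>Climb from \<open>e\<close> to its parent until an ancestor of \<open>p\<close> is
  reached; there the paths to \<open>p\<close> and to \<open>e\<close> leave through different
  children. Their labels differ, which later gives an invertible scalar.\<close>

lemma incomparable_meet:
  assumes "e \<in> N" "p \<in> N" "(p, e) \<notin> le" "(e, p) \<notin> le"
  shows "\<exists>e' c c'. e' \<in> Anc p \<and> e' \<in> Anc e \<and> c \<in> Child e' \<and> c' \<in> Child e' \<and> c \<noteq> c' \<and>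
    (c, p) \<in> le \<and> (c', e) \<in> le"
  using assms(1,3,4)
proof (induction rule: tree_induct)
  case root
  then show ?case using root_le[OF assms(2)] by simp
next
  case (step e)
  note Par = Par_le[OF step(1,2)]
  have "(p, Par e) \<notin> le" using step.prems Par le_trans by blast
  show ?case
  proof (cases "(Par e, p) \<in> le")
    case True
    then have "Par e \<noteq> p" using step.prems Par by blast
    then have anc: "Par e \<in> Anc p" using True by (simp add: Anc_iff)
    obtain c where c: "c \<in> Child (Par e)" "(c, p) \<in> le" using child_below_exists[OF anc]
      by blast
    have "e \<in> Child (Par e)" using Child_iff[OF Par_in_N[OF step(1,2)]] step by blast
    moreover have "c \<noteq> e" using c step.prems by blast
    ultimately show ?thesis using anc c Par_in_Anc[OF step(1,2)] le_refl[OF step(1)] by blast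
  next
    case False
    then obtain e' c c' where m: "e' \<in> Anc p" "e' \<in> Anc (Par e)" "c \<in> Child e'" "c' \<in> Child e'" "c \<noteq> c'"
      "(c, p) \<in> le" "(c', Par e) \<in> le"
      using step.IH \<open>(p, Par e) \<notin> le\<close> by blast
    then have "e' \<in> Anc e" using Anc_eq_down_Par[OF step(1,2)] by blast
    moreover have "(c', e) \<in> le" by (rule le_trans[OF m(7) conjunct1[OF Par]])
    ultimately show ?thesis using m by blast
  qed
qed

end

section \<open>Evaluation of polynomials\<close>

definition monom_eval :: "('v \<Rightarrow> 'b::comm_ring_1) \<Rightarrow> ('v \<Rightarrow>\<^sub>0 nat) \<Rightarrow> 'b" where
  "monom_eval \<xi> m = (\<Prod>v\<in>Poly_Mapping.keys m. \<xi> v ^ Poly_Mapping.lookup m v)"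

definition mpoly_eval :: "('c::comm_ring_1 \<Rightarrow> 'b) \<Rightarrow> ('v \<Rightarrow> 'b::comm_ring_1) \<Rightarrow>
    (('v \<Rightarrow>\<^sub>0 nat) \<Rightarrow>\<^sub>0 'c) \<Rightarrow> 'b" where
  "mpoly_eval f \<xi> P = (\<Sum>m\<in>Poly_Mapping.keys P. f (Poly_Mapping.lookup P m) * monom_eval \<xi> m)"

lemma monom_eval_superset:
  assumes "finite V" "Poly_Mapping.keys m \<subseteq> V"
  shows "monom_eval \<xi> m = (\<Prod>v\<in>V. \<xi> v ^ Poly_Mapping.lookup m v)"
  unfolding monom_eval_def using assms
  by (intro prod.mono_neutral_left) (auto simp: in_keys_iff)

lemma monom_eval_add: "monom_eval \<xi> (m + m') = monom_eval \<xi> m * monom_eval \<xi> m'"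
proof -
  let ?V = "Poly_Mapping.keys m \<union> Poly_Mapping.keys m'"
  have "monom_eval \<xi> (m + m') = (\<Prod>v\<in>?V. \<xi> v ^ Poly_Mapping.lookup (m + m') v)"
    using Poly_Mapping.keys_add[of m m'] by (intro monom_eval_superset) auto
  also have "\<dots> = monom_eval \<xi> m * monom_eval \<xi> m'"
    by (simp add: monom_eval_superset[of ?V] lookup_add power_add prod.distrib)
  finally show ?thesis .
qed

locale coefficient_hom =
  fixes f :: "'c::comm_ring_1 \<Rightarrow> 'b::comm_ring_1"
  assumes f_add: "f (x + y) = f x + f y" and f_mult: "f (x * y) = f x * f y" and f_1: "f 1 = 1"
begin

lemma f_0: "f 0 = 0"
  using f_add[of 0 0] by simp

lemma f_sum: "f (sum g I) = (\<Sum>i\<in>I. f (g i))"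
  by (induction I rule: infinite_finite_induct) (simp_all add: f_add f_0)

lemma mpoly_eval_superset:
  assumes "finite M" "Poly_Mapping.keys P \<subseteq> M"
  shows "mpoly_eval f \<xi> P = (\<Sum>m\<in>M. f (Poly_Mapping.lookup P m) * monom_eval \<xi> m)"
  unfolding mpoly_eval_def using assms
  by (intro sum.mono_neutral_left) (auto simp: in_keys_iff f_0)

lemma mpoly_eval_add: "mpoly_eval f \<xi> (P + P') = mpoly_eval f \<xi> P + mpoly_eval f \<xi> P'"
proof -
  let ?M = "Poly_Mapping.keys P \<union> Poly_Mapping.keys P'"
  have "mpoly_eval f \<xi> (P + P') = (\<Sum>m\<in>?M. f (Poly_Mapping.lookup (P + P') m) * monom_eval \<xi> m)"
    using Poly_Mapping.keys_add[of P P'] by (intro mpoly_eval_superset) auto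
  then show ?thesis
    by (simp add: mpoly_eval_superset[of ?M] lookup_add f_add algebra_simps sum.distrib)
qed

lemma mpoly_eval_0: "mpoly_eval f \<xi> 0 = 0"
  by (simp add: mpoly_eval_def)

lemma mpoly_eval_single: "mpoly_eval f \<xi> (Poly_Mapping.single m c) = f c * monom_eval \<xi> m"
  by (simp add: mpoly_eval_def f_0)

lemma mpoly_eval_sum: "mpoly_eval f \<xi> (sum P I) = (\<Sum>i\<in>I. mpoly_eval f \<xi> (P i))"
  by (induction I rule: infinite_finite_induct) (simp_all add: mpoly_eval_add mpoly_eval_0)

end

lemma mpoly_expansion: "P = (\<Sum>m\<in>Poly_Mapping.keys P. Poly_Mapping.single m (Poly_Mapping.lookup P m))"
proof (rule poly_mapping_eqI)
  fix k
  have "(\<Sum>m\<in>Poly_Mapping.keys P. Poly_Mapping.lookup P m when m = k) = Poly_Mapping.lookup P k"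
    by (cases "k \<in> Poly_Mapping.keys P")
      (auto simp: when_def sum.delta in_keys_iff)
  then show "Poly_Mapping.lookup P k = Poly_Mapping.lookup (\<Sum>m\<in>Poly_Mapping.keys P. Poly_Mapping.single m (Poly_Mapping.lookup P m)) k"
    by (simp add: lookup_sum lookup_single)
qed

lemma (in coefficient_hom) mpoly_eval_mult:
  "mpoly_eval f \<xi> (P * P') = mpoly_eval f \<xi> P * mpoly_eval f \<xi> P'"
proof -
  have "P * P' = (\<Sum>m\<in>Poly_Mapping.keys P. \<Sum>m'\<in>Poly_Mapping.keys P'.
      Poly_Mapping.single (m + m') (Poly_Mapping.lookup P m * Poly_Mapping.lookup P' m'))"
    by (subst mpoly_expansion[of P], subst mpoly_expansion[of P'])
      (simp add: sum_product mult_single)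
  then show ?thesis
    by (simp add: mpoly_eval_sum mpoly_eval_single f_mult monom_eval_add)
      (simp add: mpoly_eval_def sum_product mult_ac)
qed

lemma (in coefficient_hom) mpoly_eval_1: "mpoly_eval f \<xi> 1 = 1"
  using mpoly_eval_single[of \<xi> 0 1] by (simp add: monom_eval_def f_1)

lemma (in coefficient_hom) mpoly_eval_minus: "mpoly_eval f \<xi> (P - P') = mpoly_eval f \<xi> P - mpoly_eval f \<xi> P'"
  using mpoly_eval_add[of \<xi> "P - P'" P'] by simp

lemma (in coefficient_hom) mpoly_eval_prod: "mpoly_eval f \<xi> (prod P I) = (\<Prod>i\<in>I. mpoly_eval f \<xi> (P i))"
  by (induction I rule: infinite_finite_induct) (simp_all add: mpoly_eval_mult mpoly_eval_1)

lemma (in coefficient_hom) mpoly_eval_cst: "mpoly_eval f \<xi> (Poly_Mapping.single 0 a) = f a"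
  by (simp add: mpoly_eval_single monom_eval_def)

lemma (in coefficient_hom) mpoly_eval_var:
  "mpoly_eval f \<xi> (Poly_Mapping.single (Poly_Mapping.single v 1) 1) = \<xi> v"
  by (simp add: mpoly_eval_single monom_eval_def f_1)

definition polys_in :: "'v set \<Rightarrow> (('v \<Rightarrow>\<^sub>0 nat) \<Rightarrow>\<^sub>0 'c::comm_ring_1) set" where
  "polys_in V = {p. \<forall>m\<in>Poly_Mapping.keys p. Poly_Mapping.keys m \<subseteq> V}"

lemma polys_in_add: "p \<in> polys_in V \<Longrightarrow> q \<in> polys_in V \<Longrightarrow> p + q \<in> polys_in V"
  using Poly_Mapping.keys_add[of p q] by (fastforce simp: polys_in_def)

lemma polys_in_uminus: "p \<in> polys_in V \<Longrightarrow> - p \<in> polys_in V"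
  by (simp add: polys_in_def keys_minus)

lemma polys_in_diff: "p \<in> polys_in V \<Longrightarrow> q \<in> polys_in V \<Longrightarrow> p - q \<in> polys_in V"
  using polys_in_add[of p V "- q"] polys_in_uminus by fastforce

lemma polys_in_single: "Poly_Mapping.keys m \<subseteq> V \<Longrightarrow> Poly_Mapping.single m c \<in> polys_in V"
  by (simp add: polys_in_def)

lemma polys_in_mult:
  assumes "p \<in> polys_in V" "q \<in> polys_in V" shows "p * q \<in> polys_in V"
  unfolding polys_in_def
proof clarify
  fix k v assume k: "k \<in> Poly_Mapping.keys (p * q)" and v: "v \<in> Poly_Mapping.keys k"
  obtain m m' where "k = m + m'" "m \<in> Poly_Mapping.keys p" "m' \<in> Poly_Mapping.keys q"
    using k keys_mult[of p q] by blast
  then show "v \<in> V" using v Poly_Mapping.keys_add[of m m'] assms unfolding polys_in_def by blast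
qed

lemma polys_in_0: "0 \<in> polys_in V" and polys_in_1: "1 \<in> polys_in V"
  by (simp_all add: polys_in_def)

lemma polys_in_mono: "V \<subseteq> W \<Longrightarrow> polys_in V \<subseteq> polys_in W"
  by (auto simp: polys_in_def)

lemma polys_in_subring: "subring_set (polys_in V)"
  by (simp add: subring_set_def polys_in_add polys_in_mult polys_in_diff polys_in_0 polys_in_1)

text \<open>Membership of both operands is kept as a hypothesis in the sum and product cases,
  because later properties are compatible with products only inside the ring in the given
  variables.\<close>

lemma polys_in_induct [consumes 1, case_names cst var add mult]:
  fixes P :: "('v \<Rightarrow>\<^sub>0 nat) \<Rightarrow>\<^sub>0 'c::comm_ring_1"
  assumes P: "P \<in> polys_in V"
    and cst: "\<And>a. T (Poly_Mapping.single 0 a)"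
    and var: "\<And>v. v \<in> V \<Longrightarrow> T (Poly_Mapping.single (Poly_Mapping.single v 1) 1)"
    and add: "\<And>p q. p \<in> polys_in V \<Longrightarrow> q \<in> polys_in V \<Longrightarrow> T p \<Longrightarrow> T q \<Longrightarrow> T (p + q)"
    and mult: "\<And>p q. p \<in> polys_in V \<Longrightarrow> q \<in> polys_in V \<Longrightarrow> T p \<Longrightarrow> T q \<Longrightarrow> T (p * q)"
  shows "T P"
proof -
  let ?T = "\<lambda>p. p \<in> polys_in V \<and> T p"
  have var': "?T (Poly_Mapping.single (Poly_Mapping.single v 1) 1)" if "v \<in> V" for v
    using var[OF that] that by (simp add: polys_in_single)
  have cst': "?T (Poly_Mapping.single 0 a)" for a
    using cst by (simp add: polys_in_single)
  have mult': "?T (p * q)" if "?T p" "?T q" for p q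
    using that mult polys_in_mult by blast
  have add': "?T (p + q)" if "?T p" "?T q" for p q
    using that add polys_in_add by blast
  have one: "?T 1" using cst'[of 1] by simp
  have pow: "?T (Poly_Mapping.single (Poly_Mapping.single v n) 1)" if "v \<in> V" for v n
  proof (induction n)
    case 0 then show ?case using cst'[of 1] by simp
  next
    case (Suc n)
    have "Poly_Mapping.single (Poly_Mapping.single v (Suc n)) (1::'c)
        = Poly_Mapping.single (Poly_Mapping.single v 1) 1 * Poly_Mapping.single (Poly_Mapping.single v n) 1"
      by (simp add: mult_single flip: single_add)
    then show ?case using Suc var'[OF that] mult polys_in_mult by metis
  qed
  have mon: "?T (Poly_Mapping.single m c)" if "Poly_Mapping.keys m \<subseteq> V" for m c
  proof -
    have "?T (Poly_Mapping.single (\<Sum>v\<in>W. Poly_Mapping.single v (Poly_Mapping.lookup m v)) 1)" if "finite W" "W \<subseteq> V" for W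
      using that
    proof (induction W rule: finite_induct)
      case empty then show ?case using one by simp
    next
      case (insert v W)
      have eq: "Poly_Mapping.single (\<Sum>v\<in>insert v W. Poly_Mapping.single v (Poly_Mapping.lookup m v)) (1::'c)
          = Poly_Mapping.single (Poly_Mapping.single v (Poly_Mapping.lookup m v)) 1 *
            Poly_Mapping.single (\<Sum>v\<in>W. Poly_Mapping.single v (Poly_Mapping.lookup m v)) 1"
        using insert by (simp add: mult_single)
      have "?T (Poly_Mapping.single (Poly_Mapping.single v (Poly_Mapping.lookup m v)) 1)"
        using insert.prems by (intro pow) auto
      moreover have "?T (Poly_Mapping.single (\<Sum>v\<in>W. Poly_Mapping.single v (Poly_Mapping.lookup m v)) 1)"
        using insert.prems by (intro insert.IH) auto
      ultimately show ?case unfolding eq by (rule mult')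
    qed
    from this[of "Poly_Mapping.keys m"] have "?T (Poly_Mapping.single m 1)"
      using that mpoly_expansion[of m] by simp
    then have "?T (Poly_Mapping.single 0 c * Poly_Mapping.single m 1)"
      using cst' mult polys_in_mult by blast
    then show ?thesis by (simp add: mult_single)
  qed
  have "?T (\<Sum>m\<in>M. Poly_Mapping.single m (Poly_Mapping.lookup P m))"
    if "finite M" "M \<subseteq> Poly_Mapping.keys P" for M
    using that
  proof (induction M rule: finite_induct)
    case empty then show ?case using cst'[of 0] by simp
  next
    case (insert m M)
    then have "?T (Poly_Mapping.single m (Poly_Mapping.lookup P m))"
      using P by (intro mon) (auto simp: polys_in_def)
    moreover have "?T (\<Sum>m\<in>M. Poly_Mapping.single m (Poly_Mapping.lookup P m))"
      using insert by blast
    ultimately show ?case unfolding sum.insert[OF insert.hyps(1,2)] by (rule add')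
  qed
  from this[of "Poly_Mapping.keys P"] show ?thesis using mpoly_expansion[of P] by simp
qed

interpretation C: coefficient_hom "\<lambda>a :: complex poly. [:to_fract a:] :: KX"
  by unfold_locales (simp_all add: one_pCons)

lemma fract_poly_pcompose: "fract_poly (pcompose u w) = pcompose (fract_poly u) (fract_poly w)"
  by (induction u) (simp_all add: pcompose_pCons map_poly_pCons)

lemma pcompose_HX [simp]: "pcompose HX s = HX"
  by (simp add: HX_def)

lemma pcompose_1_left [simp]: "pcompose (1 :: 'a::comm_ring_1 poly) s = 1"
  by (simp add: pcompose_1)

section \<open>Blow-ups of a chart and their effect on residues\<close>

definition blowup :: "complex \<Rightarrow> complex poly poly" where
  "blowup t = [:[:t:], [:0, 1:]:]"

text \<open>Modulo h the substitution contracts the whole line to the point \<open>t\<close>, so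
  residues become constants.\<close>

lemma red_pcompose_blowup: "red (pcompose u (blowup t)) = [:poly (red u) t:]"
  by (induction u) (simp_all add: pcompose_pCons blowup_def)

lemma resid_blowup: "resid f g \<Longrightarrow> resid (pcompose f (fract_poly (blowup t))) [:poly g t:]"
  unfolding resid_def using fract_poly_pcompose red_pcompose_blowup by metis

text \<open>Write f as d + c T + h w. Substituting t + h T cancels the constant term, and what is
  left is h (c T + w(t + h T)). The last summand has constant residue, so the slope \<open>c\<close>
  survives the division by h.\<close>

lemma resid_blowup_linear:
  assumes "resid f [:d, c:]" "d + c * t = 0"
  shows "\<exists>f1 d1. pcompose f (fract_poly (blowup t)) = HX * f1 \<and> resid f1 [:d1, c:]"
proof -
  obtain u where u: "f = fract_poly u" "red u = [:d, c:]" using assms(1) unfolding resid_def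
    by blast
  have "red (u - [:[:d:], [:c:]:]) = 0" using u(2) by simp
  then obtain w where w: "u - [:[:d:], [:c:]:] = hp * w" unfolding red_eq_0_iff by (elim dvdE)
  have "u = [:[:d:], [:c:]:] + hp * w" unfolding w[symmetric] by simp
  then have "pcompose u (blowup t) = [:[:d + c * t:]:] + hp * [:0, [:c:]:] + hp * pcompose w (blowup t)"
    by (simp add: pcompose_add pcompose_mult pcompose_pCons pcompose_smult blowup_def)
  also have "\<dots> = hp * ([:0, [:c:]:] + pcompose w (blowup t))"
    unfolding assms(2) by (simp add: algebra_simps)
  finally have "pcompose f (fract_poly (blowup t)) = fract_poly (hp * ([:0, [:c:]:] + pcompose w (blowup t)))"
    unfolding u(1) fract_poly_pcompose[symmetric] by simp
  then have "pcompose f (fract_poly (blowup t)) = HX * fract_poly ([:0, [:c:]:] + pcompose w (blowup t))"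
    unfolding fract_poly_mult fract_poly_hp .
  moreover have "resid (fract_poly ([:0, [:c:]:] + pcompose w (blowup t))) [:poly (red w) t, c:]"
    unfolding resid_def by (intro exI conjI, rule refl) (simp add: red_pcompose_blowup)
  ultimately show ?thesis by blast
qed

lemma resid_cc: "resid (cc a) [:a:]"
  using resid_const[of "[:a:]"] by simp

lemma resid_HX: "resid HX 0"
  unfolding resid_0_iff by (intro exI[of _ 1]) simp

lemma resid_divide_HX: "resid f 0 \<Longrightarrow> HX * f' = f \<Longrightarrow> \<exists>g. resid f' g"
  unfolding resid_0_iff by (metis HX_nonzero integral_imp_resid mult_left_cancel)

definition hinv :: KX where "hinv = [:inverse (to_fract [:0, 1:]):]"

lemma HX_hinv: "HX * hinv = 1"
  by (simp add: HX_def hinv_def one_pCons)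

context fine_labelled_rooted_tree
begin

section \<open>The generic coordinates\<close>

text \<open>\<open>gen e\<close> is the pair of the images of \<open>X\<^bsub>Par e\<^esub>\<close> (which is \<open>X\<^sub>0\<close> at the root) and of \<open>R e\<close>.\<close>

function gen :: "'a \<Rightarrow> KX \<times> KX" where
  "gen e = (if e \<in> N - {root}
     then (hinv * ((\<Prod>g\<in>Child (Par e). fst (gen (Par e)) - cc (lb g)) * snd (gen (Par e))),
           (\<Prod>g\<in>Child (Par e) - {e}. fst (gen (Par e)) - cc (lb g)) * snd (gen (Par e)))
     else ([:0, 1:], 1))"
  by pat_completeness auto
termination
  by (relation "measure (\<lambda>e. card (Anc e))") (auto intro: card_Anc_Par)

declare gen.simps [simp del]

definition yv :: "'a \<Rightarrow> KX" where "yv e = fst (gen e)"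
definition rv :: "'a \<Rightarrow> KX" where "rv e = snd (gen e)"
text \<open>The image of X_e: as h is invertible in K, the relation \<open>Delta0 e\<close> leaves
  Q_e / h as the only choice.\<close>

definition zv :: "'a \<Rightarrow> KX"
  where "zv e = hinv * ((\<Prod>g\<in>Child e. yv e - cc (lb g)) * rv e)"

lemma yv_root: "yv root = [:0, 1:]" and rv_root: "rv root = 1"
  by (simp_all add: yv_def rv_def gen.simps[of root])

lemma yv_step: "e \<in> N \<Longrightarrow> e \<noteq> root \<Longrightarrow> yv e = zv (Par e)"
  by (simp add: yv_def zv_def rv_def gen.simps[of e])

lemma rv_step: "e \<in> N \<Longrightarrow> e \<noteq> root \<Longrightarrow>
    rv e = (\<Prod>g\<in>Child (Par e) - {e}. yv (Par e) - cc (lb g)) * rv (Par e)"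
  by (simp add: yv_def rv_def gen.simps[of e])

lemma HX_zv: "HX * zv e = (\<Prod>g\<in>Child e. yv e - cc (lb g)) * rv e"
  unfolding zv_def mult.assoc[symmetric] HX_hinv by simp

lemma Par_Child: "c \<in> Child e \<Longrightarrow> e \<in> N \<and> c \<in> N \<and> c \<noteq> root \<and> Par c = e \<and> (e, c) \<in> le \<and> c \<noteq> e"
proof -
  assume c: "c \<in> Child e"
  then have "e \<in> N" using le_in_N by (auto simp: Child_def)
  then show ?thesis using c Child_iff[of e c] by (auto simp: Child_def)
qed

lemma lb_distinct: "c \<in> Child e \<Longrightarrow> c' \<in> Child e \<Longrightarrow> c \<noteq> c' \<Longrightarrow> lb c \<noteq> lb c'"
  using fine[of c c'] Par_Child[of c e] Par_Child[of c' e] by simp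

section \<open>Charts\<close>

text \<open>Regularity of \<open>zv e\<close> is demanded only for nodes \<open>e\<close> not above
  \<open>p\<close>. It cannot be extended to \<open>zv p\<close> when \<open>p\<close> is not a
  leaf, where h times \<open>zv p\<close> has nonzero residue. At a leaf the restriction excludes no
  node of \<open>Parents\<close>.\<close>

definition chart_at :: "'a \<Rightarrow> KX \<Rightarrow> bool" where
  "chart_at p s \<longleftrightarrow>
    (\<exists>a c. c \<noteq> 0 \<and> s = fract_poly [:a, c:]) \<and>
    (\<forall>e. \<forall>g\<in>Child e. (g, p) \<in> le \<longrightarrow> resid (pcompose (yv e) s) [:lb g:]) \<and>
    (\<exists>d c0. c0 \<noteq> 0 \<and> resid (pcompose (yv p) s) [:d, c0:]) \<and>
    (\<forall>e\<in>Parents. (p, e) \<notin> le \<longrightarrow> (\<exists>g. resid (pcompose (zv e) s) g))"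

text \<open>Modulo h every factor of \<open>rv e\<close> becomes a difference between the label of a
  node on the path and that of a sibling, which is nonzero by the fine labelling.\<close>

lemma resid_rv:
  assumes "\<And>e g. g \<in> Child e \<Longrightarrow> (g, p) \<in> le \<Longrightarrow> resid (pcompose (yv e) s) [:lb g:]"
    and "e \<in> N" "(e, p) \<in> le"
  shows "\<exists>k. k \<noteq> 0 \<and> resid (pcompose (rv e) s) [:k:]"
  using assms(2,3)
proof (induction rule: tree_induct)
  case root
  have "resid (pcompose (rv root) s) [:1:]" using resid_1 by (simp add: rv_root one_pCons)
  then show ?case by (intro exI[of _ 1]) simp
next
  case (step e)
  have eC: "e \<in> Child (Par e)" using Child_iff[OF Par_in_N[OF step(1,2)]] step by blast
  have "(Par e, p) \<in> le" using Par_le[OF step(1,2)] step.prems le_trans by blast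
  then obtain k where k: "k \<noteq> 0" "resid (pcompose (rv (Par e)) s) [:k:]" using step.IH
    by blast
  have y: "resid (pcompose (yv (Par e)) s) [:lb e:]" using assms(1)[OF eC step.prems] .
  have "resid (pcompose (yv (Par e) - cc (lb g)) s) [:lb e - lb g:]" for g
    using resid_diff[OF y resid_cc[of "lb g"]] by (simp add: pcompose_diff)
  then have "resid (pcompose (rv e) s) ((\<Prod>g\<in>Child (Par e) - {e}. [:lb e - lb g:]) * [:k:])"
    unfolding rv_step[OF step(1,2)] pcompose_mult pcompose_prod
    by (intro resid_mult resid_prod k)
  moreover have "(\<Prod>g\<in>Child (Par e) - {e}. [:lb e - lb g:]) * [:k:] = [:(\<Prod>g\<in>Child (Par e) - {e}. lb e - lb g) * k:]"
  proof -
    have "(\<Prod>g\<in>F. [:lb e - lb g:]) = [:\<Prod>g\<in>F. lb e - lb g:]" if "finite F" for F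
      using that by (induction F rule: finite_induct) (simp_all add: one_pCons)
    then show ?thesis by simp
  qed
  moreover have "(\<Prod>g\<in>Child (Par e) - {e}. lb e - lb g) * k \<noteq> 0"
    using k(1) lb_distinct[OF eC] by auto
  ultimately show ?case by metis
qed

lemma chart_root: "chart_at root [:0, 1:]"
proof -
  have "[:0, 1:] = fract_poly [:0, 1:]" by (simp add: map_poly_pCons)
  then have 1: "\<exists>a c. c \<noteq> 0 \<and> [:0, 1:] = fract_poly [:a, c:]"
    by (metis zero_neq_one)
  have 2: "(g, root) \<notin> le" if "g \<in> Child e" for e g
    using that Par_Child[OF that] Anc_root root_le[of g] le_antisym by blast
  have "resid (pcompose (yv root) [:0, 1:]) [:0, 1:]"
    unfolding resid_def yv_root pcompose_idR
    by (intro exI[of _ "[:0, 1:]"]) (simp add: map_poly_pCons)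
  then have 3: "\<exists>d c0. c0 \<noteq> 0 \<and> resid (pcompose (yv root) [:0, 1:]) [:d, c0:]"
    by (intro exI[of _ 0] exI[of _ 1]) simp
  show ?thesis
    unfolding chart_at_def using 1 2 3 root_le Parents_in_N by blast
qed

text \<open>The chart at the parent p is blown up where the residue of \<open>yv p\<close> equals
  \<open>lb q\<close>. There \<open>yv p - cc (lb q)\<close> becomes h times a function with
  nonconstant affine residue, and so \<open>zv p\<close>, which is \<open>yv q\<close>, is regular
  with nonconstant affine residue. Functions already regular stay regular with constant residue;
  only nodes above p on the other branches need a separate argument.\<close>

lemma chart_step:
  assumes q: "q \<in> N" "q \<noteq> root" and ch: "chart_at (Par q) s"
  shows "\<exists>s'. chart_at q s'"
proof -
  define p where "p = Par q"
  have pN: "p \<in> N" unfolding p_def using Par_in_N[OF q] .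
  have qC: "q \<in> Child p" using Child_iff[OF pN] q p_def by blast
  have pq: "(p, q) \<in> le" "p \<noteq> q" using Par_le[OF q] p_def by auto
  obtain a c where s: "c \<noteq> 0" "s = fract_poly [:a, c:]" using ch unfolding chart_at_def
    by blast
  obtain d c0 where c0: "c0 \<noteq> 0" "resid (pcompose (yv p) s) [:d, c0:]"
    using ch unfolding chart_at_def p_def by blast
  \<comment> \<open>The solution of \<open>d + c0 * t = lb q\<close>: the point of the line h = 0
    that belongs to the child \<open>q\<close>.\<close>
  define t where "t = (lb q - d) / c0"
  define s' where "s' = pcompose s (fract_poly (blowup t))"
  have comp: "pcompose f s' = pcompose (pcompose f s) (fract_poly (blowup t))" for f
    unfolding s'_def by (rule pcompose_assoc)
  have s': "s' = fract_poly [:a + [:t:] * c, [:0, 1:] * c:]"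
    unfolding s'_def s(2) fract_poly_pcompose[symmetric]
    by (intro arg_cong[where f = fract_poly]) (simp add: pcompose_pCons blowup_def algebra_simps)
  have dt: "d + c0 * t = lb q" unfolding t_def using c0(1) by simp
  have yp: "resid (pcompose (yv p) s') [:lb q:]"
    using resid_blowup[OF c0(2), of t] dt unfolding comp by (simp add: mult.commute)
  have on_chain: "resid (pcompose (yv e) s') [:lb g:]" if g: "g \<in> Child e" "(g, q) \<in> le"
    for e g
  proof (cases "e = p")
    case True
    then have "g = q" using child_below_unique[of g p q q] g qC le_refl[OF q(1)] by simp
    then show ?thesis using True yp by simp
  next
    case False
    have "g \<noteq> q" using False Par_Child[OF g(1)] p_def by blast
    then have "(g, p) \<in> le" using le_Par[OF g(2)] p_def by simp
    then have "resid (pcompose (yv e) s) [:lb g:]"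
      using ch g(1) unfolding chart_at_def p_def by blast
    from resid_blowup[OF this, of t] show ?thesis unfolding comp by simp
  qed
  obtain k where k: "k \<noteq> 0" "resid (pcompose (rv q) s') [:k:]"
    using resid_rv[OF on_chain q(1) le_refl[OF q(1)]] by blast
  have "resid (pcompose (yv p - cc (lb q)) s) [:d - lb q, c0:]"
    using resid_diff[OF c0(2) resid_cc[of "lb q"]] by (simp add: pcompose_diff)
  then obtain f1 d1 where f1: "pcompose (yv p - cc (lb q)) s' = HX * f1" "resid f1 [:d1, c0:]"
    using resid_blowup_linear[of "pcompose (yv p - cc (lb q)) s" "d - lb q" c0 t] dt
    unfolding comp by (auto simp: algebra_simps)
  \<comment> \<open>All factors of \<open>Q p\<close> other than the one for \<open>q\<close> are
    collected in \<open>rv q\<close>, so the blown-up factor contains the only h, and it cancels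
    against the h on the left.\<close>
  have "HX * zv p = (yv p - cc (lb q)) * rv q"
    unfolding HX_zv rv_step[OF q] p_def[symmetric]
      by (simp add: prod.remove[OF finite_Child qC] mult.assoc)
  from arg_cong[OF this, of "\<lambda>f. pcompose f s'"]
  have "HX * pcompose (zv p) s' = HX * (f1 * pcompose (rv q) s')"
    unfolding pcompose_mult f1(1) pcompose_HX by (simp only: mult.assoc)
  then have zp: "pcompose (zv p) s' = f1 * pcompose (rv q) s'"
    by (subst (asm) mult_cancel_left) simp
  have zp_res: "resid (pcompose (zv p) s') [:d1 * k, c0 * k:]"
    using resid_mult[OF f1(2) k(2)] unfolding zp by (simp add: mult.commute)
  then have yq: "\<exists>d c0. c0 \<noteq> 0 \<and> resid (pcompose (yv q) s') [:d, c0:]"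
    unfolding yv_step[OF q] p_def[symmetric] using c0(1) k(1) by (metis mult_eq_0_iff)
  have zv_res: "\<exists>g. resid (pcompose (zv e) s') g"
    if y: "resid (pcompose (yv e) s') gy" and r: "resid (pcompose (rv e) s') 0" for e gy
  proof (rule resid_divide_HX)
    have "resid (pcompose (yv e - cc (lb g)) s') (gy - [:lb g:])" for g
      using resid_diff[OF y resid_cc[of "lb g"]] by (simp add: pcompose_diff)
    then have "resid (\<Prod>g\<in>Child e. pcompose (yv e - cc (lb g)) s') (\<Prod>g\<in>Child e. gy - [:lb g:])"
      by (intro resid_prod)
    from resid_mult[OF this r]
    show "resid ((\<Prod>g\<in>Child e. pcompose (yv e - cc (lb g)) s') * pcompose (rv e) s') 0"
      by simp
    show "HX * pcompose (zv e) s' = (\<Prod>g\<in>Child e. pcompose (yv e - cc (lb g)) s') * pcompose (rv e) s'"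
      using arg_cong[OF HX_zv[of e], of "\<lambda>f. pcompose f s'"]
      by (simp only: pcompose_mult pcompose_HX pcompose_prod)
  qed
  have rv_res: "resid (pcompose (rv e) s') ((\<Prod>g\<in>Child (Par e) - {e}. gy - [:lb g:]) * gr)"
    if "e \<in> N" "e \<noteq> root" and y: "resid (pcompose (yv (Par e)) s') gy"
      and r: "resid (pcompose (rv (Par e)) s') gr"
    for e gy gr
  proof -
    have "resid (pcompose (yv (Par e) - cc (lb g)) s') (gy - [:lb g:])" for g
      using resid_diff[OF y resid_cc[of "lb g"]] by (simp add: pcompose_diff)
    then show ?thesis
      unfolding rv_step[OF that(1,2)] pcompose_mult pcompose_prod by (intro resid_mult resid_prod r)
  qed
  \<comment> \<open>At or above a sibling \<open>c\<close> of \<open>q\<close>, the product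
    \<open>rv e\<close> contains the factor \<open>yv p - cc (lb q)\<close>, which vanishes modulo
    h. Therefore division by h in \<open>zv e\<close> creates no pole.\<close>
  have side: "(\<exists>g. resid (pcompose (yv e) s') g) \<and> resid (pcompose (rv e) s') 0"
    if c: "c \<in> Child p" "c \<noteq> q" and e: "e \<in> N" "(c, e) \<in> le" for c e
    using e
  proof (induction rule: tree_induct)
    case root
    then show ?case using Par_Child[OF c(1)] root_le[of c] le_antisym by blast
  next
    case (step e)
    show ?case
    proof (cases "c = e")
      case True
      then have Pe: "Par e = p" using Par_Child[OF c(1)] by simp
      have "\<exists>k'. resid (pcompose (rv p) s') k'"
        using resid_rv[OF on_chain pN pq(1)] by blast
      then obtain k' where k': "resid (pcompose (rv (Par e)) s') k'" using Pe by auto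
      have "resid (pcompose (yv (Par e)) s') [:lb q:]" using yp Pe by simp
      note r = rv_res[OF step(1,2) this k']
      have 0: "(\<Prod>g\<in>Child (Par e) - {e}. [:lb q:] - [:lb g:]) = 0"
        using qC c(2) True Pe by (intro prod_zero) auto
      have "resid (pcompose (rv e) s') 0" using r unfolding 0 mult_zero_left .
      then show ?thesis using zp_res unfolding yv_step[OF step(1,2)] Pe by blast
    next
      case False
      then have "(c, Par e) \<in> le" using le_Par[OF step.prems] by blast
      then obtain gy where gy: "resid (pcompose (yv (Par e)) s') gy" "resid (pcompose (rv (Par e)) s') 0"
        using step.IH by blast
      then show ?thesis
        using zv_res[OF gy] rv_res[OF step(1,2) gy] unfolding yv_step[OF step(1,2)] by simp
    qed
  qed
  have "\<exists>g. resid (pcompose (zv e) s') g" if e: "e \<in> Parents" "(q, e) \<notin> le" for e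
  proof (cases "(p, e) \<in> le")
    case False
    then obtain g where "resid (pcompose (zv e) s) g"
      using ch e(1) unfolding chart_at_def p_def by blast
    from resid_blowup[OF this, of t] show ?thesis unfolding comp by blast
  next
    case True
    show ?thesis
    proof (cases "e = p")
      case True then show ?thesis using zp_res by blast
    next
      case False
      then have "p \<in> Anc e" using True by (auto simp: Anc_iff)
      then obtain c where c: "c \<in> Child p" "(c, e) \<in> le" using child_below_exists by blast
      then have "c \<noteq> q" using e(2) by blast
      then show ?thesis using side[OF c(1) _ Parents_in_N[OF e(1)] c(2)] zv_res by blast
    qed
  qed
  moreover have "\<exists>a c. c \<noteq> 0 \<and> s' = fract_poly [:a, c:]"
    using s' s(1) by (intro exI[of _ "a + [:t:] * c"] exI[of _ "[:0, 1:] * c"]) simp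
  ultimately have "chart_at q s'"
    unfolding chart_at_def using on_chain yq by blast
  then show ?thesis by blast
qed

lemma chart_exists: "p \<in> N \<Longrightarrow> \<exists>s. chart_at p s"
  by (induction rule: tree_induct) (use chart_root chart_step in blast)+

text \<open>In the chart at \<open>e\<close> itself the residue of \<open>rv e\<close> is a nonzero
  constant.\<close>

lemma rv_nonzero: "e \<in> N \<Longrightarrow> rv e \<noteq> 0"
proof
  assume e: "e \<in> N" "rv e = 0"
  obtain s where "chart_at e s" using chart_exists[OF e(1)] by blast
  then obtain k where "k \<noteq> 0" "resid (pcompose (rv e) s) [:k:]"
    using resid_rv[of e s e] e(1) le_refl unfolding chart_at_def by blast
  moreover have "resid (pcompose (rv e) s) 0"
    unfolding e(2) resid_def by (intro exI[of _ 0]) simp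
  ultimately show False using resid_unique by fastforce
qed

section \<open>The evaluation homomorphism\<close>

definition gen_val :: "'a option \<Rightarrow> KX" where
  "gen_val v = (case v of None \<Rightarrow> [:0, 1:] | Some e \<Rightarrow> zv e)"

definition ev :: "'a tree_poly \<Rightarrow> KX" where
  "ev = mpoly_eval (\<lambda>a. [:to_fract a:]) gen_val"

lemma ev_simps:
  "ev (p + p') = ev p + ev p'" "ev (p - p') = ev p - ev p'" "ev (p * p') = ev p * ev p'"
  "ev 0 = 0" "ev 1 = 1" "ev (prod f I) = (\<Prod>i\<in>I. ev (f i))" "ev (cst a) = [:to_fract a:]"
  "ev (var None) = [:0, 1:]" "ev (Xv e) = zv e" "ev h = HX"
  by (simp_all add: ev_def C.mpoly_eval_add C.mpoly_eval_minus C.mpoly_eval_mult C.mpoly_eval_0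
      C.mpoly_eval_1 C.mpoly_eval_prod cst_def C.mpoly_eval_cst var_def C.mpoly_eval_var Xv_def
      gen_val_def h_def HX_def del: One_nat_def)

lemma ev_sum: "ev (sum f I) = (\<Sum>i\<in>I. ev (f i))"
  by (induction I rule: infinite_finite_induct) (simp_all add: ev_simps)

lemma ev_power: "ev (p ^ n) = ev p ^ n"
  by (induction n) (simp_all add: ev_simps)

lemma ev_XPar: "e \<in> N \<Longrightarrow> ev (XPar e) = yv e"
  by (simp add: XPar_def ev_simps yv_root yv_step)

lemma ev_S: "e \<in> N \<Longrightarrow> ev (S e J) = (\<Prod>g\<in>Child e - J. yv e - cc (lb g))"
  unfolding S_def by (simp add: ev_simps ev_XPar)

lemma R_step: "e \<in> N \<Longrightarrow> e \<noteq> root \<Longrightarrow> R e = S (Par e) {e} * R (Par e)" and R_root: "R root = 1"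
  by (simp_all add: R.simps[of e] R.simps[of root])

lemma ev_R: "e \<in> N \<Longrightarrow> ev (R e) = rv e"
  by (induction rule: tree_induct)
    (simp_all add: R_root R_step ev_simps rv_root rv_step ev_S Par_in_N)

lemma ev_Q: "e \<in> N \<Longrightarrow> ev (Q e) = HX * zv e"
  unfolding Q_def HX_zv by (simp add: ev_simps ev_S ev_R)

end

context coefficient_hom
begin

section \<open>Evaluation of polynomials in one variable, and ideals given as sets\<close>

definition peval :: "'b \<Rightarrow> 'c poly \<Rightarrow> 'b" where
  "peval u g = poly (map_poly f g) u"

lemma peval_simps:
  "peval u 0 = 0" "peval u (pCons a g) = f a + u * peval u g"
  by (simp_all add: peval_def map_poly_pCons f_0)

lemma peval_const: "peval u [:a:] = f a" and peval_var: "peval u [:0, 1:] = u"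
  by (simp_all add: peval_simps f_0 f_1)

lemma peval_add: "peval u (g + g') = peval u g + peval u g'"
proof -
  have "map_poly f (g + g') = map_poly f g + map_poly f g'"
    by (rule poly_eqI) (simp add: coeff_map_poly f_0 f_add)
  then show ?thesis by (simp add: peval_def)
qed

lemma peval_mult: "peval u (g * g') = peval u g * peval u g'"
proof -
  have "map_poly f (g * g') = map_poly f g * map_poly f g'"
    by (rule poly_eqI) (simp add: coeff_map_poly f_0 f_sum f_mult coeff_mult)
  then show ?thesis by (simp add: peval_def)
qed

lemma peval_in_subring: "subring_set B \<Longrightarrow> u \<in> B \<Longrightarrow> (\<And>a. f a \<in> B) \<Longrightarrow> peval u g \<in> B"
  by (induction g) (auto simp: peval_simps intro: subring_setD)

end

lemma cst_simps: "cst (a + b) = cst a + cst b" "cst (a * b) = cst a * cst b" "cst 1 = 1" "cst 0 = 0"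
  by (simp_all add: cst_def single_add mult_single)

interpretation cst_hom: coefficient_hom cst
  by unfold_locales (simp_all add: cst_simps)

interpretation scalar_hom: coefficient_hom "\<lambda>a. cst [:a:]"
proof
  fix x y :: complex
  have "[:x + y:] = [:x:] + [:y:]" "[:x * y:] = [:x:] * [:y:]" by simp_all
  then show "cst [:x + y:] = cst [:x:] + cst [:y:]" "cst [:x * y:] = cst [:x:] * cst [:y:]"
    by (simp_all only: cst_simps)
  show "cst [:1:] = 1" unfolding one_pCons[symmetric] by (rule cst_simps(3))
qed

lemma cst_inverse_cancel:
  assumes "k \<noteq> 0" shows "cst [:inverse k:] * (cst [:k:] * P) = P"
proof -
  have "cst [:inverse k:] * cst [:k:] = cst [:inverse k * k:]"
    by (rule scalar_hom.f_mult[symmetric])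
  also have "inverse k * k = 1" using assms by simp
  finally have eq: "cst [:inverse k:] * cst [:k:] = 1" unfolding scalar_hom.f_1 .
  show ?thesis by (simp only: mult.assoc[symmetric] eq mult_1_left)
qed

definition ideal_in :: "'a::comm_ring_1 set \<Rightarrow> 'a set \<Rightarrow> bool" where
  "ideal_in B J \<longleftrightarrow> J \<subseteq> B \<and> 0 \<in> J \<and> (\<forall>x\<in>J. \<forall>y\<in>J. x + y \<in> J) \<and> (\<forall>b\<in>B. \<forall>x\<in>J. b * x \<in> J)"

lemma ideal_inD:
  assumes "ideal_in B J"
  shows "x \<in> J \<Longrightarrow> x \<in> B" "0 \<in> J" "x \<in> J \<Longrightarrow> y \<in> J \<Longrightarrow> x + y \<in> J" "b \<in> B \<Longrightarrow> x \<in> J \<Longrightarrow> b * x \<in> J"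
  using assms unfolding ideal_in_def by auto

lemma ideal_in_diff:
  assumes J: "ideal_in B J" and B: "subring_set B" and "x \<in> J" "y \<in> J"
  shows "x - y \<in> J"
proof -
  have "0 - 1 \<in> B" using subring_setD[OF B] by blast
  then have "(0 - 1) * y \<in> J" using ideal_inD(4)[OF J] assms(4) by blast
  from ideal_inD(3)[OF J assms(3) this] show ?thesis by simp
qed

context fine_labelled_rooted_tree
begin

section \<open>The polynomial ring of the tree\<close>

text \<open>The set \<open>D\<close> varies because the variables are adjoined one at a time, in
  such a way that \<open>D\<close> always contains the ancestors of its members.\<close>

abbreviation PD :: "'a set \<Rightarrow> 'a tree_poly set" where
  "PD D \<equiv> polys_in (insert None (Some ` D))"

lemma poly_ring_tree_simps:
  "carrier poly_ring_tree = PD Parents"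
  "p \<otimes>\<^bsub>poly_ring_tree\<^esub> q = p * q" "p \<oplus>\<^bsub>poly_ring_tree\<^esub> q = p + q"
  "\<one>\<^bsub>poly_ring_tree\<^esub> = 1" "\<zero>\<^bsub>poly_ring_tree\<^esub> = 0"
  by (simp_all add: poly_ring_tree_def polys_in_def ring_of_type_algebra_def)

lemma poly_ring_tree_cring: "cring poly_ring_tree"
  by (rule cring_of_embedding(1)[of "\<lambda>p. p"])
    (auto simp: poly_ring_tree_simps polys_in_add polys_in_mult polys_in_0 polys_in_1 intro: polys_in_uminus)

lemma ideal_in_iff: "ideal J poly_ring_tree \<longleftrightarrow> ideal_in (PD Parents) J"
proof
  assume "ideal J poly_ring_tree"
  then interpret ideal J poly_ring_tree .
  show "ideal_in (PD Parents) J"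
    unfolding ideal_in_def
  proof (intro conjI ballI)
    show "J \<subseteq> PD Parents" using a_subset unfolding poly_ring_tree_simps .
    show "0 \<in> J"
      using additive_subgroup.zero_closed[OF is_additive_subgroup] unfolding poly_ring_tree_simps .
  next
    fix x y assume "x \<in> J" "y \<in> J"
    then show "x + y \<in> J"
      using additive_subgroup.a_closed[OF is_additive_subgroup] unfolding poly_ring_tree_simps
        by blast
  next
    fix b x assume "b \<in> PD Parents" "x \<in> J"
    then show "b * x \<in> J" using I_l_closed[of x b] unfolding poly_ring_tree_simps by blast
  qed
next
  assume J: "ideal_in (PD Parents) J"
  interpret cring poly_ring_tree by (rule poly_ring_tree_cring)
  have "subgroup J (add_monoid poly_ring_tree)"
  proof (rule add.subgroupI)
    show "J \<subseteq> carrier poly_ring_tree" using ideal_inD(1)[OF J]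
      by (auto simp: poly_ring_tree_simps)
    show "J \<noteq> {}" using ideal_inD(2)[OF J] by blast
    fix a assume a: "a \<in> J"
    have "- a \<in> J" using ideal_in_diff[OF J polys_in_subring ideal_inD(2)[OF J] a] by simp
    moreover have "\<ominus>\<^bsub>poly_ring_tree\<^esub> a = - a"
    proof (rule minus_equality)
      show "- a \<oplus>\<^bsub>poly_ring_tree\<^esub> a = \<zero>\<^bsub>poly_ring_tree\<^esub>"
        by (simp add: poly_ring_tree_simps)
      show "a \<in> carrier poly_ring_tree" "- a \<in> carrier poly_ring_tree"
        using ideal_inD(1)[OF J] a \<open>- a \<in> J\<close>
          by (simp_all add: poly_ring_tree_simps)
    qed
    ultimately show "\<ominus>\<^bsub>poly_ring_tree\<^esub> a \<in> J" by simp
  next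
    fix a b assume "a \<in> J" "b \<in> J"
    then show "a \<oplus>\<^bsub>poly_ring_tree\<^esub> b \<in> J" using ideal_inD(3)[OF J]
      by (simp add: poly_ring_tree_simps)
  qed
  then show "ideal J poly_ring_tree"
  proof (intro idealI ring_axioms)
    fix a x assume "a \<in> J" "x \<in> carrier poly_ring_tree"
    then have "x * a \<in> J" using ideal_inD(4)[OF J] unfolding poly_ring_tree_simps by blast
    then show "x \<otimes>\<^bsub>poly_ring_tree\<^esub> a \<in> J" "a \<otimes>\<^bsub>poly_ring_tree\<^esub> x \<in> J"
      unfolding poly_ring_tree_simps by (simp_all only: mult.commute[of a x])
  qed
qed

lemma PD_mono: "D \<subseteq> D' \<Longrightarrow> PD D \<subseteq> PD D'"
  by (intro polys_in_mono) auto

lemma cst_in: "cst a \<in> PD D"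
  by (simp add: cst_def polys_in_single)

lemma h_in: "h \<in> PD D"
  unfolding h_def by (rule cst_in)

lemma var_in: "v \<in> insert None (Some ` D) \<Longrightarrow> var v \<in> PD D"
  unfolding var_def by (rule polys_in_single) auto

lemma Xv_in: "e \<in> D \<Longrightarrow> Xv e \<in> PD D"
  unfolding Xv_def by (intro var_in) simp

lemma XPar_in: "e \<in> N \<Longrightarrow> Anc e \<subseteq> D \<Longrightarrow> XPar e \<in> PD D"
  unfolding XPar_def using Par_in_Anc[of e] by (auto intro: Xv_in var_in)

lemma S_in: "e \<in> N \<Longrightarrow> Anc e \<subseteq> D \<Longrightarrow> S e J \<in> PD D"
  unfolding S_def by (intro subring_set_prod polys_in_subring polys_in_diff XPar_in cst_in)

text \<open>\<open>R e\<close> collects one factor for each step of the path from the root, so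
  \<open>R c\<close> is its initial part. The cofactor makes the quotient Q_e / R_c a polynomial, in
  variables of ancestors of \<open>e\<close> only.\<close>

lemma R_factor:
  assumes "e \<in> N" "(c, e) \<in> le" "Anc e \<subseteq> D"
  shows "\<exists>T\<in>PD D. R e = R c * T"
  using assms
proof (induction rule: tree_induct)
  case root
  then have "c = root" using root_le[of c] le_in_N le_antisym by blast
  then show ?case by (intro bexI[of _ 1]) (simp_all add: polys_in_1)
next
  case (step e)
  show ?case
  proof (cases "c = e")
    case True
    then show ?thesis by (intro bexI[of _ 1]) (simp_all add: polys_in_1)
  next
    case False
    have sub: "Anc (Par e) \<subseteq> D" using Anc_eq_down_Par[OF step(1,2)] step.prems by blast
    obtain T where T: "T \<in> PD D" "R (Par e) = R c * T"
      using step.IH[OF le_Par[OF step.prems(1) False] sub] by blast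
    have "R e = R c * (S (Par e) {e} * T)"
      unfolding R_step[OF step(1,2)] T(2) by (simp only: mult_ac)
    moreover have "S (Par e) {e} * T \<in> PD D"
      by (intro polys_in_mult S_in Par_in_N step sub T)
    ultimately show ?thesis by blast
  qed
qed

lemma R_in: "e \<in> N \<Longrightarrow> Anc e \<subseteq> D \<Longrightarrow> R e \<in> PD D"
  using R_factor[of e root D] root_le[of e] by (auto simp: R_root)

lemma Q_in: "e \<in> N \<Longrightarrow> Anc e \<subseteq> D \<Longrightarrow> Q e \<in> PD D"
  unfolding Q_def by (intro polys_in_mult S_in R_in)

lemma Anc_sub_Parents: "Anc e \<subseteq> Parents"
  using Anc_Parents by blast

lemma tree_gens_subset:
  "{Delta0 e | e. e \<in> Parents} \<union> {D. \<exists>e\<in>Parents. \<exists>e'\<in>Anc e. is_Delta e' e D} \<subseteq> PD Parents"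
proof -
  have "Delta0 e \<in> PD Parents" if "e \<in> Parents" for e
    unfolding Delta0_def using that Anc_sub_Parents
    by (intro polys_in_diff polys_in_mult h_in Xv_in Q_in Parents_in_N)
  then show ?thesis unfolding is_Delta_def poly_ring_tree_simps by blast
qed

lemma tree_ideal_ideal: "ideal_in (PD Parents) tree_ideal"
proof -
  interpret cring poly_ring_tree by (rule poly_ring_tree_cring)
  show ?thesis
    unfolding ideal_in_iff[symmetric] tree_ideal_def
    by (rule genideal_ideal) (use tree_gens_subset poly_ring_tree_simps(1) in simp)
qed

lemma tree_gens_in_ideal:
  "{Delta0 e | e. e \<in> Parents} \<union> {D. \<exists>e\<in>Parents. \<exists>e'\<in>Anc e. is_Delta e' e D} \<subseteq> tree_ideal"
proof -
  interpret cring poly_ring_tree by (rule poly_ring_tree_cring)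
  show ?thesis
    unfolding tree_ideal_def
    by (rule genideal_self) (use tree_gens_subset poly_ring_tree_simps(1) in simp)
qed

lemma Delta0_in: "e \<in> Parents \<Longrightarrow> h * Xv e - Q e \<in> tree_ideal"
  using tree_gens_in_ideal unfolding Delta0_def by blast

text \<open>Dividing by \<open>R c\<close> leaves one linear factor of \<open>Q e'\<close> and, with
  \<open>R_factor\<close>, the polynomial \<open>T\<close> equal to Q_e / R_c. That \<open>T\<close>
  involves only ancestors of \<open>e\<close> is what permits inductions along the tree.\<close>

lemma Delta_in:
  assumes e: "e \<in> Parents" "c \<in> Child e'" "(c, e) \<in> le"
  shows "\<exists>T\<in>PD (Anc e). (XPar e' - cst [:lb c:]) * Xv e - Xv e' * T \<in> tree_ideal"
proof -
  note c = Par_Child[OF e(2)]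
  have eN: "e \<in> N" using e(1) Parents_in_N by blast
  have anc: "e' \<in> Anc e"
    unfolding Anc_iff using le_trans[of e' c e] le_antisym[of e' c] c e(3) by blast
  obtain T where T: "T \<in> PD (Anc e)" "R e = R c * T"
    using R_factor[OF eN e(3) order_refl] by blast
  define D where "D = (XPar e' - cst [:lb c:]) * Xv e - Xv e' * (S e {} * T)"
  have ST: "S e {} * T \<in> PD (Anc e)" by (intro polys_in_mult S_in eN order_refl T)
  have Se': "S e' {} = (XPar e' - cst [:lb c:]) * S e' {c}"
    unfolding S_def by (simp add: prod.remove[OF finite_Child e(2)])
  have Pc: "Par c = e'" using c by blast
  have "R c = S (Par c) {c} * R (Par c)" by (rule R_step) (use c in blast)+
  then have Qe': "Q e' = (XPar e' - cst [:lb c:]) * R c"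
    by (simp only: Q_def Se' Pc mult.assoc)
  have Qe: "Q e = R c * (S e {} * T)" unfolding Q_def T(2) by (simp only: mult_ac)
  have RD: "R c * D = Q e' * Xv e - Q e * Xv e'"
  proof -
    have "R c * D = R c * ((XPar e' - cst [:lb c:]) * Xv e) - R c * (Xv e' * (S e {} * T))"
      unfolding D_def by (rule right_diff_distrib)
    also have "R c * ((XPar e' - cst [:lb c:]) * Xv e) = Q e' * Xv e"
      unfolding Qe' by (simp only: mult_ac)
    also have "R c * (Xv e' * (S e {} * T)) = Q e * Xv e'"
      unfolding Qe by (simp only: mult_ac)
    finally show ?thesis .
  qed
  have ST': "S e {} * T \<in> PD Parents" using ST PD_mono[OF Anc_sub_Parents] by blast
  have e': "e' \<in> N" "e' \<in> Parents" using c Anc_Parents[OF anc] by auto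
  have "D \<in> PD Parents"
    unfolding D_def
    by (rule polys_in_diff polys_in_mult XPar_in cst_in Xv_in ST' e' Anc_sub_Parents e(1))+
  moreover have "c \<in> Child e' \<inter> down e" using e by (simp add: down_iff)
  ultimately have "is_Delta e' e D"
    unfolding is_Delta_def poly_ring_tree_simps using RD by blast
  then have "D \<in> tree_ideal" using tree_gens_in_ideal e(1) anc by blast
  then show ?thesis unfolding D_def using ST by blast
qed

text \<open>For the second family only the multiple by \<open>R c\<close> is given explicitly. It
  evaluates to zero, and \<open>rv c\<close> can be cancelled because it is nonzero.\<close>

lemma ev_tree_ideal: "P \<in> tree_ideal \<Longrightarrow> ev P = 0"
proof -
  interpret cring poly_ring_tree by (rule poly_ring_tree_cring)
  have "tree_ideal \<subseteq> {P \<in> PD Parents. ev P = 0}"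
    unfolding tree_ideal_def
  proof (rule genideal_minimal)
    show "ideal {P \<in> PD Parents. ev P = 0} poly_ring_tree"
      unfolding ideal_in_iff ideal_in_def
      by (auto simp: ev_simps polys_in_0 polys_in_add polys_in_mult)
    have "ev (Delta0 e) = 0" if "e \<in> Parents" for e
      unfolding Delta0_def by (simp add: ev_simps ev_Q Parents_in_N that)
    moreover have "ev D = 0" if e: "e \<in> Parents" "e' \<in> Anc e" "is_Delta e' e D" for e e' D
    proof -
      obtain c where c: "c \<in> Child e'" "R c * D = Q e' * Xv e - Q e * Xv e'"
        using e(3) unfolding is_Delta_def by blast
      have "rv c * ev D = 0"
        using arg_cong[OF c(2), of ev] Par_Child[OF c(1)] Parents_in_N[OF e(1)]
        by (simp add: ev_simps ev_R ev_Q)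
      then show ?thesis using rv_nonzero Par_Child[OF c(1)] by simp
    qed
    ultimately show "{Delta0 e | e. e \<in> Parents} \<union> {D. \<exists>e\<in>Parents. \<exists>e'\<in>Anc e. is_Delta e' e D}
        \<subseteq> {P \<in> PD Parents. ev P = 0}"
      using tree_gens_subset by blast
  qed
  then show "P \<in> tree_ideal \<Longrightarrow> ev P = 0" by blast
qed

section \<open>Residual coordinates\<close>

text \<open>Modulo \<open>J\<close> the coordinates along the path to \<open>p\<close> are scalars.
  A node \<open>e\<close> off the path branches from it at some \<open>e'\<close>, through a child
  \<open>c'\<close> instead of the child \<open>c\<close> towards \<open>p\<close>; the relation for
  \<open>e'\<close> and \<open>e\<close> then reads (lb c - lb c') X_e = X_{e'} T modulo
  \<open>J\<close>. The difference of labels is invertible and the right side involves only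
  ancestors of \<open>e\<close>, so induction on the depth expresses X_e through
  \<open>XPar p\<close>.\<close>

lemma residual_coordinate:
  assumes D: "D \<subseteq> Parents" "\<And>e. e \<in> D \<Longrightarrow> Anc e \<subseteq> D"
    and p: "p \<in> N" "Anc p \<subseteq> D" "\<And>e. e \<in> D \<Longrightarrow> (p, e) \<notin> le"
    and J: "ideal_in (PD D) J" and hJ: "h \<in> J"
    and chain_J: "\<And>e' c. c \<in> Child e' \<Longrightarrow> (c, p) \<in> le \<Longrightarrow> XPar e' - cst [:lb c:] \<in> J"
    and IJ: "tree_ideal \<inter> PD D \<subseteq> J"
    and P: "P \<in> PD D"
  shows "\<exists>g. P - scalar_hom.peval (XPar p) g \<in> J"
proof -
  note B = polys_in_subring[of "insert None (Some ` D)"]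
  define OK where "OK P \<longleftrightarrow> (\<exists>g. P - scalar_hom.peval (XPar p) g \<in> J)"
    for P
  have Xp: "XPar p \<in> PD D" by (intro XPar_in p)
  have G_in: "scalar_hom.peval (XPar p) g \<in> PD D" for g
    by (rule scalar_hom.peval_in_subring[OF B Xp cst_in])
  have OK_add: "OK (P + Q)" if ok: "OK P" "OK Q" for P Q
  proof -
    obtain g g' where "P - scalar_hom.peval (XPar p) g \<in> J" "Q - scalar_hom.peval (XPar p) g' \<in> J"
      using ok unfolding OK_def by blast
    from ideal_inD(3)[OF J this] have "(P + Q) - scalar_hom.peval (XPar p) (g + g') \<in> J"
      by (simp add: scalar_hom.peval_add algebra_simps)
    then show ?thesis unfolding OK_def by blast
  qed
  have OK_mult: "OK (P * Q)" if "OK P" "OK Q" "Q \<in> PD D" for P Q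
  proof -
    obtain g g' where g: "P - scalar_hom.peval (XPar p) g \<in> J" "Q - scalar_hom.peval (XPar p) g' \<in> J"
      using \<open>OK P\<close> \<open>OK Q\<close> unfolding OK_def by blast
    have "Q * (P - scalar_hom.peval (XPar p) g) + scalar_hom.peval (XPar p) g * (Q - scalar_hom.peval (XPar p) g') \<in> J"
      using g \<open>Q \<in> PD D\<close> G_in by (intro ideal_inD(3,4)[OF J])
    then have "P * Q - scalar_hom.peval (XPar p) (g * g') \<in> J"
      by (simp add: scalar_hom.peval_mult algebra_simps)
    then show ?thesis unfolding OK_def by blast
  qed
  have OK_cong: "OK P" if "OK Q" "P - Q \<in> J" for P Q
  proof -
    obtain g where "Q - scalar_hom.peval (XPar p) g \<in> J" using \<open>OK Q\<close>
      unfolding OK_def by blast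
    from ideal_inD(3)[OF J \<open>P - Q \<in> J\<close> this] show ?thesis unfolding OK_def by auto
  qed
  have OK_scalar: "OK (cst [:a:])" for a
    unfolding OK_def
      by (intro exI[of _ "[:a:]"]) (simp add: scalar_hom.peval_const ideal_inD(2)[OF J])
  have OK_cst: "OK (cst a)" for a
  proof (cases a)
    case (pCons a0 k)
    have "a = [:a0:] + [:0, 1:] * k" unfolding pCons by simp
    then have "cst a - cst [:a0:] = cst k * h" unfolding h_def
      by (simp only: cst_simps mult_ac) simp
    then have "cst a - cst [:a0:] \<in> J" using ideal_inD(4)[OF J cst_in hJ] by simp
    then show ?thesis using OK_cong OK_scalar by blast
  qed
  have OK_XPar: "OK (XPar e)" if "(e, p) \<in> le" for e
  proof (cases "e = p")
    case True
    then show ?thesis unfolding OK_def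
      by (intro exI[of _ "[:0, 1:]"]) (simp only: scalar_hom.peval_var diff_self ideal_inD(2)[OF J])
  next
    case False
    then have "e \<in> Anc p" using that by (simp add: Anc_iff)
    then obtain c where "c \<in> Child e" "(c, p) \<in> le" using child_below_exists by blast
    from chain_J[OF this] show ?thesis using OK_cong OK_scalar by blast
  qed
  have OK_polys: "OK P"
    if "P \<in> polys_in (insert None (Some ` W))" "W \<subseteq> D" "\<And>e. e \<in> W \<Longrightarrow> OK (Xv e)" for P W
    using that(1)
  proof (induction rule: polys_in_induct)
    case (cst a) then show ?case using OK_cst unfolding cst_def .
  next
    case (var v)
    have "OK (var None)"
      using OK_XPar[OF root_le[OF p(1)]] by (simp add: XPar_def)
    then show ?case using var that(3) unfolding Xv_def var_def[symmetric] by (cases v) auto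
  next
    case (add P Q) then show ?case using OK_add by blast
  next
    case (mult P Q) then show ?case using OK_mult PD_mono[OF that(2)] by blast
  qed
  have OK_Xv: "OK (Xv e)" if "e \<in> D" for e
    using that
  proof (induction "card (Anc e)" arbitrary: e rule: less_induct)
    case less
    have eP: "e \<in> Parents" and eN: "e \<in> N" using less.prems D(1) Parents_in_N by auto
    show ?case
    proof (cases "(e, p) \<in> le")
      case True
      then have "e \<in> Anc p" using p(3)[OF less.prems] le_refl[OF p(1)] by (auto simp: Anc_iff)
      then obtain c where c: "c \<in> Child e" "(c, p) \<in> le" using child_below_exists by blast
      then have "XPar c = Xv e" using Par_Child[OF c(1)] by (simp add: XPar_def)
      then show ?thesis using OK_XPar[OF c(2)] by simp
    next
      case False
      obtain e' c c' where m: "e' \<in> Anc p" "e' \<in> Anc e" "c \<in> Child e'" "c' \<in> Child e'" "c \<noteq> c'"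
        "(c, p) \<in> le" "(c', e) \<in> le"
        using incomparable_meet[OF eN p(1) p(3)[OF less.prems] False] by blast
      obtain T where T: "T \<in> PD (Anc e)" "(XPar e' - cst [:lb c':]) * Xv e - Xv e' * T \<in> tree_ideal"
        using Delta_in[OF eP m(4,7)] by blast
      have AD: "Anc e \<subseteq> D" by (rule D(2)[OF less.prems])
      have e'N: "e' \<in> N" "Anc e' \<subseteq> D" "e' \<in> D"
        using Par_Child[OF m(3)] D(2) m(2) AD by auto
      have small: "OK (Xv x)" if "x \<in> Anc e" for x
      proof -
        have "x \<notin> Anc x" "Anc x \<subseteq> Anc e"
          using that le_trans le_antisym by (auto simp: Anc_iff)
        then have "Anc x \<subset> Anc e" using that by blast
        then have "card (Anc x) < card (Anc e)" by (rule psubset_card_mono[OF finite_Anc])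
        then show ?thesis using less.hyps that AD by blast
      qed
      have T_in: "T \<in> PD D" using T(1) PD_mono[OF AD] by blast
      have "OK T" using OK_polys[OF T(1) AD small] .
      then have "OK (Xv e' * T)" using OK_mult small[OF m(2)] T_in by blast
      then have okT: "OK (cst [:inverse (lb c - lb c'):] * (Xv e' * T))"
        using OK_mult OK_scalar e'N T_in by (blast intro: polys_in_mult Xv_in)
      let ?k = "lb c - lb c'"
      have k: "?k \<noteq> 0" using lb_distinct[OF m(3,4,5)] by simp
      have Delta_J: "(XPar e' - cst [:lb c':]) * Xv e - Xv e' * T \<in> J"
        using T(2) IJ e'N less.prems T_in
        by (blast intro: polys_in_mult polys_in_diff XPar_in cst_in Xv_in)
      have chJ: "Xv e * (XPar e' - cst [:lb c:]) \<in> J"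
        by (intro ideal_inD(4)[OF J] chain_J m Xv_in less.prems)
      \<comment> \<open>In the relation for \<open>e'\<close> and \<open>e\<close> the variable
        \<open>XPar e'\<close> is replaced by the scalar \<open>lb c\<close> that it equals modulo
        \<open>J\<close>.\<close>
      have key: "cst [:?k:] * Xv e - Xv e' * T =
          ((XPar e' - cst [:lb c':]) * Xv e - Xv e' * T) - Xv e * (XPar e' - cst [:lb c:])"
      proof -
        have eq: "cst [:?k:] = cst [:lb c:] - cst [:lb c':]"
          using scalar_hom.f_add[of ?k "lb c'"]
          unfolding diff_add_cancel by (rule eq_diff_eq[THEN iffD2, OF sym])
        show ?thesis unfolding eq by (simp add: algebra_simps)
      qed
      have "cst [:?k:] * Xv e - Xv e' * T \<in> J"
        unfolding key by (rule ideal_in_diff[OF J B Delta_J chJ])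
      then have "cst [:inverse ?k:] * (cst [:?k:] * Xv e - Xv e' * T) \<in> J"
        by (intro ideal_inD(4)[OF J] cst_in)
      then have "Xv e - cst [:inverse ?k:] * (Xv e' * T) \<in> J"
        unfolding right_diff_distrib cst_inverse_cancel[OF k] .
      then show ?thesis using OK_cong okT by blast
    qed
  qed
  have "OK P" using OK_polys[OF P order_refl OK_Xv] .
  then show ?thesis unfolding OK_def .
qed

lemma resid_peval:
  assumes "p \<in> N" "resid (pcompose (yv p) s) l"
  shows "resid (pcompose (ev (scalar_hom.peval (XPar p) g)) s) (pcompose g l)"
proof (induction g)
  case 0
  then show ?case unfolding resid_def
    by (intro exI[of _ 0]) (simp add: scalar_hom.peval_simps ev_simps)
next
  case (pCons a g)
  have "resid (cc a + pcompose (yv p) s * pcompose (ev (scalar_hom.peval (XPar p) g)) s) ([:a:] + l * pcompose g l)"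
    by (intro resid_add resid_mult resid_cc assms pCons)
  then show ?case
    by (simp add: scalar_hom.peval_simps ev_simps ev_XPar[OF assms(1)] pcompose_add pcompose_mult pcompose_pCons)
qed

text \<open>Modulo \<open>J\<close> the polynomial is g(\<open>XPar p\<close>), with residue g(d + c
  t). As c is nonzero, this vanishes only for g = 0. So an ideal whose elements have zero residue
  and which contains h, the relations and the path equations is the whole kernel of the residue
  map.\<close>

lemma residue_zero_in_ideal:
  assumes D: "D \<subseteq> Parents" "\<And>e. e \<in> D \<Longrightarrow> Anc e \<subseteq> D"
    and p: "p \<in> N" "Anc p \<subseteq> D" "\<And>e. e \<in> D \<Longrightarrow> (p, e) \<notin> le"
    and J: "ideal_in (PD D) J" and hJ: "h \<in> J"
    and chain_J: "\<And>e' c. c \<in> Child e' \<Longrightarrow> (c, p) \<in> le \<Longrightarrow> XPar e' - cst [:lb c:] \<in> J"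
    and IJ: "tree_ideal \<inter> PD D \<subseteq> J"
    and P: "P \<in> PD D"
    and s: "chart_at p s" and PJ: "resid (pcompose (ev P) s) 0"
    and J0: "\<And>x. x \<in> J \<Longrightarrow> resid (pcompose (ev x) s) 0"
  shows "P \<in> J"
proof -
  obtain g where g: "P - scalar_hom.peval (XPar p) g \<in> J"
    using residual_coordinate[OF D p J hJ chain_J IJ P] by blast
  obtain d c where dc: "c \<noteq> 0" "resid (pcompose (yv p) s) [:d, c:]"
    using s unfolding chart_at_def by blast
  have "resid (pcompose (ev P) s - pcompose (ev (P - scalar_hom.peval (XPar p) g)) s) (0 - 0)"
    by (intro resid_diff PJ J0 g)
  then have "resid (pcompose (ev (scalar_hom.peval (XPar p) g)) s) 0"
    by (simp add: ev_simps pcompose_diff)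
  then have "pcompose g [:d, c:] = 0"
    using resid_peval[OF p(1) dc(2)] resid_unique by blast
  then have "g = 0" using dc(1) by (simp add: pcompose_eq_0_iff)
  then show ?thesis using g by (simp add: scalar_hom.peval_simps)
qed

end

lemma poly_eq_sum_atMost:
  fixes U :: "'b::comm_ring_1 poly"
  assumes "degree U \<le> n" shows "poly U x = (\<Sum>i\<le>n. coeff U i * x ^ i)"
proof -
  have "(\<Sum>i\<le>n. coeff U i * x ^ i) = (\<Sum>i\<le>degree U. coeff U i * x ^ i)"
    using assms by (intro sum.mono_neutral_right) (auto simp: coeff_eq_0)
  then show ?thesis by (simp add: poly_altdef)
qed

context fine_labelled_rooted_tree
begin

section \<open>The kernel of the evaluation\<close>

lemma ev_resid_exists:
  assumes P: "P \<in> PD D" and s: "chart_at p s"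
    and D: "D \<subseteq> Parents" "\<And>e. e \<in> D \<Longrightarrow> (p, e) \<notin> le"
  shows "\<exists>g. resid (pcompose (ev P) s) g"
  using P
proof (induction rule: polys_in_induct)
  case (cst a)
  have "resid (pcompose (ev (cst a)) s) [:coeff a 0:]" using resid_const by (simp add: ev_simps)
  then show ?case unfolding cst_def by blast
next
  case (var v)
  have "\<exists>g. resid (pcompose (ev (var v)) s) g"
  proof (cases v)
    case None
    obtain a c where "s = fract_poly [:a, c:]" using s unfolding chart_at_def by blast
    moreover have "pcompose [:0, 1:] s = s" by (simp add: pcompose_pCons)
    ultimately show ?thesis unfolding None using integral_imp_resid by (simp add: ev_simps)
  next
    case (Some e)
    then have "e \<in> Parents" "(p, e) \<notin> le" using var D by auto
    then show ?thesis using s unfolding Some Xv_def[symmetric] chart_at_def by (simp add: ev_simps)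
  qed
  then show ?case unfolding var_def .
next
  case (add P P')
  then show ?case using resid_add by (simp add: ev_simps pcompose_add) blast
next
  case (mult P P')
  then show ?case using resid_mult by (simp add: ev_simps pcompose_mult) blast
qed

text \<open>The residue is that of \<open>Q p\<close>: a nonzero constant from \<open>rv p\<close>
  times a product of nonconstant affine functions. Thus X_p has a pole of order exactly one along h
  = 0 in this chart.\<close>

lemma resid_HX_zv:
  assumes s: "chart_at p s" and p: "p \<in> N"
  shows "\<exists>g. g \<noteq> 0 \<and> resid (HX * pcompose (zv p) s) g"
proof -
  obtain d c0 where y: "c0 \<noteq> 0" "resid (pcompose (yv p) s) [:d, c0:]"
    using s unfolding chart_at_def by blast
  obtain k where k: "k \<noteq> 0" "resid (pcompose (rv p) s) [:k:]"
    using resid_rv[of p s p] p le_refl s unfolding chart_at_def by blast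
  have "resid (pcompose (yv p - cc (lb g)) s) ([:d, c0:] - [:lb g:])" for g
    using resid_diff[OF y(2) resid_cc[of "lb g"]] by (simp only: pcompose_diff pcompose_const)
  then have "resid (\<Prod>g\<in>Child p. pcompose (yv p - cc (lb g)) s) (\<Prod>g\<in>Child p. [:d, c0:] - [:lb g:])"
    by (intro resid_prod)
  from resid_mult[OF this k(2)]
  have "resid (HX * pcompose (zv p) s) ((\<Prod>g\<in>Child p. [:d, c0:] - [:lb g:]) * [:k:])"
    using arg_cong[OF HX_zv[of p], of "\<lambda>f. pcompose f s"]
    by (simp only: pcompose_mult pcompose_HX pcompose_prod)
  moreover have "[:d, c0:] - [:lb g:] \<noteq> 0" for g using y(1) by simp
  then have "(\<Prod>g\<in>Child p. [:d, c0:] - [:lb g:]) * [:k:] \<noteq> 0"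
    using k(1) by (simp only: mult_eq_0_iff prod_zero_iff[OF finite_Child]) auto
  ultimately show ?thesis by blast
qed

lemma univariate_representation:
  assumes "P \<in> PD D"
  shows "\<exists>U. (\<forall>i. coeff U i \<in> PD (D - {p})) \<and> P = poly U (Xv p)"
  using assms
proof (induction rule: polys_in_induct)
  case (cst a)
  show ?case
    by (intro exI[of _ "[:cst a:]"]) (auto simp: coeff_pCons cst_in polys_in_0 cst_def[symmetric] split: nat.splits)
next
  case (var v)
  have "\<exists>U. (\<forall>i. coeff U i \<in> PD (D - {p})) \<and> var v = poly U (Xv p)"
  proof (cases "v = Some p")
    case True
    then show ?thesis
      by (intro exI[of _ "[:0, 1:]"]) (auto simp: coeff_pCons polys_in_0 polys_in_1 Xv_def split: nat.splits)
  next
    case False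
    then have "var v \<in> PD (D - {p})" using var by (intro var_in) auto
    then show ?thesis
      by (intro exI[of _ "[:var v:]"]) (auto simp: coeff_pCons polys_in_0 split: nat.splits)
  qed
  then show ?case unfolding var_def .
next
  case (add P P')
  then obtain U U' where "\<forall>i. coeff U i \<in> PD (D - {p})" "P = poly U (Xv p)"
    "\<forall>i. coeff U' i \<in> PD (D - {p})" "P' = poly U' (Xv p)" by blast
  then show ?case by (intro exI[of _ "U + U'"]) (simp add: polys_in_add)
next
  case (mult P P')
  then obtain U U' where "\<forall>i. coeff U i \<in> PD (D - {p})" "P = poly U (Xv p)"
    "\<forall>i. coeff U' i \<in> PD (D - {p})" "P' = poly U' (Xv p)" by blast
  then show ?case
    by (intro exI[of _ "U * U'"])
      (auto simp: coeff_mult intro!: subring_set_sum[OF polys_in_subring] polys_in_mult)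
qed

text \<open>In the variable X_0 alone the evaluation is the inclusion of C[h][x] into K[x].\<close>

lemma kernel_base:
  assumes "P \<in> PD {}" "ev P = 0" shows "P = 0"
proof -
  have "\<exists>u. P = cst_hom.peval (var None) u"
    using assms(1)
  proof (induction rule: polys_in_induct)
    case (cst a)
    show ?case
      unfolding cst_def[symmetric] by (rule exI[of _ "[:a:]"]) (rule cst_hom.peval_const[symmetric])
  next
    case (var v)
    then show ?case by (intro exI[of _ "[:0, 1:]"]) (simp only: cst_hom.peval_var var_def, simp)
  next
    case (add P P')
    then show ?case using cst_hom.peval_add by metis
  next
    case (mult P P')
    then show ?case using cst_hom.peval_mult by metis
  qed
  then obtain u where u: "P = cst_hom.peval (var None) u" by blast
  have "ev (cst_hom.peval (var None) u) = fract_poly u"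
    by (induction u) (simp_all add: cst_hom.peval_simps ev_simps map_poly_pCons)
  then have "u = 0" using assms(2) u by simp
  then show ?thesis using u by (simp add: cst_hom.peval_simps)
qed

text \<open>Induction on the degree in X_p. The leading coefficient has zero residue in the chart at
  \<open>p\<close>, hence lies in the conductor \<open>J\<close>; the relations then trade the
  leading term for one of lower degree in X_p.\<close>

lemma kernel_step:
  assumes D: "D \<subseteq> Parents" "\<And>e. e \<in> D \<Longrightarrow> Anc e \<subseteq> D"
    and p: "p \<in> Parents" "Anc p \<subseteq> D" "\<And>e. e \<in> D \<Longrightarrow> (p, e) \<notin> le"
    and IH: "\<And>P. P \<in> PD D \<Longrightarrow> ev P = 0 \<Longrightarrow> P \<in> tree_ideal"
    and U: "\<And>i. coeff U i \<in> PD D" "degree U \<le> n" "ev (poly U (Xv p)) = 0"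
  shows "poly U (Xv p) \<in> tree_ideal"
  using U
proof (induction n arbitrary: U)
  case 0
  then obtain u0 where "U = [:u0:]" using degree_eq_zeroE by blast
  then show ?case using 0 IH[of u0]
    by (metis coeff_pCons_0 mult_zero_right poly_0 poly_pCons add_0_right)
next
  case (Suc n)
  note I = tree_ideal_ideal
  note B = polys_in_subring[of "insert None (Some ` Parents)"]
  have pN: "p \<in> N" using p(1) Parents_in_N by blast
  have DP: "PD D \<subseteq> PD Parents" by (rule PD_mono[OF D(1)])
  have Xp: "Xv p \<in> PD Parents" by (rule Xv_in[OF p(1)])
  obtain s where s: "chart_at p s" using chart_exists[OF pN] by blast
  obtain q where q: "q \<noteq> 0" "resid (HX * pcompose (zv p) s) q" using resid_HX_zv[OF s pN]
    by blast
  define P1 where "P1 = coeff U (Suc n)"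
  \<comment> \<open>the conductor: the coefficients that absorb one factor \<open>X\<^sub>p\<close> modulo the relations\<close>
  define J where "J = {P \<in> PD D. \<exists>w\<in>PD D. P * Xv p - w \<in> tree_ideal}"
  have J: "ideal_in (PD D) J"
    unfolding ideal_in_def
  proof (intro conjI ballI)
    show "J \<subseteq> PD D" unfolding J_def by blast
    show "0 \<in> J" unfolding J_def using ideal_inD(2)[OF I] polys_in_0
      by (auto intro!: bexI[of _ 0])
  next
    fix x y assume "x \<in> J" "y \<in> J"
    then obtain w w' where w: "x \<in> PD D" "y \<in> PD D" "w \<in> PD D" "w' \<in> PD D"
      "x * Xv p - w \<in> tree_ideal" "y * Xv p - w' \<in> tree_ideal" unfolding J_def by blast
    have "(x + y) * Xv p - (w + w') \<in> tree_ideal"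
      using ideal_inD(3)[OF I w(5,6)] by (simp add: algebra_simps)
    then show "x + y \<in> J" unfolding J_def using w polys_in_add by blast
  next
    fix b x assume "b \<in> PD D" "x \<in> J"
    then obtain w where w: "x \<in> PD D" "w \<in> PD D" "x * Xv p - w \<in> tree_ideal"
      unfolding J_def by blast
    have "b * (x * Xv p - w) \<in> tree_ideal"
      using \<open>b \<in> PD D\<close> DP by (intro ideal_inD(4)[OF I _ w(3)]) blast
    then have "(b * x) * Xv p - b * w \<in> tree_ideal" by (simp add: algebra_simps)
    then show "b * x \<in> J" unfolding J_def using w \<open>b \<in> PD D\<close> polys_in_mult
      by blast
  qed
  have "h \<in> J"
    unfolding J_def using h_in Q_in[OF pN p(2)] Delta0_in[OF p(1)] by blast
  have chJ: "XPar e' - cst [:lb c:] \<in> J" if c: "c \<in> Child e'" "(c, p) \<in> le" for e' c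
  proof -
    have anc: "e' \<in> Anc p"
      unfolding Anc_iff using le_trans[of e' c p] le_antisym[of e' c] Par_Child[OF c(1)] c(2)
        by blast
    obtain T where T: "T \<in> PD (Anc p)" "(XPar e' - cst [:lb c:]) * Xv p - Xv e' * T \<in> tree_ideal"
      using Delta_in[OF p(1) c] by blast
    have "e' \<in> D" using anc p(2) by blast
    moreover have "T \<in> PD D" using T(1) PD_mono[OF p(2)] by blast
    moreover have "e' \<in> N" using Par_Child[OF c(1)] by blast
    ultimately have "Xv e' * T \<in> PD D" "XPar e' - cst [:lb c:] \<in> PD D"
      using D(2) by (blast intro: polys_in_mult Xv_in polys_in_diff XPar_in cst_in)+
    then show ?thesis unfolding J_def using T(2) by blast
  qed
  have IJ: "tree_ideal \<inter> PD D \<subseteq> J"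
  proof
    fix x assume x: "x \<in> tree_ideal \<inter> PD D"
    then have "Xv p * x \<in> tree_ideal" by (intro ideal_inD(4)[OF I Xp]) blast
    then have "x * Xv p - 0 \<in> tree_ideal" by (simp add: mult.commute)
    then show "x \<in> J" unfolding J_def using x polys_in_0 by blast
  qed
  \<comment> \<open>If x X_p equals w in K[x] with w regular, then h w has residue zero. It is also
    x times h X_p, whose second factor has nonzero residue, so x has residue zero.\<close>
  have J0: "resid (pcompose (ev x) s) 0" if "x \<in> J" for x
  proof -
    obtain w where w: "x \<in> PD D" "w \<in> PD D" "x * Xv p - w \<in> tree_ideal"
      using \<open>x \<in> J\<close> unfolding J_def by blast
    have "ev x * zv p = ev w" using ev_tree_ideal[OF w(3)] by (simp add: ev_simps)
    then have "pcompose (ev x) s * (HX * pcompose (zv p) s) = HX * pcompose (ev w) s"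
      by (metis mult.left_commute pcompose_mult)
    moreover obtain gw where "resid (pcompose (ev w) s) gw"
      using ev_resid_exists[OF w(2) s D(1) p(3)] by blast
    then have "resid (HX * pcompose (ev w) s) 0" using resid_mult[OF resid_HX] by fastforce
    moreover obtain gx where gx: "resid (pcompose (ev x) s) gx"
      using ev_resid_exists[OF w(1) s D(1) p(3)] by blast
    ultimately have "gx * q = 0" using resid_mult[OF gx q(2)] resid_unique by metis
    then show ?thesis using gx q(1) by simp
  qed
  \<comment> \<open>The relation is multiplied by \<open>HX ^ Suc n\<close>, one h for each possible
    factor X_p. Every term of degree at most \<open>n\<close> then retains a factor h, so modulo h
    only the leading coefficient times a power of \<open>q\<close> is left.\<close>
  have "resid (pcompose (ev P1) s) 0"
  proof -
    let ?z = "pcompose (zv p) s" and ?u = "\<lambda>i. pcompose (ev (coeff U i)) s"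
    have "\<exists>g. resid (?u i) g" for i using ev_resid_exists[OF Suc.prems(1) s D(1) p(3)]
      by blast
    then obtain g where g: "\<And>i. resid (?u i) (g i)" by metis
    have "0 = pcompose (ev (\<Sum>i\<le>Suc n. coeff U i * Xv p ^ i)) s"
      using Suc.prems(3) poly_eq_sum_atMost[OF Suc.prems(2)] by simp
    also have "\<dots> = (\<Sum>i\<le>Suc n. ?u i * ?z ^ i)"
    proof -
      have pw: "pcompose (f ^ i) s = pcompose f s ^ i" for f :: KX and i
        by (induction i) (simp_all add: pcompose_mult)
      show ?thesis by (simp only: ev_sum ev_simps ev_power pcompose_sum pcompose_mult pw)
    qed
    finally have "0 = HX ^ Suc n * (\<Sum>i\<le>Suc n. ?u i * ?z ^ i)" by simp
    also have "\<dots> = (\<Sum>i\<le>Suc n. HX ^ (Suc n - i) * (?u i * (HX * ?z) ^ i))"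
      unfolding sum_distrib_left
    proof (rule sum.cong[OF refl])
      fix i assume "i \<in> {..Suc n}"
      then have "HX ^ Suc n = HX ^ (Suc n - i) * HX ^ i" by (simp flip: power_add del: power_Suc)
      then show "HX ^ Suc n * (?u i * ?z ^ i) = HX ^ (Suc n - i) * (?u i * (HX * ?z) ^ i)"
        unfolding power_mult_distrib by (simp only: mult_ac)
    qed
    also have "\<dots> = (\<Sum>i\<le>n. HX ^ (Suc n - i) * (?u i * (HX * ?z) ^ i)) + ?u (Suc n) * (HX * ?z) ^ Suc n"
      by (simp only: sum.atMost_Suc diff_self_eq_0 power_0 mult_1_left)
    finally have eq: "0 = (\<Sum>i\<le>n. HX ^ (Suc n - i) * (?u i * (HX * ?z) ^ i)) + ?u (Suc n) * (HX * ?z) ^ Suc n" .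
    have "resid (\<Sum>i\<in>F. HX ^ (Suc n - i) * (?u i * (HX * ?z) ^ i)) 0"
      if "F \<subseteq> {..n}" "finite F" for F
      using that(2,1)
    proof (induction F rule: finite_induct)
      case empty
      then show ?case unfolding resid_def by (intro exI[of _ 0]) simp
    next
      case (insert i F)
      then have "Suc n - i = Suc (n - i)" by auto
      have "resid (HX ^ (Suc n - i) * (?u i * (HX * ?z) ^ i)) (0 ^ (Suc n - i) * (g i * q ^ i))"
        by (intro resid_mult resid_power resid_HX g q)
      then have "resid (HX ^ (Suc n - i) * (?u i * (HX * ?z) ^ i)) 0"
        unfolding \<open>Suc n - i = Suc (n - i)\<close> by simp
      from resid_add[OF this insert.IH] show ?case
        using insert by (simp del: power_Suc)
    qed
    then have "resid (\<Sum>i\<le>n. HX ^ (Suc n - i) * (?u i * (HX * ?z) ^ i)) 0" by blast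
    from resid_add[OF this resid_mult[OF g[of "Suc n"] resid_power[OF q(2), of "Suc n"]]]
    have "resid 0 (0 + g (Suc n) * q ^ Suc n)" unfolding eq[symmetric] .
    moreover have "resid 0 0" unfolding resid_def by (intro exI[of _ 0]) simp
    ultimately have "0 + g (Suc n) * q ^ Suc n = 0" by (rule resid_unique)
    then have "g (Suc n) = 0" using q(1) by simp
    then show ?thesis using g[of "Suc n"] unfolding P1_def by simp
  qed
  then have "P1 \<in> J"
    unfolding P1_def
    using residue_zero_in_ideal[OF D pN p(2,3) J \<open>h \<in> J\<close> chJ IJ Suc.prems(1) s _ J0] by blast
  then obtain w where w: "w \<in> PD D" "P1 * Xv p - w \<in> tree_ideal" unfolding J_def by blast
  \<comment> \<open>The leading term P1 X_p^(n+1) is exchanged for w X_p^n; the two differ by X_p^n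
    times a relation.\<close>
  define U' where "U' = U - monom P1 (Suc n) + monom w n"
  have coeff_U': "coeff U' i \<in> PD D" for i
    unfolding U'_def using Suc.prems(1) w(1) P1_def
    by (auto intro!: polys_in_add polys_in_diff polys_in_0)
  have "degree U' \<le> n"
  proof (rule degree_le, intro allI impI)
    fix i assume "n < i"
    then show "coeff U' i = 0"
      using Suc.prems(2) by (cases "i = Suc n") (auto simp: U'_def P1_def coeff_eq_0)
  qed
  have diff: "poly U (Xv p) - poly U' (Xv p) = Xv p ^ n * (P1 * Xv p - w)"
    by (simp add: U'_def poly_monom algebra_simps)
  have "Xv p ^ n * (P1 * Xv p - w) \<in> tree_ideal"
    by (intro ideal_inD(4)[OF I _ w(2)] subring_set_power[OF B Xp])
  then have diff_in: "poly U (Xv p) - poly U' (Xv p) \<in> tree_ideal" unfolding diff .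
  then have "ev (poly U' (Xv p)) = 0"
    using ev_tree_ideal Suc.prems(3) by (fastforce simp: ev_simps)
  then have "poly U' (Xv p) \<in> tree_ideal"
    using Suc.IH[OF coeff_U' \<open>degree U' \<le> n\<close>] by blast
  from ideal_inD(3)[OF I diff_in this] show ?case by simp
qed

text \<open>A node of \<open>D\<close> with the most ancestors has no other node of \<open>D\<close>
  above it, so removing it leaves a set closed under ancestors on which its chart is regular, as
  \<open>kernel_step\<close> requires.\<close>

lemma kernel_downclosed:
  assumes "D \<subseteq> Parents" "\<And>e. e \<in> D \<Longrightarrow> Anc e \<subseteq> D" "P \<in> PD D" "ev P = 0"
  shows "P \<in> tree_ideal"
  using assms
proof (induction "card D" arbitrary: D P rule: less_induct)
  case less
  have finD: "finite D"
    using less.prems(1) finite_nodes Parents_in_N by (meson finite_subset subsetI)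
  show ?case
  proof (cases "D = {}")
    case True
    then have "P = 0" using kernel_base less.prems(3,4) by blast
    then show ?thesis using ideal_inD(2)[OF tree_ideal_ideal] by simp
  next
    case False
    have "Max ((\<lambda>y. card (Anc y)) ` D) \<in> (\<lambda>y. card (Anc y)) ` D"
      using finD False by (intro Max_in) auto
    then obtain p where p: "p \<in> D" "Max ((\<lambda>y. card (Anc y)) ` D) = card (Anc p)"
      by blast
    have top: "(p, e) \<notin> le" if e: "e \<in> D - {p}" for e
    proof
      assume pe: "(p, e) \<in> le"
      have "Anc p \<subseteq> Anc e" "p \<in> Anc e" "p \<notin> Anc p"
        using pe e le_trans le_antisym by (auto simp: Anc_iff)
      then have "Anc p \<subset> Anc e" by blast
      then have "card (Anc p) < card (Anc e)" by (rule psubset_card_mono[OF finite_Anc])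
      moreover have "card (Anc e) \<le> Max ((\<lambda>y. card (Anc y)) ` D)"
        using e finD by (intro Max_ge) auto
      ultimately show False using p(2) by simp
    qed
    have closed: "Anc e \<subseteq> D - {p}" if "e \<in> D" for e
    proof -
      have "p \<notin> Anc e"
      proof
        assume "p \<in> Anc e"
        then have "(p, e) \<in> le" "p \<noteq> e" by (auto simp: Anc_iff)
        then show False using top[of e] that by blast
      qed
      then show ?thesis using less.prems(2)[OF that] by blast
    qed
    have "card (D - {p}) < card D" using finD p(1) by (simp add: card_gt_0_iff False)
    then have IH: "\<And>P. P \<in> PD (D - {p}) \<Longrightarrow> ev P = 0 \<Longrightarrow> P \<in> tree_ideal"
      using less.hyps[of "D - {p}"] less.prems(1) closed by blast
    obtain U where U: "\<forall>i. coeff U i \<in> PD (D - {p})" "P = poly U (Xv p)"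
      using univariate_representation[OF less.prems(3)] by blast
    have "poly U (Xv p) \<in> tree_ideal"
    proof (rule kernel_step[of "D - {p}" p U "degree U"])
      show "D - {p} \<subseteq> Parents" using less.prems(1) by blast
      show "p \<in> Parents" using less.prems(1) p(1) by blast
      show "ev (poly U (Xv p)) = 0" using less.prems(4) U(2) by simp
    qed (use closed p(1) top IH U(1) in auto)
    then show ?thesis using U(2) by simp
  qed
qed

lemma kernel_iff: "P \<in> PD Parents \<Longrightarrow> ev P = 0 \<longleftrightarrow> P \<in> tree_ideal"
  using kernel_downclosed[of Parents P] ev_tree_ideal Anc_sub_Parents by blast

section \<open>The fiber over the origin is reduced\<close>

text \<open>The ideal of the functions vanishing on the part of the fiber \<open>h = 0\<close> that lies over the path to \<open>p\<close>.\<close>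

definition node_ideal :: "'a \<Rightarrow> 'a tree_poly set" where
  "node_ideal p = Idl\<^bsub>poly_ring_tree\<^esub>
    (tree_ideal \<union> {h} \<union> {XPar e - cst [:lb c:] | e c. c \<in> Child e \<and> (c, p) \<in> le})"

lemma node_gens_subset:
  "tree_ideal \<union> {h} \<union> {XPar e - cst [:lb c:] | e c. c \<in> Child e \<and> (c, p) \<in> le} \<subseteq> PD Parents"
proof -
  have "XPar e - cst [:lb c:] \<in> PD Parents" if "c \<in> Child e" for e c
    using Par_Child[OF that] by (intro polys_in_diff XPar_in cst_in Anc_sub_Parents) blast
  then show ?thesis using ideal_inD(1)[OF tree_ideal_ideal] h_in by blast
qed

lemma node_ideal_ideal: "ideal_in (PD Parents) (node_ideal p)"
  and node_gens_in: "tree_ideal \<union> {h} \<union> {XPar e - cst [:lb c:] | e c. c \<in> Child e \<and> (c, p) \<in> le} \<subseteq> node_ideal p"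
proof -
  interpret cring poly_ring_tree by (rule poly_ring_tree_cring)
  show "ideal_in (PD Parents) (node_ideal p)"
    unfolding ideal_in_iff[symmetric] node_ideal_def
    by (rule genideal_ideal) (use node_gens_subset poly_ring_tree_simps(1) in simp)
  show "tree_ideal \<union> {h} \<union> {XPar e - cst [:lb c:] | e c. c \<in> Child e \<and> (c, p) \<in> le} \<subseteq> node_ideal p"
    unfolding node_ideal_def
      by (rule genideal_self) (use node_gens_subset poly_ring_tree_simps(1) in simp)
qed

lemma node_ideal_minimal:
  assumes "ideal_in (PD Parents) J" "tree_ideal \<subseteq> J" "h \<in> J"
    "\<And>e c. c \<in> Child e \<Longrightarrow> (c, p) \<in> le \<Longrightarrow> XPar e - cst [:lb c:] \<in> J"
  shows "node_ideal p \<subseteq> J"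
proof -
  interpret cring poly_ring_tree by (rule poly_ring_tree_cring)
  show ?thesis
    unfolding node_ideal_def
    by (rule genideal_minimal) (use assms ideal_in_iff in auto)
qed

text \<open>In the chart at a leaf every element has a residue, and
  \<open>residue_zero_in_ideal\<close> shows that the node ideal is the kernel of a residue map into
  C[t], where there are no nilpotents.\<close>

lemma leaf_node_ideal_radical:
  assumes p: "p \<in> N" "p \<notin> Parents" and P: "P \<in> PD Parents" "P ^ n \<in> node_ideal p"
  shows "P \<in> node_ideal p"
proof -
  have leaf: "(p, e) \<notin> le" if "e \<in> Parents" for e
    using p that Parents_in_N unfolding Parents_def Leaves_def by blast
  obtain s where s: "chart_at p s" using chart_exists[OF p(1)] by blast
  have "node_ideal p \<subseteq> {x \<in> PD Parents. resid (pcompose (ev x) s) 0}"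
  proof (rule node_ideal_minimal)
    show "ideal_in (PD Parents) {x \<in> PD Parents. resid (pcompose (ev x) s) 0}"
      unfolding ideal_in_def
    proof (intro conjI ballI)
      show "0 \<in> {x \<in> PD Parents. resid (pcompose (ev x) s) 0}"
        unfolding resid_0_iff by (auto simp: ev_simps polys_in_0 intro!: exI[of _ 0])
    next
      fix x y assume "x \<in> {x \<in> PD Parents. resid (pcompose (ev x) s) 0}" "y \<in> {x \<in> PD Parents. resid (pcompose (ev x) s) 0}"
      then show "x + y \<in> {x \<in> PD Parents. resid (pcompose (ev x) s) 0}"
        using resid_add[of "pcompose (ev x) s" 0 "pcompose (ev y) s" 0]
        by (simp add: ev_simps polys_in_add pcompose_add)
    next
      fix b x assume b: "b \<in> PD Parents"
        and x: "x \<in> {x \<in> PD Parents. resid (pcompose (ev x) s) 0}"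
      obtain g where "resid (pcompose (ev b) s) g" using ev_resid_exists[OF b s order_refl leaf]
        by blast
      then show "b * x \<in> {x \<in> PD Parents. resid (pcompose (ev x) s) 0}"
        using b x resid_mult[of "pcompose (ev b) s" g "pcompose (ev x) s" 0]
        by (simp add: ev_simps polys_in_mult pcompose_mult)
    qed blast
    show "tree_ideal \<subseteq> {x \<in> PD Parents. resid (pcompose (ev x) s) 0}"
      using ideal_inD(1)[OF tree_ideal_ideal] ev_tree_ideal
      by (auto simp: resid_0_iff intro!: exI[of _ 0])
    show "h \<in> {x \<in> PD Parents. resid (pcompose (ev x) s) 0}"
      using h_in resid_HX by (simp add: ev_simps)
    fix e c assume c: "c \<in> Child e" "(c, p) \<in> le"
    then have "resid (pcompose (yv e) s) [:lb c:]" using s unfolding chart_at_def by blast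
    from resid_diff[OF this resid_cc[of "lb c"]]
    have "resid (pcompose (ev (XPar e - cst [:lb c:])) s) 0"
      using Par_Child[OF c(1)] by (simp add: ev_simps ev_XPar pcompose_diff)
    moreover have "XPar e - cst [:lb c:] \<in> PD Parents" using node_gens_subset c by blast
    ultimately show "XPar e - cst [:lb c:] \<in> {x \<in> PD Parents. resid (pcompose (ev x) s) 0}"
      by blast
  qed
  then have J0: "resid (pcompose (ev x) s) 0" if "x \<in> node_ideal p" for x using that by blast
  obtain g where g: "resid (pcompose (ev P) s) g" using ev_resid_exists[OF P(1) s order_refl leaf]
    by blast
  have "pcompose (ev (P ^ n)) s = pcompose (ev P) s ^ n"
    unfolding ev_power by (induction n) (simp_all add: pcompose_mult)
  then have "g ^ n = 0"
    using J0[OF P(2)] resid_power[OF g, of n] resid_unique by metis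
  then have "g = 0" by (cases "n = 0") simp_all
  then have "resid (pcompose (ev P) s) 0" using g by simp
  moreover have "XPar e' - cst [:lb c:] \<in> node_ideal p" if "c \<in> Child e'" "(c, p) \<in> le"
    for e' c
    using node_gens_in that by blast
  ultimately show ?thesis
    using node_gens_in[of p] leaf
    by (intro residue_zero_in_ideal[OF order_refl Anc_sub_Parents p(1) Anc_sub_Parents _ node_ideal_ideal
          _ _ _ P(1) s _ J0]) auto
qed

end

section \<open>Gluing over the children of a node, and descent from the leaves to the root\<close>

context fine_labelled_rooted_tree
begin

text \<open>The factor theorem for the polynomial with roots \<open>lb g\<close>: its value at
  \<open>u\<close> minus its value at \<open>t\<close> is divisible by \<open>u - t\<close>, with a
  quotient in the ring of the tree.\<close>

lemma prod_shift:
  assumes "finite F" and u: "u \<in> PD Parents"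
  shows "\<exists>M\<in>PD Parents. (\<Prod>g\<in>F. u - cst [:lb g:]) - cst [:\<Prod>g\<in>F. t - lb g:] = (u - cst [:t:]) * M"
  using assms(1)
proof (induction F rule: finite_induct)
  case empty
  then show ?case by (intro bexI[of _ 0]) (simp_all add: scalar_hom.f_1 polys_in_0)
next
  case (insert a F)
  let ?P = "\<Prod>g\<in>F. u - cst [:lb g:]" and ?k = "\<Prod>g\<in>F. t - lb g"
  obtain M where M: "M \<in> PD Parents" "?P - cst [:?k:] = (u - cst [:t:]) * M" using insert.IH
    by blast
  have P_in: "?P \<in> PD Parents"
    by (intro subring_set_prod polys_in_subring polys_in_diff u cst_in)
  have P: "(\<Prod>g\<in>insert a F. u - cst [:lb g:]) = (u - cst [:lb a:]) * ?P" using insert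
    by simp
  have "(\<Prod>g\<in>insert a F. t - lb g) = (t - lb a) * ?k" using insert by simp
  then have k: "cst [:\<Prod>g\<in>insert a F. t - lb g:] = cst [:t - lb a:] * cst [:?k:]"
    by (simp only: scalar_hom.f_mult)
  have t: "cst [:t - lb a:] = cst [:t:] - cst [:lb a:]"
    using scalar_hom.f_add[of "t - lb a" "lb a"] unfolding diff_add_cancel
      by (rule eq_diff_eq[THEN iffD2, OF sym])
  have "(u - cst [:lb a:]) * ?P - cst [:t - lb a:] * cst [:?k:]
      = (u - cst [:t:]) * ?P + cst [:t - lb a:] * (?P - cst [:?k:])"
    unfolding t by (simp add: algebra_simps)
  also have "\<dots> = (u - cst [:t:]) * (?P + cst [:t - lb a:] * M)"
    unfolding M(2) by (simp only: distrib_left mult_ac)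
  finally have "(\<Prod>g\<in>insert a F. u - cst [:lb g:]) - cst [:\<Prod>g\<in>insert a F. t - lb g:]
      = (u - cst [:t:]) * (?P + cst [:t - lb a:] * M)" unfolding P k .
  moreover have "?P + cst [:t - lb a:] * M \<in> PD Parents"
    by (intro polys_in_add polys_in_mult cst_in P_in M)
  ultimately show ?case by blast
qed

lemma XPar_in_Parents: "e \<in> N \<Longrightarrow> XPar e \<in> PD Parents"
  by (intro XPar_in Anc_sub_Parents)

lemma node_chain_in: "c \<in> Child e \<Longrightarrow> (c, p) \<in> le \<Longrightarrow> XPar e - cst [:lb c:] \<in> node_ideal p"
  using node_gens_in by blast

text \<open>The counterpart of \<open>resid_rv\<close> modulo the node ideal: on the path each
  factor of \<open>R e\<close> is a nonzero difference of labels.\<close>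

lemma R_cong_scalar:
  assumes "e \<in> N" "(e, p) \<in> le"
  shows "\<exists>k. k \<noteq> 0 \<and> R e - cst [:k:] \<in> node_ideal p"
  using assms
proof (induction rule: tree_induct)
  case root
  show ?case
    by (intro exI[of _ 1]) (simp add: R_root scalar_hom.f_1 ideal_inD(2)[OF node_ideal_ideal])
next
  case (step e)
  note J = node_ideal_ideal[of p]
  have PeN: "Par e \<in> N" by (rule Par_in_N[OF step(1,2)])
  have eC: "e \<in> Child (Par e)" using Child_iff[OF PeN] step by blast
  have "(Par e, p) \<in> le" using le_trans Par_le[OF step(1,2)] step.prems by blast
  then obtain k where k: "k \<noteq> 0" "R (Par e) - cst [:k:] \<in> node_ideal p" using step.IH
    by blast
  let ?S = "S (Par e) {e}" and ?l = "\<Prod>g\<in>Child (Par e) - {e}. lb e - lb g"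
  obtain M where M: "M \<in> PD Parents" "?S - cst [:?l:] = (XPar (Par e) - cst [:lb e:]) * M"
    using prod_shift[OF finite_Diff[OF finite_Child] XPar_in_Parents[OF PeN]] unfolding S_def
      by blast
  have "M * (XPar (Par e) - cst [:lb e:]) \<in> node_ideal p"
    by (intro ideal_inD(4)[OF J M(1)] node_chain_in eC step.prems)
  then have S_cong: "?S - cst [:?l:] \<in> node_ideal p" unfolding M(2) by (simp only: mult.commute)
  have S_in': "?S \<in> PD Parents" by (intro S_in PeN Anc_sub_Parents)
  have "?S * (R (Par e) - cst [:k:]) + cst [:k:] * (?S - cst [:?l:]) \<in> node_ideal p"
    by (intro ideal_inD(3,4)[OF J] S_in' cst_in k S_cong)
  also have "?S * (R (Par e) - cst [:k:]) + cst [:k:] * (?S - cst [:?l:]) = R e - cst [:k * ?l:]"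
    unfolding R_step[OF step(1,2)] scalar_hom.f_mult by (simp add: algebra_simps)
  finally have "R e - cst [:k * ?l:] \<in> node_ideal p" .
  moreover have "k * ?l \<noteq> 0" using k(1) lb_distinct[OF eC] by auto
  ultimately show ?case by blast
qed

text \<open>Modulo the node ideal h vanishes, so \<open>Delta0\<close> makes S_p R_p vanish, and R_p
  is a nonzero scalar. Hence \<open>XPar p\<close> can take only the labels of the children of
  \<open>p\<close> as values: the part of the fiber over \<open>p\<close> splits among them.\<close>

lemma S_in_node_ideal:
  assumes p: "p \<in> Parents" shows "S p {} \<in> node_ideal p"
proof -
  note J = node_ideal_ideal[of p]
  have pN: "p \<in> N" using p Parents_in_N by blast
  obtain k where k: "k \<noteq> 0" "R p - cst [:k:] \<in> node_ideal p"
    using R_cong_scalar[OF pN le_refl[OF pN]] by blast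
  have S: "S p {} \<in> PD Parents" by (intro S_in pN Anc_sub_Parents)
  have D: "h * Xv p - Q p \<in> node_ideal p" using Delta0_in[OF p] node_gens_in by blast
  have "Xv p * h \<in> node_ideal p"
    using node_gens_in[of p] by (intro ideal_inD(4)[OF J Xv_in[OF p]]) blast
  from ideal_in_diff[OF J polys_in_subring this D]
  have "Q p \<in> node_ideal p" by (simp add: mult.commute)
  then have "S p {} * R p \<in> node_ideal p" unfolding Q_def .
  from ideal_in_diff[OF J polys_in_subring this ideal_inD(4)[OF J S k(2)]]
  have "cst [:k:] * S p {} \<in> node_ideal p" by (simp add: algebra_simps)
  from ideal_inD(4)[OF J cst_in this, of "[:inverse k:]"] show ?thesis
    unfolding cst_inverse_cancel[OF k(1)] .
qed

lemma node_ideal_child_mono: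
  assumes q: "q \<in> Child p" shows "node_ideal p \<subseteq> node_ideal q"
proof (rule node_ideal_minimal[OF node_ideal_ideal])
  show "tree_ideal \<subseteq> node_ideal q" "h \<in> node_ideal q" using node_gens_in[of q] by auto
  fix e c assume "c \<in> Child e" "(c, p) \<in> le"
  moreover have "(p, q) \<in> le" using Par_Child[OF q] by blast
  ultimately show "XPar e - cst [:lb c:] \<in> node_ideal q" using node_chain_in le_trans by blast
qed

text \<open>The path to \<open>q\<close> is that to \<open>p\<close> with one more step, so besides
  generators of the ideal at \<open>p\<close> there is only
  \<open>XPar p - cst [:lb q:]\<close>.\<close>

lemma node_ideal_child:
  assumes q: "q \<in> Child p" and x: "x \<in> node_ideal q"
  shows "\<exists>W\<in>PD Parents. x - (XPar p - cst [:lb q:]) * W \<in> node_ideal p"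
proof -
  note J = node_ideal_ideal[of p]
  note pq = Par_Child[OF q]
  let ?L = "XPar p - cst [:lb q:]"
  let ?K = "{x \<in> PD Parents. \<exists>W\<in>PD Parents. x - ?L * W \<in> node_ideal p}"
  have base: "x \<in> ?K" if "x \<in> node_ideal p" for x
    using that ideal_inD(1)[OF J that] polys_in_0 by (auto intro!: bexI[of _ 0])
  have "node_ideal q \<subseteq> ?K"
  proof (rule node_ideal_minimal)
    show "ideal_in (PD Parents) ?K"
      unfolding ideal_in_def
    proof (intro conjI ballI)
      show "0 \<in> ?K" using base ideal_inD(2)[OF J] by blast
    next
      fix x y assume "x \<in> ?K" "y \<in> ?K"
      then obtain W W' where W: "x \<in> PD Parents" "y \<in> PD Parents" "W \<in> PD Parents" "W' \<in> PD Parents"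
        "x - ?L * W \<in> node_ideal p" "y - ?L * W' \<in> node_ideal p" by blast
      have eq: "x + y - ?L * (W + W') = (x - ?L * W) + (y - ?L * W')" by (simp add: algebra_simps)
      have "x + y - ?L * (W + W') \<in> node_ideal p" unfolding eq
        by (rule ideal_inD(3)[OF J W(5,6)])
      then show "x + y \<in> ?K" using W polys_in_add by blast
    next
      fix b x assume b: "b \<in> PD Parents" and "x \<in> ?K"
      then obtain W where W: "x \<in> PD Parents" "W \<in> PD Parents" "x - ?L * W \<in> node_ideal p" by blast
      have eq: "b * (x - ?L * W) = b * x - ?L * (b * W)" unfolding right_diff_distrib
        by (simp only: mult_ac)
      have "b * x - ?L * (b * W) \<in> node_ideal p" unfolding eq[symmetric]
        by (rule ideal_inD(4)[OF J b W(3)])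
      then show "b * x \<in> ?K" using W b polys_in_mult by blast
    qed blast
    show "tree_ideal \<subseteq> ?K" "h \<in> ?K" using base node_gens_in[of p] by auto
    fix e c assume c: "c \<in> Child e" "(c, q) \<in> le"
    show "XPar e - cst [:lb c:] \<in> ?K"
    proof (cases "c = q")
      case True
      have "e = p" using Par_Child[OF c(1)] pq True by simp
      then have "XPar e - cst [:lb c:] - ?L * 1 = 0" using True by simp
      then have "XPar e - cst [:lb c:] - ?L * 1 \<in> node_ideal p" using ideal_inD(2)[OF J]
        by metis
      moreover have "XPar e - cst [:lb c:] \<in> PD Parents" using node_gens_subset c by blast
      ultimately show ?thesis using polys_in_1 by blast
    next
      case False
      then have "(c, p) \<in> le" using le_Par[OF c(2)] pq by simp
      then show ?thesis using base node_chain_in c(1) by blast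
    qed
  qed
  then show ?thesis using x by blast
qed

text \<open>The Chinese remainder theorem: the linear factors that belong to different children are
  comaximal, so \<open>P\<close> is modulo the ideal at \<open>p\<close> a multiple of their
  product, and by \<open>S_in_node_ideal\<close> this product lies in the ideal.\<close>

lemma node_ideal_inter:
  assumes p: "p \<in> Parents" and P: "P \<in> PD Parents"
    and all: "\<And>q. q \<in> Child p \<Longrightarrow> P \<in> node_ideal q"
  shows "P \<in> node_ideal p"
proof -
  note J = node_ideal_ideal[of p]
  note B = polys_in_subring[of "insert None (Some ` Parents)"]
  have pN: "p \<in> N" using p Parents_in_N by blast
  let ?S = "\<lambda>F. \<Prod>g\<in>F. XPar p - cst [:lb g:]"
  have S_in: "?S F \<in> PD Parents" for F
    by (intro subring_set_prod B polys_in_diff XPar_in_Parents pN cst_in)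
  have "\<exists>W\<in>PD Parents. P - ?S F * W \<in> node_ideal p"
    if "finite F" "F \<subseteq> Child p" for F
    using that
  proof (induction F rule: finite_induct)
    case empty
    show ?case using ideal_inD(2)[OF J] P by (intro bexI[of _ P]) simp_all
  next
    case (insert q F)
    let ?L = "XPar p - cst [:lb q:]"
    have qC: "q \<in> Child p" using insert.prems by blast
    have L_in: "?L \<in> PD Parents" by (intro polys_in_diff XPar_in_Parents pN cst_in)
    obtain W where W: "W \<in> PD Parents" "P - ?S F * W \<in> node_ideal p" using insert by blast
    obtain V where V: "V \<in> PD Parents" "P - ?L * V \<in> node_ideal p"
      using node_ideal_child[OF qC all[OF qC]] by blast
    \<comment> \<open>The value at \<open>lb q\<close> of the product over \<open>F\<close>, nonzero
      because labels of siblings differ. Thus the product over \<open>F\<close> equals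
      \<open>k\<close> modulo the new factor, and this is the comaximality used to combine the two
      congruences for \<open>P\<close>.\<close>
    define k where "k = (\<Prod>g\<in>F. lb q - lb g)"
    obtain M where M: "M \<in> PD Parents" "?S F - cst [:k:] = ?L * M"
      using prod_shift[OF insert.hyps(1) XPar_in_Parents[OF pN], of "lb q"] unfolding k_def by blast
    have k: "k \<noteq> 0"
      unfolding k_def using insert lb_distinct[OF qC] by auto
    have 1: "?S F * (P - ?L * V) - ?L * M * (P - ?S F * W) \<in> node_ideal p"
      by (intro ideal_in_diff[OF J B] ideal_inD(4)[OF J] polys_in_mult S_in L_in M V W)
    have ck: "cst [:k:] = ?S F - ?L * M" unfolding M(2)[symmetric] by simp
    have Sq: "?S (insert q F) = ?L * ?S F" using insert.hyps by simp
    have "a * (P - l * V) - l * M * (P - a * W) = (a - l * M) * P - l * a * (V - M * W)" for a l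
      by (simp add: algebra_simps)
    then have "?S F * (P - ?L * V) - ?L * M * (P - ?S F * W)
        = cst [:k:] * P - ?S (insert q F) * (V - M * W)"
      unfolding ck Sq .
    then have "cst [:inverse k:] * (cst [:k:] * P - ?S (insert q F) * (V - M * W)) \<in> node_ideal p"
      using 1 by (intro ideal_inD(4)[OF J cst_in]) simp
    then have "P - ?S (insert q F) * (cst [:inverse k:] * (V - M * W)) \<in> node_ideal p"
      unfolding right_diff_distrib[of "cst [:inverse k:]" "cst [:k:] * P"] cst_inverse_cancel[OF k]
        mult.left_commute[of "cst [:inverse k:]" "?S (insert q F)"] .
    moreover have "cst [:inverse k:] * (V - M * W) \<in> PD Parents"
      by (intro polys_in_mult polys_in_diff cst_in V M W)
    ultimately show ?case by blast
  qed
  from this[OF finite_Child order_refl]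
  obtain W where W: "W \<in> PD Parents" "P - ?S (Child p) * W \<in> node_ideal p" by blast
  have "W * S p {} \<in> node_ideal p" by (intro ideal_inD(4)[OF J W(1)] S_in_node_ideal p)
  then have "?S (Child p) * W \<in> node_ideal p" unfolding S_def by (simp add: mult.commute)
  from ideal_inD(3)[OF J W(2) this] show ?thesis by simp
qed

text \<open>Induction from the leaves towards the root: a power of \<open>P\<close> in the ideal at
  \<open>p\<close> lies in the larger ideals at all children, which gives \<open>P\<close> in each
  of them and, by \<open>node_ideal_inter\<close>, in the ideal at \<open>p\<close>.\<close>

lemma node_ideal_radical:
  assumes "p \<in> N" "P \<in> PD Parents" "P ^ n \<in> node_ideal p"
  shows "P \<in> node_ideal p"
  using assms(1,3)
proof (induction "card {x \<in> N. (p, x) \<in> le}" arbitrary: p rule: less_induct)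
  case less
  show ?case
  proof (cases "p \<in> Parents")
    case False
    then show ?thesis using leaf_node_ideal_radical less.prems assms(2) by blast
  next
    case True
    show ?thesis
    proof (rule node_ideal_inter[OF True assms(2)])
      fix q assume q: "q \<in> Child p"
      note pq = Par_Child[OF q]
      have "{x \<in> N. (q, x) \<in> le} \<subset> {x \<in> N. (p, x) \<in> le}"
      proof
        show "{x \<in> N. (q, x) \<in> le} \<subseteq> {x \<in> N. (p, x) \<in> le}"
          using pq le_trans by blast
        have "p \<in> {x \<in> N. (p, x) \<in> le}" "p \<notin> {x \<in> N. (q, x) \<in> le}"
          using pq le_refl le_antisym by auto
        then show "{x \<in> N. (q, x) \<in> le} \<noteq> {x \<in> N. (p, x) \<in> le}" by blast
      qed
      then have "card {x \<in> N. (q, x) \<in> le} < card {x \<in> N. (p, x) \<in> le}"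
        using finite_nodes by (intro psubset_card_mono) auto
      moreover have "P ^ n \<in> node_ideal q" using node_ideal_child_mono[OF q] less.prems(2)
        by blast
      ultimately show "P \<in> node_ideal q" using less.hyps pq by blast
    qed
  qed
qed

text \<open>No child lies at or below the root, so the ideal at the root is generated by the
  relations and h. Modulo the kernel this is the ideal of h, and its radicality is the reducedness
  of the fiber over the origin.\<close>

lemma origin_fiber_radical:
  assumes P: "P \<in> PD Parents" and C: "C \<in> PD Parents" and eq: "ev P ^ n = HX * ev C"
  shows "\<exists>C'\<in>PD Parents. ev P = HX * ev C'"
proof -
  note J = node_ideal_ideal[of root]
  have "ev (P ^ n - C * h) = 0" using eq by (simp add: ev_simps ev_power)
  moreover have "P ^ n - C * h \<in> PD Parents"
    by (intro polys_in_diff polys_in_mult subring_set_power[OF polys_in_subring] P C h_in)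
  ultimately have "P ^ n - C * h \<in> node_ideal root"
    using kernel_iff node_gens_in by blast
  moreover have "C * h \<in> node_ideal root"
    using node_gens_in[of root] by (intro ideal_inD(4)[OF J C]) blast
  ultimately have "P ^ n - C * h + C * h \<in> node_ideal root" by (rule ideal_inD(3)[OF J])
  then have "P \<in> node_ideal root"
    using node_ideal_radical[OF root_in P, of n] by simp
  moreover have "node_ideal root \<subseteq> {P \<in> PD Parents. \<exists>C'\<in>PD Parents. ev P = HX * ev C'}" (is "_ \<subseteq> ?K")
  proof (rule node_ideal_minimal)
    show "ideal_in (PD Parents) ?K"
      unfolding ideal_in_def
    proof (intro conjI ballI)
      show "0 \<in> ?K" using polys_in_0 by (auto simp: ev_simps intro!: bexI[of _ 0])
    next
      fix x y assume "x \<in> ?K" "y \<in> ?K"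
      then obtain C' C''
        where "x \<in> PD Parents" "y \<in> PD Parents" "C' \<in> PD Parents" "C'' \<in> PD Parents"
        "ev x = HX * ev C'" "ev y = HX * ev C''" by blast
      then show "x + y \<in> ?K"
        by (auto simp: ev_simps polys_in_add distrib_left intro!: bexI[of _ "C' + C''"])
    next
      fix b x assume "b \<in> PD Parents" "x \<in> ?K"
      then obtain C'
        where "b \<in> PD Parents" "x \<in> PD Parents" "C' \<in> PD Parents" "ev x = HX * ev C'"
        by blast
      then show "b * x \<in> ?K"
        by (auto simp: ev_simps polys_in_mult mult_ac intro!: bexI[of _ "b * C'"])
    qed blast
    show "tree_ideal \<subseteq> ?K"
      using ideal_inD(1)[OF tree_ideal_ideal] ev_tree_ideal polys_in_0
      by (auto simp: ev_simps intro!: bexI[of _ 0])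
    show "h \<in> ?K" using h_in polys_in_1 by (auto simp: ev_simps intro!: bexI[of _ 1])
    fix e c assume "c \<in> Child e" "(c, root) \<in> le"
    then show "XPar e - cst [:lb c:] \<in> ?K"
      using Par_Child[of c e] root_le[of c] le_antisym by blast
  qed
  ultimately show ?thesis by blast
qed

section \<open>The surface of the tree\<close>

text \<open>The elements of K[x] whose denominators are powers of h form a ring that is stable under
  division by h, and each variable is evaluated from earlier ones by ring operations and one such
  division.\<close>

lemma ev_denominators:
  assumes "P \<in> PD Parents" shows "\<exists>n u. HX ^ n * ev P = fract_poly u"
proof -
  define Den where "Den = {f. \<exists>n u. HX ^ n * f = fract_poly u}"
  have int: "fract_poly u \<in> Den" for u unfolding Den_def
    by (rule CollectI, rule exI[of _ 0], rule exI[of _ u]) simp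
  have mult: "f * f' \<in> Den" if "f \<in> Den" "f' \<in> Den" for f f'
  proof -
    obtain n u n' u' where "HX ^ n * f = fract_poly u" "HX ^ n' * f' = fract_poly u'"
      using \<open>f \<in> Den\<close> \<open>f' \<in> Den\<close> unfolding Den_def by blast
    then have "HX ^ (n + n') * (f * f') = fract_poly (u * u')"
      unfolding fract_poly_mult
        by (metis (no_types, lifting) mult.assoc mult.left_commute power_add)
    then show ?thesis unfolding Den_def by blast
  qed
  have add: "f + f' \<in> Den" if "f \<in> Den" "f' \<in> Den" for f f'
  proof -
    obtain n u n' u' where "HX ^ n * f = fract_poly u" "HX ^ n' * f' = fract_poly u'"
      using \<open>f \<in> Den\<close> \<open>f' \<in> Den\<close> unfolding Den_def by blast
    then have "fract_poly (hp ^ n' * u + hp ^ n * u') = HX ^ n' * (HX ^ n * f) + HX ^ n * (HX ^ n' * f')"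
      by (simp only: fract_poly_add fract_poly_mult fract_poly_power fract_poly_hp)
    also have "\<dots> = HX ^ (n + n') * (f + f')"
      by (simp add: power_add algebra_simps)
    finally show ?thesis unfolding Den_def by (metis (mono_tags, lifting) mem_Collect_eq)
  qed
  have cc_Den: "[:to_fract a:] \<in> Den" for a using int[of "[:a:]"] by (simp add: map_poly_pCons)
  have one: "1 \<in> Den" using int[of 1] by simp
  have sub: "f - cc a \<in> Den" if "f \<in> Den" for f a
  proof -
    have eq: "f - cc a = f + [:to_fract (- [:a:]):]"
      by (rule poly_eqI) (simp add: coeff_pCons to_fract_uminus del: minus_pCons split: nat.splits)
    show ?thesis unfolding eq by (rule add[OF that cc_Den])
  qed
  have prod: "(\<And>i. i \<in> I \<Longrightarrow> f i \<in> Den) \<Longrightarrow> prod f I \<in> Den" for f and I :: "'a set"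
    by (induction I rule: infinite_finite_induct) (auto intro: one mult)
  have x: "[:0, 1:] \<in> Den" using int[of "[:0, 1:]"] by (simp add: map_poly_pCons)
  have divide: "f \<in> Den" if "HX * f \<in> Den" for f
  proof -
    obtain n u where "HX ^ n * (HX * f) = fract_poly u" using \<open>HX * f \<in> Den\<close>
      unfolding Den_def by blast
    then have "HX ^ Suc n * f = fract_poly u" by (simp only: power_Suc2 mult.assoc)
    then show ?thesis unfolding Den_def by blast
  qed
  have zv_Den: "zv e \<in> Den" if "yv e \<in> Den" "rv e \<in> Den" for e
    by (rule divide) (auto simp: HX_zv intro!: mult prod sub that)
  have yr: "yv e \<in> Den \<and> rv e \<in> Den" if "e \<in> N" for e
    using that
  proof (induction rule: tree_induct)
    case root then show ?case using x one by (simp add: yv_root rv_root)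
  next
    case (step e)
    then show ?case
      using zv_Den[of "Par e"] by (auto simp: yv_step rv_step intro!: mult prod sub)
  qed
  have "ev P \<in> Den"
    using assms
  proof (induction rule: polys_in_induct)
    case (cst a) then show ?case using cc_Den[of a] unfolding cst_def[symmetric]
      by (simp add: ev_simps)
  next
    case (var v)
    have "ev (var v) \<in> Den"
    proof (cases v)
      case None then show ?thesis using x by (simp add: ev_simps)
    next
      case (Some e)
      then have "e \<in> N" using var Parents_in_N by auto
      then show ?thesis unfolding Some Xv_def[symmetric] using yr zv_Den by (simp add: ev_simps)
    qed
    then show ?case unfolding var_def .
  next
    case (add P P') then show ?case
      using \<open>\<And>f f'. f \<in> Den \<Longrightarrow> f' \<in> Den \<Longrightarrow> f + f' \<in> Den\<close> by (simp add: ev_simps)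
  next
    case (mult P P') then show ?case
      using \<open>\<And>f f'. f \<in> Den \<Longrightarrow> f' \<in> Den \<Longrightarrow> f * f' \<in> Den\<close> by (simp add: ev_simps)
  qed
  then show ?thesis unfolding Den_def by blast
qed

lemma leaf_exists: "\<exists>p\<in>N. p \<notin> Parents"
proof -
  have "Max ((\<lambda>y. card (Anc y)) ` N) \<in> (\<lambda>y. card (Anc y)) ` N"
    using finite_nodes nodes_nonempty by (intro Max_in) auto
  then obtain p where p: "p \<in> N" "Max ((\<lambda>y. card (Anc y)) ` N) = card (Anc p)" by blast
  have "x = p" if "x \<in> N" "(p, x) \<in> le" for x
  proof (rule ccontr)
    assume "x \<noteq> p"
    then have "p \<in> Anc x" "p \<notin> Anc p" "Anc p \<subseteq> Anc x"
      using that le_trans le_antisym by (auto simp: Anc_iff)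
    then have "Anc p \<subset> Anc x" by blast
    then have "card (Anc p) < card (Anc x)" by (rule psubset_card_mono[OF finite_Anc])
    moreover have "card (Anc x) \<le> Max ((\<lambda>y. card (Anc y)) ` N)"
      using that finite_nodes by (intro Max_ge) auto
    ultimately show False using p(2) by simp
  qed
  then show ?thesis using p(1) unfolding Parents_def Leaves_def by blast
qed

text \<open>On a coset of \<open>tree_ideal\<close> the map \<open>ev\<close> is constant, so the
  image is a singleton; by \<open>kernel_iff\<close> the resulting map is injective on the
  quotient.\<close>

definition emb :: "'a tree_poly set \<Rightarrow> KX" where
  "emb U = the_elem (ev ` U)"

lemma ev_ring_hom: "ring_hom_ring poly_ring_tree (ring_of_type_algebra :: KX ring) ev"
  using poly_ring_tree_cring ring_from_type_algebra
  by (auto intro!: ring_hom_ringI2 ring_hom_memI simp: cring_def poly_ring_tree_simps ev_simps)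

lemma kernel_ev: "a_kernel poly_ring_tree (ring_of_type_algebra :: KX ring) ev = tree_ideal"
  using kernel_iff ideal_inD(1)[OF tree_ideal_ideal]
  by (auto simp: a_kernel_def' poly_ring_tree_simps)

lemma emb_coset: "P \<in> PD Parents \<Longrightarrow> emb (tree_ideal +>\<^bsub>poly_ring_tree\<^esub> P) = ev P"
  unfolding emb_def using ring_hom_ring.the_elem_simp[OF ev_ring_hom, of P]
  unfolding kernel_ev by (simp add: poly_ring_tree_simps)

lemma tree_ring_coset: "U \<in> carrier tree_ring \<Longrightarrow> \<exists>P\<in>PD Parents. U = tree_ideal +>\<^bsub>poly_ring_tree\<^esub> P"
  unfolding tree_ring_def using ring_hom_ring.quot_mem[OF ev_ring_hom, of U]
  unfolding kernel_ev poly_ring_tree_simps .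

lemma coset_hom: "ring_hom_cring poly_ring_tree tree_ring ((+>\<^bsub>poly_ring_tree\<^esub>) tree_ideal)"
  unfolding tree_ring_def
  using ideal.rcos_ring_hom_cring[OF _ poly_ring_tree_cring] tree_ideal_ideal ideal_in_iff by blast

lemma tree_ring_finitely_generated:
  "\<exists>F. finite F \<and> F \<subseteq> carrier tree_ring \<and>
    generate_ring tree_ring (range (\<lambda>c. tree_proj [:c:]) \<union> F) = carrier tree_ring"
proof -
  interpret \<pi>: ring_hom_cring poly_ring_tree tree_ring "(+>\<^bsub>poly_ring_tree\<^esub>) tree_ideal" by (rule coset_hom)
  let ?\<pi> = "\<lambda>P. tree_ideal +>\<^bsub>poly_ring_tree\<^esub> P"
  \<comment> \<open>The base consists of the complex constants only, so h has to be listed among the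
    generators.\<close>
  define F where "F = ?\<pi> ` (insert h (var ` insert None (Some ` Parents)))"
  have closed: "?\<pi> P \<in> carrier tree_ring" if "P \<in> PD Parents" for P
    using \<pi>.hom_closed that unfolding poly_ring_tree_simps .
  have hom: "?\<pi> (P + P') = ?\<pi> P \<oplus>\<^bsub>tree_ring\<^esub> ?\<pi> P'" "?\<pi> (P * P') = ?\<pi> P \<otimes>\<^bsub>tree_ring\<^esub> ?\<pi> P'"
    if "P \<in> PD Parents" "P' \<in> PD Parents" for P P'
    using \<pi>.hom_add[of P P'] \<pi>.hom_mult[of P P'] that unfolding poly_ring_tree_simps
      by blast+
  have "finite Parents" using finite_nodes Parents_in_N by (meson finite_subset subsetI)
  then have finF: "finite F" unfolding F_def by simp
  have F_sub: "F \<subseteq> carrier tree_ring"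
    unfolding F_def using h_in var_in by (auto intro!: closed)
  let ?K = "range (\<lambda>c. tree_proj [:c:])"
  have K_sub: "?K \<subseteq> carrier tree_ring" unfolding tree_proj_def using cst_in
    by (auto intro!: closed)
  let ?G = "generate_ring tree_ring (?K \<union> F)"
  have "?\<pi> P \<in> ?G" if "P \<in> PD Parents" for P
    using that
  proof (induction rule: polys_in_induct)
    case (cst a)
    have "?\<pi> (cst a) \<in> ?G"
    proof (induction a)
      case 0
      have "?\<pi> (cst [:0:]) \<in> ?K" unfolding tree_proj_def by blast
      then have "?\<pi> (cst [:0:]) \<in> ?G" by (intro generate_ring.incl) blast
      then show ?case by simp
    next
      case (pCons c a)
      have "pCons c a = [:c:] + [:0, 1:] * a" by simp
      then have "cst (pCons c a) = cst [:c:] + h * cst a" unfolding h_def by (simp only: cst_simps)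
      then have "?\<pi> (cst (pCons c a)) = ?\<pi> (cst [:c:]) \<oplus>\<^bsub>tree_ring\<^esub> ?\<pi> h \<otimes>\<^bsub>tree_ring\<^esub> ?\<pi> (cst a)"
        using hom cst_in h_in polys_in_mult by metis
      moreover have "?\<pi> (cst [:c:]) \<in> ?G" "?\<pi> h \<in> ?G"
        unfolding F_def tree_proj_def by (intro generate_ring.incl; blast)+
      ultimately show ?case
        using pCons by (auto intro: generate_ring.eng_add generate_ring.eng_mult)
    qed
    then show ?case unfolding cst_def .
  next
    case (var v)
    then have "?\<pi> (var v) \<in> ?G" unfolding F_def by (intro generate_ring.incl) blast
    then show ?case unfolding var_def .
  next
    case (add P P')
    then show ?case unfolding hom(1)[OF add(1,2)] by (intro generate_ring.eng_add)
  next
    case (mult P P')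
    then show ?case unfolding hom(2)[OF mult(1,2)] by (intro generate_ring.eng_mult)
  qed
  then have "carrier tree_ring \<subseteq> ?G" using tree_ring_coset by blast
  moreover have "?G \<subseteq> carrier tree_ring"
    by (rule ring.generate_ring_incl[OF \<pi>.S.ring_axioms Un_least[OF K_sub F_sub]])
  ultimately show ?thesis using finF F_sub by blast
qed

text \<open>The chart at a leaf \<open>p\<close> serves: no node of \<open>Parents\<close> lies
  above \<open>p\<close>, so all of B is regular there, and \<open>XPar p\<close> supplies the
  element with nonconstant residue.\<close>

lemma tree_model: "\<exists>\<sigma> \<tau>. danielewski_model tree_ring tree_proj emb \<sigma> \<tau>"
proof -
  interpret \<pi>: ring_hom_cring poly_ring_tree tree_ring "(+>\<^bsub>poly_ring_tree\<^esub>) tree_ideal" by (rule coset_hom)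
  let ?\<pi> = "\<lambda>P. tree_ideal +>\<^bsub>poly_ring_tree\<^esub> P"
  have closed: "?\<pi> P \<in> carrier tree_ring" if "P \<in> PD Parents" for P
    using \<pi>.hom_closed that unfolding poly_ring_tree_simps .
  obtain p where p: "p \<in> N" "p \<notin> Parents" using leaf_exists by blast
  have leaf: "(p, e) \<notin> le" if "e \<in> Parents" for e
    using p that Parents_in_N unfolding Parents_def Leaves_def by blast
  obtain s where s: "chart_at p s" using chart_exists[OF p(1)] by blast
  obtain \<sigma> \<tau> where st: "\<tau> \<noteq> 0" "s = fract_poly [:\<sigma>, \<tau>:]" using s
    unfolding chart_at_def by blast
  have "danielewski_model tree_ring tree_proj emb \<sigma> \<tau>"
  proof
    show "emb \<in> ring_hom tree_ring ring_of_type_algebra"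
      using ring_hom_ring.the_elem_hom[OF ev_ring_hom]
        unfolding kernel_ev emb_def[abs_def] tree_ring_def .
    show "inj_on emb (carrier tree_ring)"
      using ring_hom_ring.the_elem_inj[OF ev_ring_hom]
        unfolding kernel_ev emb_def[abs_def] tree_ring_def
      by (intro inj_onI)
    show "tree_proj a \<in> carrier tree_ring" for a unfolding tree_proj_def
      by (rule closed[OF cst_in])
    show "emb (tree_proj a) = [:to_fract a:]" for a
      unfolding tree_proj_def emb_coset[OF cst_in] by (simp add: ev_simps)
    have "var None \<in> PD Parents" by (rule var_in) simp
    then have "emb (?\<pi> (var None)) = [:0, 1:]" "?\<pi> (var None) \<in> carrier tree_ring"
      using closed by (simp_all add: emb_coset ev_simps)
    then show "[:0, 1:] \<in> emb ` carrier tree_ring" by (metis imageI)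
    show "\<exists>n u. HX ^ n * emb b = fract_poly u" if b: "b \<in> carrier tree_ring" for b
      using tree_ring_coset[OF b] emb_coset ev_denominators by metis
    show "\<exists>d\<in>carrier tree_ring. emb b = HX * emb d"
      if bc: "b \<in> carrier tree_ring" "c \<in> carrier tree_ring" "emb b ^ n = HX * emb c"
        for b c n
    proof -
      obtain P C where P: "P \<in> PD Parents" "b = ?\<pi> P"
        and C: "C \<in> PD Parents" "c = ?\<pi> C"
        using tree_ring_coset bc(1,2) by meson
      obtain C' where C': "C' \<in> PD Parents" "ev P = HX * ev C'"
        using origin_fiber_radical[OF P(1) C(1), of n] bc(3)
          unfolding P(2) C(2) emb_coset[OF P(1)] emb_coset[OF C(1)] by blast
      then show ?thesis
        unfolding P(2) emb_coset[OF P(1)] using closed[OF C'(1)] emb_coset[OF C'(1)]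
          by (intro bexI[of _ "?\<pi> C'"]) simp_all
    qed
    show "\<tau> \<noteq> 0" by (rule st(1))
    show "\<exists>u. pcompose (emb b) (fract_poly [:\<sigma>, \<tau>:]) = fract_poly u" if b: "b \<in> carrier tree_ring" for b
    proof -
      obtain P where P: "P \<in> PD Parents" "b = ?\<pi> P" using tree_ring_coset[OF b] by blast
      obtain g where "resid (pcompose (ev P) s) g" using ev_resid_exists[OF P(1) s order_refl leaf]
        by blast
      then show ?thesis unfolding P(2) emb_coset[OF P(1)] st(2)[symmetric] resid_def by blast
    qed
    have XP: "XPar p \<in> PD Parents" by (rule XPar_in_Parents[OF p(1)])
    have "\<exists>d c0. c0 \<noteq> 0 \<and> resid (pcompose (emb (?\<pi> (XPar p))) (fract_poly [:\<sigma>, \<tau>:])) [:d, c0:]"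
      unfolding emb_coset[OF XP] ev_XPar[OF p(1)] st(2)[symmetric] using s unfolding chart_at_def
        by blast
    then show "\<exists>b\<in>carrier tree_ring. \<exists>d c0. c0 \<noteq> 0 \<and> resid (pcompose (emb b) (fract_poly [:\<sigma>, \<tau>:])) [:d, c0:]"
      using closed[OF XP] by blast
    show "\<exists>F. finite F \<and> F \<subseteq> carrier tree_ring \<and>
      generate_ring tree_ring (range (\<lambda>c. tree_proj [:c:]) \<union> F) = carrier tree_ring"
      by (rule tree_ring_finitely_generated)
  qed
  then show ?thesis by blast
qed

end

theorem theorem0p1:
  fixes N :: "'a set" and le :: "'a rel" and root :: 'a and lb :: "'a \<Rightarrow> complex"
  assumes "fine_labelled_rooted_tree N le root lb"
  shows "generalized_danielewski_surface TYPE('m)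
    (fine_labelled_rooted_tree.tree_ring N le root lb)
    (fine_labelled_rooted_tree.tree_proj N le root lb)"
  using fine_labelled_rooted_tree.tree_model[OF assms]
    danielewski_model.is_generalized_danielewski_surface by blast

end
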